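(* Suppose that $g\in H^\infty(\mathbb{B}^d)$ with $\|g\|_\infty\le1$ and $\mathrm{Re}(g(z))\ge0$ for $z\in\mathbb{B}^d$, and suppose that there exists $\varepsilon>0$ such that $w(\zeta):=|g(\zeta)|^2\ge\varepsilon$ for $\sigma$-a.e. $\zeta\in\partial\mathbb{B}^d$. Let $\mu_{\mathrm{s}}$ be a discrete measure on $\partial\mathbb{B}^d$ such that $d\mu(\zeta)=w(\zeta)\,d\sigma(\zeta)+d\mu_{\mathrm{s}}(\zeta)$ is a probability measure on $\partial\mathbb{B}^d$, and let $(\gamma_{\alpha,\beta})_{\alpha,\beta\in\mathbb{N}_0^d}$ be the Verblunsky coefficients of $\mu$. Then $$\prod_{\alpha\in\mathbb{N}_0^d}(1-|\gamma_{0,\alpha}|^2)=\exp\left(\int_{\partial\mathbb{B}^d}\log(w(\zeta))\,d\sigma(\zeta)\right)>0.$$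
   Context: $\mathbb{B}^d$ is the open unit ball of $\mathbb{C}^d$, $\partial\mathbb{B}^d$ the unit sphere, $\sigma$ the rotation-invariant Lebesgue probability measure on $\partial\mathbb{B}^d$. $H^\infty(\mathbb{B}^d)$ is the space of bounded holomorphic functions on $\mathbb{B}^d$ with sup norm $\|\cdot\|_\infty$; for $\sigma$-a.e. $\zeta$, $g(\zeta)$ denotes the $K$-limit of $g$ at $\zeta$ (limit as $z\to\zeta$ within each Kor\'anyi region $\{z\in\mathbb{B}^d:|1-\langle z,\zeta\rangle|<\frac c2(1-\|z\|^2)\}$, $c>1$), which exists $\sigma$-a.e. and coincides with the radial limit. A measure is discrete if it is a countable sum $\sum_k\rho_k\delta_{\zeta_k}$, $\rho_k>0$, of point masses (possibly zero). Shortlex order $\prec$ on $\mathbb{N}_0^d$: $\alpha\prec\beta$ if $|\alpha|<|\beta|$ (where $|\alpha|=\sum\alpha_i$), or if $|\alpha|=|\beta|$ and $\alpha_i>\beta_i$ at the first index where they differ. Infinite products over $\mathbb{N}_0^d$ are limits of partial products in this order. Verblunsky coefficients of $\mu$: let $K(\alpha,\beta)=\int_{\partial\mathbb{B}^d}\zeta^\alpha\overline{\zeta}^\beta d\mu$ (its finite sections are positive definite here). For $\alpha\prec\beta$ let $S=\{\delta:\alpha\prec\delta\prec\beta\}$, $M=[K(\delta,\delta')]_{\delta,\delta'\in S}$, $u=[K(\alpha,\delta)]_{\delta\in S}$ (row), $v=[K(\delta,\beta)]_{\delta\in S}$ (column), and $$\gamma_{\alpha,\beta}=\frac{K(\alpha,\beta)-uM^{-1}v}{\sqrt{K(\alpha,\alpha)-uM^{-1}u^*}\,\sqrt{K(\beta,\beta)-v^*M^{-1}v}},$$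 where terms involving $M$ are omitted if $S=\emptyset$; $\gamma_{\alpha,\alpha}=0$, $\gamma_{\beta,\alpha}=\overline{\gamma_{\alpha,\beta}}$. *)

theory Defs
  imports "HOL-Probability.Probability"
begin

text \<open>
  Throughout, \<open>\<complex>\<^sup>d\<close> is \<open>complex ^ 'd\<close> and \<open>\<nat>\<^sub>0\<^sup>d\<close> is \<open>nat ^ 'd\<close>, where \<open>'d\<close> is an arbitrary finite
  linearly ordered index type; the order on \<open>'d\<close> (that of the coordinates \<open>1, \<dots>, d\<close>) enters only
  through the shortlex order. The library norm on \<open>complex ^ 'd\<close> is the Euclidean one.
\<close>

section \<open>Bounded holomorphic functions on the unit ball and their K-limits\<close>

text \<open>The library inner product on \<open>complex ^ 'd\<close> is the real one.\<close>

definition cinner :: "complex ^ 'd \<Rightarrow> complex ^ 'd \<Rightarrow> complex" where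
  "cinner z \<zeta> = (\<Sum>i\<in>UNIV. z $ i * cnj (\<zeta> $ i))"

text \<open>A \<open>has_derivative\<close> derivative is real linear; homogeneity makes it complex linear.\<close>

definition holomorphic_Cn_on :: "(complex ^ 'd \<Rightarrow> complex) \<Rightarrow> (complex ^ 'd) set \<Rightarrow> bool" where
  "holomorphic_Cn_on f U \<longleftrightarrow>
     (\<forall>z\<in>U. \<exists>D. (f has_derivative D) (at z) \<and> (\<forall>c v. D (c *s v) = c * D v))"

definition H_infinity :: "(complex ^ 'd \<Rightarrow> complex) set" where
  "H_infinity = {g. holomorphic_Cn_on g (ball 0 1) \<and> bounded (g ` ball 0 1)}"

definition H_infinity_norm :: "(complex ^ 'd \<Rightarrow> complex) \<Rightarrow> real" where
  "H_infinity_norm g = (SUP z\<in>ball 0 1. cmod (g z))"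

definition koranyi_region :: "real \<Rightarrow> complex ^ 'd \<Rightarrow> (complex ^ 'd) set" where
  "koranyi_region c \<zeta> =
     {z \<in> ball 0 1. cmod (1 - cinner z \<zeta>) < c / 2 * (1 - (norm z)\<^sup>2)}"

definition has_K_limit :: "(complex ^ 'd \<Rightarrow> complex) \<Rightarrow> complex ^ 'd \<Rightarrow> complex \<Rightarrow> bool" where
  "has_K_limit g \<zeta> L \<longleftrightarrow> (\<forall>c>1. (g \<longlongrightarrow> L) (at \<zeta> within koranyi_region c \<zeta>))"

text \<open>
  Where no K-limit exists, the value is a fixed unspecified constant; for \<open>g\<close> in \<open>H_infinity\<close>
  this happens only on a null set of the sphere.
\<close>

definition K_limit :: "(complex ^ 'd \<Rightarrow> complex) \<Rightarrow> complex ^ 'd \<Rightarrow> complex" where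
  "K_limit g \<zeta> = (THE L. has_K_limit g \<zeta> L)"

section \<open>Measures on the unit sphere\<close>

definition sphere_borel :: "(complex ^ 'd) measure" where
  "sphere_borel = restrict_space borel (sphere 0 1)"

text \<open>
  Normalised surface measure in polar coordinates: the measure of \<open>A\<close> is the proportion of the
  ball's volume taken up by the cone over \<open>A\<close>. (The null set \<open>{0}\<close> is the only part of the ball
  that \<open>sgn\<close> does not send to the sphere.) It is a probability measure invariant under all
  orthogonal transformations of the underlying real space, in particular under unitary ones:
  \<open>prob_space_sphere_measure\<close>, \<open>distr_sphere_measure_orthogonal\<close>.
\<close>

definition sphere_measure :: "(complex ^ 'd) measure" where
  "sphere_measure =
     restrict_space (distr (uniform_measure lborel (ball 0 1)) borel sgn) (sphere 0 1)"

lemma emeasure_orthogonal_image_ge: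
  fixes f :: "'a::euclidean_space \<Rightarrow> 'a"
  assumes f: "orthogonal_transformation f" and V: "open V"
  shows "emeasure lborel V \<le> emeasure lborel (f ` V)"
proof -
  have bij: "bij f" using f orthogonal_transformation_bij by blast
  have lin: "linear f" using f orthogonal_transformation_linear by blast
  define K where "K = {(a, r). 0 < r \<and> ball a r \<subseteq> V}"
  obtain C where C: "countable C" "C \<subseteq> K"
     "pairwise (\<lambda>i j. disjnt (ball (fst i) (snd i)) (ball (fst j) (snd j))) C"
     "negligible (V - (\<Union>i\<in>C. ball (fst i) (snd i)))"
  proof (rule Vitali_covering_theorem_balls[of V K fst snd])
    fix x and d :: real assume "x \<in> V" "0 < d"
    obtain e where e: "e > 0" "ball x e \<subseteq> V" using V \<open>x \<in> V\<close> openE by blast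
    have "ball x (min e (d / 2)) \<subseteq> V" using e by auto
    then show "\<exists>i. i \<in> K \<and> x \<in> ball (fst i) (snd i) \<and> snd i < d"
      using e \<open>0 < d\<close> by (intro exI[of _ "(x, min e (d / 2))"]) (auto simp: K_def)
  qed auto
  let ?U = "\<Union>i\<in>C. ball (fst i) (snd i)"
  have fb: "f ` ball a r = ball (f a) r" for a r
    using image_orthogonal_transformation_ball[OF f] .
  have U: "?U \<subseteq> V" using C(2) by (force simp: K_def)
  have oU: "open ?U" by blast
  have "V - ?U \<in> null_sets lborel"
    using C(4) V oU by (auto simp: negligible_iff_null_sets null_sets_completion_iff)
  then have "emeasure lborel V = emeasure lborel ?U"
    using U V oU emeasure_Un_null_set[of ?U lborel "V - ?U"] by (simp add: Un_absorb1)
  also have "\<dots> = (\<integral>\<^sup>+i. emeasure lborel (ball (fst i) (snd i)) \<partial>count_space C)"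
    using C by (intro emeasure_UN_countable) (auto simp: disjoint_family_on_def pairwise_def disjnt_def)
  also have "\<dots> = (\<integral>\<^sup>+i. emeasure lborel (ball (f (fst i)) (snd i)) \<partial>count_space C)"
    using C(2) by (intro nn_integral_cong) (auto simp: K_def emeasure_ball)
  also have "\<dots> = emeasure lborel (\<Union>i\<in>C. f ` ball (fst i) (snd i))"
    unfolding fb[symmetric]
  proof (intro emeasure_UN_countable[symmetric])
    show "f ` ball (fst i) (snd i) \<in> sets lborel" for i by (simp add: fb)
    show "disjoint_family_on (\<lambda>i. f ` ball (fst i) (snd i)) C"
      using C(3) by (simp add: disjoint_family_on_def pairwise_def disjnt_def
                          flip: image_Int[OF bij_is_inj[OF bij]])
  qed fact
  also have "\<dots> \<le> emeasure lborel (f ` V)"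
  proof (rule emeasure_mono)
    have "open (f ` V)" using V bij lin by (simp add: open_surjective_linear_image bij_is_surj)
    then show "f ` V \<in> sets lborel" by simp
  qed (use U in blast)
  finally show ?thesis .
qed

lemma distr_lborel_orthogonal:
  fixes f :: "'a::euclidean_space \<Rightarrow> 'a"
  assumes f: "orthogonal_transformation f"
  shows "distr lborel borel f = lborel"
proof (rule lborel_eqI[symmetric])
  have bij: "bij f" using f orthogonal_transformation_bij by blast
  have cont: "continuous_on UNIV f"
    using f orthogonal_transformation_linear linear_continuous_on linear_conv_bounded_linear by blast
  then have [measurable]: "f \<in> borel_measurable borel" by (rule borel_measurable_continuous_onI)
  fix l u :: 'a assume lu: "\<And>b. b \<in> Basis \<Longrightarrow> l \<bullet> b \<le> u \<bullet> b"
  have eq: "f -` box l u = inv f ` box l u" using bij by (simp add: bij_vimage_eq_inv_image)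
  have "open (f -` box l u)" using cont by (intro open_vimage) auto
  then have "emeasure lborel (f -` box l u) \<le> emeasure lborel (f ` (f -` box l u))"
    by (rule emeasure_orthogonal_image_ge[OF f])
  also have "f ` (f -` box l u) = box l u" using bij by (simp add: bij_is_surj)
  finally have "emeasure lborel (f -` box l u) \<le> emeasure lborel (box l u)" .
  moreover have "emeasure lborel (box l u) \<le> emeasure lborel (f -` box l u)"
    unfolding eq by (rule emeasure_orthogonal_image_ge) (auto intro: orthogonal_transformation_inv f)
  ultimately show "emeasure (distr lborel borel f) (box l u) = (\<Prod>b\<in>Basis. (u - l) \<bullet> b)"
    using lu by (simp add: emeasure_distr emeasure_lborel_box)
qed simp

lemma space_sphere_measure: "space sphere_measure = sphere 0 1"
  by (simp add: sphere_measure_def space_restrict_space)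

lemma sets_sphere_measure: "sets sphere_measure = sets sphere_borel"
  by (simp add: sphere_measure_def sphere_borel_def sets_restrict_space)

lemma emeasure_sphere_measure:
  fixes A :: "(complex ^ 'd) set"
  assumes "A \<in> sets sphere_borel"
  shows "emeasure sphere_measure A = emeasure lborel (ball 0 1 \<inter> sgn -` A) / emeasure lborel (ball (0 :: complex ^ 'd) 1)"
proof -
  have A: "A \<in> sets borel" "A \<subseteq> sphere 0 1"
    using assms by (auto simp: sphere_borel_def sets_restrict_space)
  have [measurable]: "(sgn :: complex ^ 'd \<Rightarrow> _) \<in> borel_measurable borel"
    unfolding sgn_div_norm[abs_def] by measurable
  have "sgn -` A \<in> sets (borel :: (complex ^ 'd) measure)"
    using measurable_sets[OF \<open>sgn \<in> _\<close> A(1)] by simp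
  with A show ?thesis
    by (simp add: sphere_measure_def emeasure_restrict_space emeasure_distr emeasure_uniform_measure)
qed

lemma prob_space_sphere_measure: "prob_space (sphere_measure :: (complex ^ 'd) measure)"
proof
  let ?B = "ball (0 :: complex ^ 'd) 1"
  have "sphere 0 1 \<in> sets (sphere_borel :: (complex ^ 'd) measure)"
    by (auto simp: sphere_borel_def sets_restrict_space)
  then have "emeasure sphere_measure (sphere (0 :: complex ^ 'd) 1) = emeasure lborel (?B \<inter> sgn -` sphere 0 1) / emeasure lborel ?B"
    by (rule emeasure_sphere_measure)
  also have "?B \<inter> sgn -` sphere 0 1 = ?B - {0}" by (auto simp: norm_sgn)
  also have "emeasure lborel (?B - {0}) = emeasure lborel ?B"
    by (rule emeasure_Diff_null_set) auto
  also have "\<dots> / \<dots> = 1"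
    using unit_ball_vol_pos[of "real CARD('d) * 2"]
    by (intro ennreal_divide_self) (simp_all add: emeasure_lborel_ball_finite emeasure_ball less_imp_neq[THEN not_sym])
  finally show "emeasure sphere_measure (space (sphere_measure :: (complex ^ 'd) measure)) = 1"
    unfolding space_sphere_measure .
qed

lemma distr_sphere_measure_orthogonal:
  fixes f :: "complex ^ 'd \<Rightarrow> complex ^ 'd"
  assumes f: "orthogonal_transformation f"
  shows "distr sphere_measure sphere_borel f = sphere_measure"
proof (rule measure_eqI)
  fix A assume "A \<in> sets (distr sphere_measure sphere_borel f)"
  then have A: "A \<in> sets sphere_borel" by simp
  have lin: "linear f" using f orthogonal_transformation_linear by blast
  have n: "norm (f x) = norm x" for x using f orthogonal_transformation_norm by blast
  have [measurable]: "f \<in> borel_measurable borel"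
    using lin by (intro borel_measurable_continuous_onI linear_continuous_on)
                 (simp add: linear_conv_bounded_linear)
  have [measurable]: "(sgn :: complex ^ 'd \<Rightarrow> _) \<in> borel_measurable borel"
    unfolding sgn_div_norm[abs_def] by measurable
  have fm: "f \<in> measurable sphere_measure sphere_borel"
    unfolding measurable_cong_sets[OF sets_sphere_measure refl]
    unfolding sphere_borel_def
    by (intro measurable_restrict_space2 measurable_restrict_space1) (auto simp: space_restrict_space n)
  have A': "f -` A \<inter> sphere 0 1 \<in> sets sphere_borel"
    using measurable_sets[OF fm A] by (simp add: space_sphere_measure sets_sphere_measure)
  have Ab: "A \<in> sets borel" "A \<subseteq> sphere 0 1"
    using A by (auto simp: sphere_borel_def sets_restrict_space)
  have m: "ball 0 1 \<inter> sgn -` A \<in> sets (borel :: (complex ^ 'd) measure)"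
    using measurable_sets[OF \<open>sgn \<in> _\<close> Ab(1)] by simp
  have "sgn (f x) = f (sgn x)" for x
    using lin by (simp add: sgn_div_norm n linear_scale)
  then have "ball 0 1 \<inter> sgn -` (f -` A \<inter> sphere 0 1) = f -` (ball 0 1 \<inter> sgn -` A)"
    using Ab(2) n by (auto simp: subset_iff norm_sgn)
  moreover have "emeasure lborel (f -` (ball 0 1 \<inter> sgn -` A)) = emeasure (distr lborel borel f) (ball 0 1 \<inter> sgn -` A)"
    using m by (simp add: emeasure_distr)
  ultimately show "emeasure (distr sphere_measure sphere_borel f) A = emeasure sphere_measure A"
    using fm A A'
    by (simp add: emeasure_distr space_sphere_measure emeasure_sphere_measure distr_lborel_orthogonal[OF f])
qed (simp add: sets_sphere_measure)

definition discrete_sphere_measure :: "(complex ^ 'd) measure \<Rightarrow> bool" where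
  "discrete_sphere_measure \<nu> \<longleftrightarrow> sets \<nu> = sets sphere_borel \<and>
     (\<exists>(I :: nat set) (\<rho> :: nat \<Rightarrow> real) \<zeta>. (\<forall>k\<in>I. \<rho> k > 0 \<and> \<zeta> k \<in> sphere 0 1) \<and>
        (\<forall>A\<in>sets \<nu>. emeasure \<nu> A =
           (\<Sum>\<^sub>\<infinity>k\<in>I. ennreal (\<rho> k) * emeasure (return sphere_borel (\<zeta> k)) A)))"

section \<open>The shortlex order\<close>

definition shortlex :: "nat ^ 'd::{finite,linorder} \<Rightarrow> nat ^ 'd::{finite,linorder} \<Rightarrow> bool" (infix "\<prec>\<^sub>s" 50) where
  "\<alpha> \<prec>\<^sub>s \<beta> \<longleftrightarrow>
     (\<Sum>i\<in>UNIV. \<alpha> $ i) < (\<Sum>i\<in>UNIV. \<beta> $ i) \<or>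
     (\<Sum>i\<in>UNIV. \<alpha> $ i) = (\<Sum>i\<in>UNIV. \<beta> $ i) \<and>
       (\<exists>i. (\<forall>j<i. \<alpha> $ j = \<beta> $ j) \<and> \<alpha> $ i > \<beta> $ i)"

text \<open>
  The multi-index at position \<open>n\<close> is the one with exactly \<open>n\<close> predecessors;
  \<open>shortlex_enum_less_iff\<close> and \<open>bij_shortlex_enum\<close> below say that this is the increasing
  enumeration of all multi-indices.
\<close>

definition shortlex_enum :: "nat \<Rightarrow> nat ^ 'd::{finite,linorder}" where
  "shortlex_enum n = (THE \<alpha>. card {\<beta>. \<beta> \<prec>\<^sub>s \<alpha>} = n)"

lemma shortlex_irrefl: "\<not> \<alpha> \<prec>\<^sub>s \<alpha>"
  by (auto simp: shortlex_def)

lemma shortlex_trans: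
  assumes "\<alpha> \<prec>\<^sub>s \<beta>" "\<beta> \<prec>\<^sub>s \<gamma>" shows "\<alpha> \<prec>\<^sub>s \<gamma>"
proof (cases "(\<Sum>i\<in>UNIV. \<alpha> $ i) = (\<Sum>i\<in>UNIV. \<beta> $ i) \<and> (\<Sum>i\<in>UNIV. \<beta> $ i) = (\<Sum>i\<in>UNIV. \<gamma> $ i)")
  case True
  then obtain i j where i: "\<forall>k<i. \<alpha> $ k = \<beta> $ k" "\<alpha> $ i > \<beta> $ i"
    and j: "\<forall>k<j. \<beta> $ k = \<gamma> $ k" "\<beta> $ j > \<gamma> $ j"
    using assms by (auto simp: shortlex_def)
  have "(\<forall>k<min i j. \<alpha> $ k = \<gamma> $ k) \<and> \<alpha> $ (min i j) > \<gamma> $ (min i j)"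
    using i j by (cases i j rule: linorder_cases) (auto simp: min_def)
  then show ?thesis using True unfolding shortlex_def by metis
next
  case False
  then show ?thesis using assms by (auto simp: shortlex_def)
qed

lemma shortlex_total:
  assumes "\<alpha> \<noteq> \<beta>" shows "\<alpha> \<prec>\<^sub>s \<beta> \<or> \<beta> \<prec>\<^sub>s \<alpha>"
proof (cases "(\<Sum>i\<in>UNIV. \<alpha> $ i) = (\<Sum>i\<in>UNIV. \<beta> $ i)")
  case True
  define D where "D = {i. \<alpha> $ i \<noteq> \<beta> $ i}"
  have "D \<noteq> {}" using assms by (auto simp: D_def vec_eq_iff)
  then have M: "Min D \<in> D" by simp
  have "\<forall>k<Min D. \<alpha> $ k = \<beta> $ k"
    by (metis (mono_tags, lifting) D_def Min.coboundedI finite leD mem_Collect_eq)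
  with M True show ?thesis
    unfolding shortlex_def D_def by (metis (mono_tags, lifting) mem_Collect_eq neqE)
next
  case False
  then show ?thesis by (auto simp: shortlex_def)
qed

lemma finite_shortlex_below: "finite {\<beta>. \<beta> \<prec>\<^sub>s \<alpha>}"
proof (rule finite_subset)
  show "{\<beta>. \<beta> \<prec>\<^sub>s \<alpha>} \<subseteq> vec_lambda ` (PiE UNIV (\<lambda>_. {..(\<Sum>i\<in>UNIV. \<alpha> $ i)}))"
  proof
    fix \<beta> assume "\<beta> \<in> {\<beta>. \<beta> \<prec>\<^sub>s \<alpha>}"
    then have "(\<Sum>i\<in>UNIV. \<beta> $ i) \<le> (\<Sum>i\<in>UNIV. \<alpha> $ i)" by (auto simp: shortlex_def)
    moreover have "\<beta> $ i \<le> (\<Sum>i\<in>UNIV. \<beta> $ i)" for i by (rule member_le_sum) auto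
    ultimately have "(\<lambda>i. \<beta> $ i) \<in> PiE UNIV (\<lambda>_. {..(\<Sum>i\<in>UNIV. \<alpha> $ i)})" using order_trans by auto
    then show "\<beta> \<in> vec_lambda ` (PiE UNIV (\<lambda>_. {..(\<Sum>i\<in>UNIV. \<alpha> $ i)}))" 
      by (metis image_eqI vec_nth_inverse)
  qed
qed (intro finite_imageI finite_PiE, auto)

lemma shortlex_rank_less_iff:
  "card {\<delta>. \<delta> \<prec>\<^sub>s \<alpha>} < card {\<delta>. \<delta> \<prec>\<^sub>s \<beta>} \<longleftrightarrow> \<alpha> \<prec>\<^sub>s \<beta>"
proof -
  have *: "card {\<delta>. \<delta> \<prec>\<^sub>s \<alpha>} < card {\<delta>. \<delta> \<prec>\<^sub>s \<beta>}" if "\<alpha> \<prec>\<^sub>s \<beta>" for \<alpha> \<beta>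
    by (rule psubset_card_mono[OF finite_shortlex_below])
       (use that shortlex_trans shortlex_irrefl in blast)
  show ?thesis using * shortlex_total by (metis less_asym less_irrefl)
qed

lemma bij_shortlex_rank: "bij (\<lambda>\<alpha>. card {\<delta>. \<delta> \<prec>\<^sub>s \<alpha>})"
proof (rule bijI)
  let ?r = "\<lambda>\<alpha>::nat ^ 'a::{finite,linorder}. card {\<delta>. \<delta> \<prec>\<^sub>s \<alpha>}"
  show inj: "inj ?r"
    by (rule injI) (metis shortlex_rank_less_iff shortlex_total less_irrefl)
  have "infinite (range ?r)"
  proof
    assume "finite (range ?r)"
    then have "finite (UNIV :: (nat ^ 'a::{finite,linorder}) set)" using inj finite_imageD by blast
    moreover have "inj (\<lambda>n. (\<chi> i. n) :: nat ^ 'a::{finite,linorder})" by (rule injI) (simp add: vec_eq_iff)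
    ultimately show False using finite_imageD infinite_UNIV_nat rev_finite_subset by blast
  qed
  have "n \<in> range ?r" for n
  proof -
    obtain \<alpha> where \<alpha>: "?r \<alpha> > n"
      using \<open>infinite (range ?r)\<close> by (metis (no_types, lifting) infinite_nat_iff_unbounded imageE)
    have "?r ` {\<delta>. \<delta> \<prec>\<^sub>s \<alpha>} = {..<?r \<alpha>}"
    proof (rule card_subset_eq)
      show "?r ` {\<delta>. \<delta> \<prec>\<^sub>s \<alpha>} \<subseteq> {..<?r \<alpha>}" using shortlex_rank_less_iff by auto
      show "card (?r ` {\<delta>. \<delta> \<prec>\<^sub>s \<alpha>}) = card {..<?r \<alpha>}"
        using card_image[OF inj_on_subset[OF inj]] by simp
    qed simp
    then show ?thesis using \<alpha> by auto
  qed
  then show "surj ?r" by auto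
qed

lemma shortlex_rank_enum: "card {\<delta>. \<delta> \<prec>\<^sub>s shortlex_enum n} = n"
proof -
  have "\<exists>!\<alpha>. card {\<beta>. \<beta> \<prec>\<^sub>s \<alpha>} = n" using bij_shortlex_rank unfolding bij_iff by (rule spec)
  then show ?thesis unfolding shortlex_enum_def by (rule theI')
qed

lemma shortlex_enum_less_iff: "shortlex_enum m \<prec>\<^sub>s shortlex_enum n \<longleftrightarrow> m < n"
  by (metis shortlex_rank_enum shortlex_rank_less_iff)

lemma bij_shortlex_enum: "bij shortlex_enum"
proof -
  have "inj (\<lambda>n. shortlex_enum n)" by (metis injI shortlex_rank_enum)
  moreover have "surj (\<lambda>n. shortlex_enum n)"
    by (rule surjI[of _ "\<lambda>\<alpha>. card {\<delta>. \<delta> \<prec>\<^sub>s \<alpha>}"])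
       (metis bij_shortlex_rank bij_is_inj injD shortlex_rank_enum)
  ultimately show ?thesis by (simp add: bij_def)
qed

definition has_shortlex_prod :: "(nat ^ 'd::{finite,linorder} \<Rightarrow> real) \<Rightarrow> real \<Rightarrow> bool" where
  "has_shortlex_prod f L \<longleftrightarrow> (\<lambda>n. \<Prod>k<n. f (shortlex_enum k)) \<longlonglongrightarrow> L"

section \<open>Verblunsky coefficients\<close>

definition cmonom :: "nat ^ 'd \<Rightarrow> complex ^ 'd \<Rightarrow> complex" where
  "cmonom \<alpha> \<zeta> = (\<Prod>i\<in>UNIV. (\<zeta> $ i) ^ (\<alpha> $ i))"

definition moment_kernel ::
    "(complex ^ 'd) measure \<Rightarrow> nat ^ 'd \<Rightarrow> nat ^ 'd \<Rightarrow> complex" where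
  "moment_kernel \<mu> \<alpha> \<beta> = (LINT \<zeta>|\<mu>. cmonom \<alpha> \<zeta> * cnj (cmonom \<beta> \<zeta>))"

text \<open>
  The inverse of the matrix \<open>(M i j)\<close> with rows and columns indexed by the finite set \<open>S\<close>,
  extended by zero so that it is unique as a function.
\<close>

definition matrix_inv_on :: "'i set \<Rightarrow> ('i \<Rightarrow> 'i \<Rightarrow> complex) \<Rightarrow> 'i \<Rightarrow> 'i \<Rightarrow> complex" where
  "matrix_inv_on S M = (THE N.
     (\<forall>i j. i \<notin> S \<or> j \<notin> S \<longrightarrow> N i j = 0) \<and>
     (\<forall>i\<in>S. \<forall>j\<in>S. (\<Sum>k\<in>S. M i k * N k j) = (if i = j then 1 else 0)) \<and>
     (\<forall>i\<in>S. \<forall>j\<in>S. (\<Sum>k\<in>S. N i k * M k j) = (if i = j then 1 else 0)))"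

text \<open>The product of a row, a square matrix and a column indexed by \<open>S\<close>.\<close>

definition row_mat_col :: "'i set \<Rightarrow> ('i \<Rightarrow> complex) \<Rightarrow> ('i \<Rightarrow> 'i \<Rightarrow> complex) \<Rightarrow> ('i \<Rightarrow> complex) \<Rightarrow> complex"
  where "row_mat_col S x N y = (\<Sum>i\<in>S. \<Sum>j\<in>S. x i * N i j * y j)"

text \<open>
  The case of a pair in increasing order. For empty \<open>S\<close> the terms involving the matrix are empty
  sums. The radicands are positive when the finite sections of \<open>K\<close> are positive definite.
\<close>

definition verblunsky_lt ::
    "(nat ^ 'd::{finite,linorder} \<Rightarrow> nat ^ 'd::{finite,linorder} \<Rightarrow> complex) \<Rightarrow> nat ^ 'd::{finite,linorder} \<Rightarrow> nat ^ 'd::{finite,linorder} \<Rightarrow> complex" where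
  "verblunsky_lt K \<alpha> \<beta> =
     (let S = {\<delta>. \<alpha> \<prec>\<^sub>s \<delta> \<and> \<delta> \<prec>\<^sub>s \<beta>};
          N = matrix_inv_on S K;
          u = (\<lambda>\<delta>. K \<alpha> \<delta>);
          v = (\<lambda>\<delta>. K \<delta> \<beta>)
      in (K \<alpha> \<beta> - row_mat_col S u N v) /
         (csqrt (K \<alpha> \<alpha> - row_mat_col S u N (\<lambda>\<delta>. cnj (u \<delta>))) *
          csqrt (K \<beta> \<beta> - row_mat_col S (\<lambda>\<delta>. cnj (v \<delta>)) N v)))"

definition verblunsky ::
    "(complex ^ 'd::{finite,linorder}) measure \<Rightarrow> nat ^ 'd::{finite,linorder} \<Rightarrow> nat ^ 'd::{finite,linorder} \<Rightarrow> complex" where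
  "verblunsky \<mu> \<alpha> \<beta> =
     (if \<alpha> \<prec>\<^sub>s \<beta> then verblunsky_lt (moment_kernel \<mu>) \<alpha> \<beta>
      else if \<beta> \<prec>\<^sub>s \<alpha> then cnj (verblunsky_lt (moment_kernel \<mu>) \<beta> \<alpha>)
      else 0)"

end

theory Submission
  imports Defs "HOL-Complex_Analysis.Cauchy_Integral_Formula"
begin

text \<open>
  Write \<open>\<sigma>\<close> for the measure on the sphere and \<open>w = |g|\<^sup>2\<close> on the boundary. By the recursion for Schur
  complements, the product of the factors \<open>1 - |\<gamma> 0 \<alpha>|\<^sup>2\<close> over the first \<open>n\<close> multi-indices is the squared
  distance, in \<open>L\<^sup>2(\<mu>)\<close>, from the constant \<open>1\<close> to the span of the other monomials among them
  (\<open>verblunsky_product_eq_schur\<close>, \<open>prediction_error\<close>). The limit is therefore the infimum of \<open>\<integral>|p|\<^sup>2 d\<mu>\<close>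
  over the polynomials with \<open>p 0 = 1\<close>, and both sides of the theorem turn out to be \<open>|g 0|\<^sup>2\<close>.

  The infimum is at least \<open>|g 0|\<^sup>2\<close>: leaving out the discrete part makes the integral smaller, and
  \<open>\<integral>|p g|\<^sup>2 d\<sigma> \<ge> |p 0 * g 0|\<^sup>2\<close> by the mean value property (\<open>weight_lower_bound\<close>). It is at most
  \<open>|g 0|\<^sup>2\<close>: as \<open>Re g \<ge> 0\<close>, the function \<open>1 / (g + \<delta>)\<close> is bounded and \<open>|g / (g + \<delta>)| \<le> 1\<close>, so polynomials
  close to its dilates, normalised at \<open>0\<close>, are nearly optimal for the weight \<open>w\<close>
  (\<open>weight_upper_bound\<close>). The point masses cost nothing: finitely many of them carry almost all of
  the discrete part, and \<open>1 - ((1 + \<langle>z, \<zeta>\<rangle>) / 2) ^ n\<close> vanishes at \<open>\<zeta>\<close> while it tends boundedly to \<open>1\<close>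
  at \<open>0\<close> and at every other point of the sphere (\<open>nearly_optimal_polynomial\<close>). Finally \<open>g + \<delta>\<close> has a holomorphic
  logarithm, whose real part has the mean value property, and \<open>w \<ge> \<epsilon>\<close> allows \<open>\<delta>\<close> to tend to \<open>0\<close>;
  hence the mean of \<open>ln w\<close> is \<open>2 ln |g 0|\<close> (\<open>integral_ln_boundary\<close>).

  Each of these passages to the boundary uses that \<open>g (r \<zeta>)\<close> tends to \<open>K_limit g \<zeta>\<close> for almost every
  \<open>\<zeta>\<close>, which is Koranyi's theorem (\<open>K_limit_exists_AE\<close>), and most of the text proves it. The
  Poisson-Szego formula (\<open>poisson_formula\<close>) follows from the moments of \<open>\<langle>z, \<xi>\<rangle>\<close>, because averaging over the
  rotations that fix \<open>\<xi>\<close> reduces it to one complex variable. It bounds a holomorphic function on a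
  Koranyi region by its averages over the caps \<open>|1 - \<langle>z, \<zeta>\<rangle>| < \<rho>\<close>
  (\<open>koranyi_maximal_inequality\<close>), and a covering argument makes these averages small outside a small
  set (\<open>weak_type_inequality\<close>). The homogeneous parts of \<open>g\<close> are orthogonal polynomials, so the
  dilates of \<open>g\<close> form a Cauchy family in the mean (\<open>dilates_mean_cauchy\<close>); along a fast sequence of radii
  the differences are summable uniformly on the Koranyi regions at almost every \<open>\<zeta>\<close>.
\<close>

section \<open>The Hermitian inner product\<close>

lemma cinner_add_left: "cinner (a + b) c = cinner a c + cinner b c"
  by (simp add: cinner_def distrib_right sum.distrib)

lemma cinner_add_right: "cinner c (a + b) = cinner c a + cinner c b"
  by (simp add: cinner_def distrib_left sum.distrib)

lemma cinner_diff_left: "cinner (a - b) c = cinner a c - cinner b c"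
  by (simp add: cinner_def left_diff_distrib sum_subtractf)

lemma cinner_diff_right: "cinner c (a - b) = cinner c a - cinner c b"
  by (simp add: cinner_def right_diff_distrib sum_subtractf)

lemma cinner_scale_left: "cinner (t *s a) c = t * cinner a c"
  by (simp add: cinner_def sum_distrib_left mult.assoc)

lemma cinner_scale_right: "cinner c (t *s a) = cnj t * cinner c a"
  by (simp add: cinner_def sum_distrib_left mult_ac)

lemma cinner_zero [simp]: "cinner 0 c = 0" "cinner c 0 = 0"
  by (simp_all add: cinner_def)

lemma cnj_cinner: "cnj (cinner a b) = cinner b a"
  by (simp add: cinner_def mult.commute)

lemma cinner_self: "cinner a a = of_real ((norm a)\<^sup>2)"
proof -
  have "(norm a)\<^sup>2 = (\<Sum>i\<in>UNIV. (cmod (a $ i))\<^sup>2)"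
    by (simp add: norm_vec_def L2_set_def sum_nonneg)
  then have "of_real ((norm a)\<^sup>2) = (\<Sum>i\<in>UNIV. complex_of_real ((cmod (a $ i))\<^sup>2))"
    by (simp only: of_real_sum)
  then show ?thesis unfolding cinner_def complex_norm_square by simp
qed

lemma cinner_axis: "cinner a (axis i 1) = a $ i"
  by (simp add: cinner_def axis_def if_distrib[of cnj] if_distrib[of "\<lambda>x. _ * x"] cong: if_cong)

lemma norm_scale_vec: "norm (t *s (a :: complex ^ 'd)) = cmod t * norm a"
proof -
  have "complex_of_real ((norm (t *s a))\<^sup>2) = of_real ((cmod t * norm a)\<^sup>2)"
    unfolding power_mult_distrib of_real_mult cinner_self[symmetric] cinner_scale_left cinner_scale_right
      complex_norm_square by simp
  then have "(norm (t *s a))\<^sup>2 = (cmod t * norm a)\<^sup>2" using of_real_eq_iff by blast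
  then show ?thesis by (simp add: power2_eq_iff_nonneg)
qed

lemma cmod_cinner_le: "cmod (cinner a b) \<le> norm a * norm b"
proof -
  have "cmod (cinner a b) \<le> (\<Sum>i\<in>UNIV. cmod (a $ i) * cmod (b $ i))"
    unfolding cinner_def by (rule order_trans[OF norm_sum]) (simp add: norm_mult)
  also have "\<dots> \<le> norm a * norm b"
    using L2_set_mult_ineq[of "\<lambda>i. cmod (a $ i)" "\<lambda>i. cmod (b $ i)" UNIV] by (simp add: norm_vec_def)
  finally show ?thesis .
qed

lemma bounded_linear_scale_vec: "bounded_linear (\<lambda>t. t *s (b :: complex ^ 'd))"
  by (rule bounded_linear_intro[where K = "norm b"])
     (simp_all add: vec_eq_iff distrib_right norm_scale_vec)

lemma continuous_on_scale_vec [continuous_intros]: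
  fixes b :: "'a::topological_space \<Rightarrow> complex ^ 'd"
  assumes "continuous_on A t" "continuous_on A b"
  shows "continuous_on A (\<lambda>x. t x *s b x)"
  unfolding vector_scalar_mult_def
  by (intro continuous_on_vec_lambda continuous_intros assms)

lemma continuous_on_cinner [continuous_intros]:
  assumes "continuous_on A a" "continuous_on A b"
  shows "continuous_on A (\<lambda>x. cinner (a x) (b x))"
  unfolding cinner_def using assms
  by (intro continuous_intros)

section \<open>Holomorphy along complex lines\<close>

text \<open>
  For continuous functions on open sets this is the usual holomorphy in several variables. The
  notion is closed under composition with functions of one variable for trivial reasons, and every
  argument below restricts a function to complex lines.
\<close>

definition line_holomorphic :: "(complex ^ 'd \<Rightarrow> complex) \<Rightarrow> (complex ^ 'd) set \<Rightarrow> bool" where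
  "line_holomorphic f U \<longleftrightarrow> continuous_on U f \<and>
     (\<forall>a b. (\<lambda>t. f (a + t *s b)) holomorphic_on {t. a + t *s b \<in> U})"

lemma line_holomorphicD:
  assumes "line_holomorphic f U" "\<And>t. t \<in> T \<Longrightarrow> a + t *s b \<in> U"
  shows "(\<lambda>t. f (a + t *s b)) holomorphic_on T"
  using assms unfolding line_holomorphic_def by (meson holomorphic_on_subset mem_Collect_eq subsetI)

lemma line_holomorphic_continuous: "line_holomorphic f U \<Longrightarrow> continuous_on U f"
  by (simp add: line_holomorphic_def)

lemma line_holomorphic_subset:
  "line_holomorphic f U \<Longrightarrow> V \<subseteq> U \<Longrightarrow> line_holomorphic f V"
  unfolding line_holomorphic_def
  by (metis (mono_tags, lifting) Collect_mono continuous_on_subset holomorphic_on_subset subset_iff)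

lemma holomorphic_Cn_imp_line_holomorphic:
  assumes "holomorphic_Cn_on f U"
  shows "line_holomorphic f U"
  unfolding line_holomorphic_def
proof safe
  show "continuous_on U f"
    using assms unfolding holomorphic_Cn_on_def
    by (meson continuous_at_imp_continuous_on has_derivative_continuous)
  fix a b :: "complex ^ 'a"
  show "(\<lambda>t. f (a + t *s b)) holomorphic_on {t. a + t *s b \<in> U}"
  proof (rule holomorphic_onI)
    fix t assume "t \<in> {t. a + t *s b \<in> U}"
    then obtain D where D: "(f has_derivative D) (at (a + t *s b))" "\<And>c v. D (c *s v) = c * D v"
      using assms unfolding holomorphic_Cn_on_def by blast
    have "((\<lambda>t. a + t *s b) has_derivative (\<lambda>t. t *s b)) (at t)"
      using bounded_linear.has_derivative[OF bounded_linear_scale_vec has_derivative_ident]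
      by (auto intro!: derivative_eq_intros)
    from has_derivative_compose[OF this D(1)]
    moreover have "(\<lambda>t. D (t *s b)) = (*) (D b)" by (simp add: D(2) fun_eq_iff mult.commute)
    ultimately have "((\<lambda>t. f (a + t *s b)) has_field_derivative D b) (at t)"
      unfolding has_field_derivative_def by simp
    then show "(\<lambda>t. f (a + t *s b)) field_differentiable at t within {t. a + t *s b \<in> U}"
      using field_differentiable_at_within field_differentiable_def by blast
  qed
qed

lemma line_holomorphic_const: "line_holomorphic (\<lambda>_. c) U"
  by (simp add: line_holomorphic_def)

lemma line_holomorphic_add:
  "line_holomorphic f U \<Longrightarrow> line_holomorphic g U \<Longrightarrow> line_holomorphic (\<lambda>z. f z + g z) U"
  by (auto simp: line_holomorphic_def intro!: continuous_intros holomorphic_intros)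

lemma line_holomorphic_diff:
  "line_holomorphic f U \<Longrightarrow> line_holomorphic g U \<Longrightarrow> line_holomorphic (\<lambda>z. f z - g z) U"
  by (auto simp: line_holomorphic_def intro!: continuous_intros holomorphic_intros)

lemma line_holomorphic_mult:
  "line_holomorphic f U \<Longrightarrow> line_holomorphic g U \<Longrightarrow> line_holomorphic (\<lambda>z. f z * g z) U"
  by (auto simp: line_holomorphic_def intro!: continuous_intros holomorphic_intros)

lemma line_holomorphic_compose:
  assumes "line_holomorphic f U" "\<phi> holomorphic_on V" "f ` U \<subseteq> V"
  shows "line_holomorphic (\<lambda>z. \<phi> (f z)) U"
  unfolding line_holomorphic_def
proof safe
  show "continuous_on U (\<lambda>z. \<phi> (f z))"
    using assms by (metis continuous_on_compose2 holomorphic_on_imp_continuous_on line_holomorphic_def)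
  fix a b
  have "(\<lambda>t. f (a + t *s b)) holomorphic_on {t. a + t *s b \<in> U}"
    using assms(1) by (simp add: line_holomorphic_def)
  then have "(\<phi> \<circ> (\<lambda>t. f (a + t *s b))) holomorphic_on {t. a + t *s b \<in> U}"
    using assms(2,3) by (intro holomorphic_on_compose_gen) auto
  then show "(\<lambda>t. \<phi> (f (a + t *s b))) holomorphic_on {t. a + t *s b \<in> U}"
    by (simp add: o_def)
qed

lemma line_holomorphic_dilate:
  fixes f :: "complex ^ 'd \<Rightarrow> complex"
  assumes "line_holomorphic f U" "\<And>z. z \<in> V \<Longrightarrow> s *s z \<in> U"
  shows "line_holomorphic (\<lambda>z. f (s *s z)) V"
  unfolding line_holomorphic_def
proof safe
  show "continuous_on V (\<lambda>z. f (s *s z))"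
    using assms by (intro continuous_on_compose2[OF line_holomorphic_continuous[OF assms(1)]] continuous_intros) auto
  fix a b :: "complex ^ 'd"
  have "s *s (a + t *s b) = s *s a + t *s (s *s b)" for t
    by (simp add: vec_eq_iff algebra_simps)
  then show "(\<lambda>t. f (s *s (a + t *s b))) holomorphic_on {t. a + t *s b \<in> V}"
    using assms(2) by (metis (mono_tags, lifting) assms(1) line_holomorphicD holomorphic_cong mem_Collect_eq)
qed

text \<open>
  Cauchy's formula at the centre, with the circle parametrised by the unit interval so that the average
  is an integral over a probability space.
\<close>

lemma holomorphic_average_circle:
  assumes "h holomorphic_on cball 0 1"
  shows "(LINT t:{0..1}|lborel. h (cis (2 * pi * t))) = h 0"
proof -
  have "((\<lambda>u. h u / (u - 0)) has_contour_integral (2 * of_real pi * \<i> * h 0)) (circlepath 0 1)"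
    by (rule Cauchy_integral_circlepath_simple[OF assms]) simp
  moreover have circ: "circlepath 0 1 x = cis (2*pi*x)" for x
    by (simp add: circlepath cis_conv_exp mult_ac)
  moreover have "vector_derivative (circlepath 0 1) (at x within {0..1}) = 2 * pi * \<i> * cis (2*pi*x)"
    if "x \<in> {0..1}" for x
    using that by (simp add: vector_derivative_circlepath01 cis_conv_exp mult_ac)
  ultimately have *: "((\<lambda>x. h (cis (2*pi*x)) / cis (2*pi*x) * (2 * pi * \<i> * cis (2*pi*x))) has_integral 2 * of_real pi * \<i> * h 0) {0..1}"
    unfolding has_contour_integral_def
    by (elim has_integral_eq[rotated]) simp
  have "((\<lambda>x. h (cis (2*pi*x))) has_integral h 0) {0..1}"
    using has_integral_mult_right[OF *, of "inverse (2 * of_real pi * \<i>)"]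
    by (simp add: field_simps)
  then have "integral {0..1} (\<lambda>x. h (cis (2*pi*x))) = h 0" by (rule integral_unique)
  moreover have "continuous_on {0..1} (\<lambda>x. h (cis (2*pi*x)))"
    by (rule continuous_on_compose2[OF holomorphic_on_imp_continuous_on[OF assms]])
       (auto intro!: continuous_intros simp: cis_conv_exp)
  then have "set_integrable lborel {0..1} (\<lambda>x. h (cis (2*pi*x)))"
    by (rule borel_integrable_atLeastAtMost')
  ultimately show ?thesis by (simp add: set_borel_integral_eq_integral(2))
qed

section \<open>Integration over the sphere\<close>

lemma measurable_sphere_measure_iff:
  "measurable sphere_measure = measurable (restrict_space borel (sphere 0 1))"
  by (intro ext measurable_cong_sets) (simp_all add: sets_sphere_measure sphere_borel_def)

lemma borel_measurable_sphere_measure: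
  fixes F :: "complex ^ 'd \<Rightarrow> 'b::topological_space"
  assumes "continuous_on (sphere 0 1) F"
  shows "F \<in> borel_measurable sphere_measure"
  unfolding measurable_sphere_measure_iff by (rule borel_measurable_continuous_on_restrict[OF assms])

lemma finite_sphere_measure: "finite_measure sphere_measure"
  using prob_space_sphere_measure by (rule prob_space.axioms)

lemma integrable_sphere:
  fixes F :: "complex ^ 'd \<Rightarrow> 'b::{banach,second_countable_topology}"
  assumes "continuous_on (sphere 0 1) F"
  shows "integrable sphere_measure F"
proof -
  have "bounded (F ` sphere 0 1)" by (intro compact_imp_bounded compact_continuous_image assms compact_sphere)
  then obtain B where "\<And>z. z \<in> sphere 0 1 \<Longrightarrow> norm (F z) \<le> B" unfolding bounded_iff by blast
  then show ?thesis
    by (intro finite_measure.integrable_const_bound[OF finite_sphere_measure, of _ B] AE_I2 borel_measurable_sphere_measure assms)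
       (simp add: space_sphere_measure)
qed

lemma integral_sphere_cong:
  "(\<And>z. norm z = 1 \<Longrightarrow> F z = G z) \<Longrightarrow> (LINT z|sphere_measure. F z) = (LINT z|sphere_measure. G z)"
  by (intro Bochner_Integration.integral_cong) (auto simp: space_sphere_measure)

lemma integral_sphere_orthogonal:
  fixes F :: "complex ^ 'd \<Rightarrow> 'b::{banach,second_countable_topology}"
  assumes T: "orthogonal_transformation (T :: complex ^ 'd \<Rightarrow> complex ^ 'd)" and F: "continuous_on (sphere 0 1) F"
  shows "(LINT z|sphere_measure. F (T z)) = (LINT z|sphere_measure. F z)"
proof -
  have lin: "linear T" using T orthogonal_transformation_linear by blast
  have "continuous_on UNIV T" using lin linear_continuous_on linear_conv_bounded_linear by blast
  then have "T \<in> borel_measurable borel" by (rule borel_measurable_continuous_onI)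
  then have m: "T \<in> measurable sphere_measure sphere_borel"
    unfolding measurable_sphere_measure_iff sphere_borel_def using T
    by (intro measurable_restrict_space2 measurable_restrict_space1)
       (auto simp: space_restrict_space orthogonal_transformation_norm)
  have Fm: "F \<in> borel_measurable sphere_borel"
    using F by (simp add: sphere_borel_def borel_measurable_continuous_on_restrict)
  show ?thesis
    using integral_distr[OF m Fm] by (simp add: distr_sphere_measure_orthogonal[OF T])
qed

lemma orthogonal_transformation_cinner:
  fixes T :: "complex ^ 'd \<Rightarrow> complex ^ 'd"
  assumes "\<And>a b. T (a + b) = T a + T b" "\<And>c a. T (c *s a) = c *s T a" "\<And>a. norm (T a) = norm a"
  shows "orthogonal_transformation T"
proof -
  have "T (r *\<^sub>R a) = r *\<^sub>R T a" for r a
    using assms(2)[of "of_real r" a] by (simp add: vector_scalar_mult_def scaleR_vec_def scaleR_conv_of_real)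
  then have "linear T" by (intro linearI) (simp_all add: assms)
  then show ?thesis using assms by (simp add: orthogonal_transformation)
qed

text \<open>
  For a unit vector \<open>\<xi>\<close> the component along \<open>\<xi>\<close> stays and the orthogonal complement is multiplied by
  \<open>u\<close>. The case \<open>\<xi> = 0\<close>, where everything is multiplied by \<open>u\<close>, gives the mean value property of the ball.
\<close>

definition rotation_around :: "complex ^ 'd \<Rightarrow> complex \<Rightarrow> complex ^ 'd \<Rightarrow> complex ^ 'd" where
  "rotation_around \<xi> u z = cinner z \<xi> *s \<xi> + u *s (z - cinner z \<xi> *s \<xi>)"

lemma cinner_rotation_around:
  assumes "\<xi> = 0 \<or> norm \<xi> = 1"
  shows "cinner (rotation_around \<xi> u z) \<xi> = cinner z \<xi>"
  using assms by (auto simp: rotation_around_def cinner_add_left cinner_scale_left cinner_diff_left cinner_self)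

lemma norm_add_cinner_orthogonal:
  assumes "cinner a b = 0"
  shows "(norm (a + b))\<^sup>2 = (norm a)\<^sup>2 + (norm b)\<^sup>2"
proof -
  have "cinner b a = 0" using assms cnj_cinner[of a b] by simp
  then have "complex_of_real ((norm (a + b))\<^sup>2) = of_real ((norm a)\<^sup>2 + (norm b)\<^sup>2)"
    using assms unfolding of_real_add cinner_self[symmetric]
    by (simp add: cinner_add_left cinner_add_right)
  then show ?thesis using of_real_eq_iff by blast
qed

lemma norm_rotation_around:
  assumes "\<xi> = 0 \<or> norm \<xi> = 1"
  shows "(norm (rotation_around \<xi> u z))\<^sup>2 = (cmod (cinner z \<xi>))\<^sup>2 + (cmod u)\<^sup>2 * ((norm z)\<^sup>2 - (cmod (cinner z \<xi>))\<^sup>2)"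
proof -
  define w where "w = z - cinner z \<xi> *s \<xi>"
  have w: "cinner w \<xi> = 0" "cinner \<xi> w = 0"
    using assms cnj_cinner[of w \<xi>]
    by (auto simp: w_def cinner_diff_left cinner_scale_left cinner_self)
  have par: "(norm (cinner z \<xi> *s \<xi>))\<^sup>2 = (cmod (cinner z \<xi>))\<^sup>2"
    using assms by (auto simp: norm_scale_vec)
  have "(norm z)\<^sup>2 = (cmod (cinner z \<xi>))\<^sup>2 + (norm w)\<^sup>2"
    using norm_add_cinner_orthogonal[of "cinner z \<xi> *s \<xi>" w] w par
    by (simp add: cinner_scale_left) (simp add: w_def)
  moreover have "(norm (rotation_around \<xi> u z))\<^sup>2 = (cmod (cinner z \<xi>))\<^sup>2 + (cmod u * norm w)\<^sup>2"
    using norm_add_cinner_orthogonal[of "cinner z \<xi> *s \<xi>" "u *s w"] w par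
    by (simp add: cinner_scale_left cinner_scale_right rotation_around_def norm_scale_vec flip: w_def)
  ultimately show ?thesis by (simp add: power_mult_distrib)
qed

lemma orthogonal_rotation_around:
  assumes "\<xi> = 0 \<or> norm \<xi> = 1" "cmod u = 1"
  shows "orthogonal_transformation (rotation_around \<xi> u)"
proof (rule orthogonal_transformation_cinner)
  show "norm (rotation_around \<xi> u a) = norm a" for a
    using norm_rotation_around[OF assms(1), of u a] assms(2) by (simp add: power2_eq_iff_nonneg)
  show "rotation_around \<xi> u (a + b) = rotation_around \<xi> u a + rotation_around \<xi> u b" for a b
    unfolding rotation_around_def cinner_add_left vec_eq_iff by (simp add: distrib_left distrib_right right_diff_distrib)
  show "rotation_around \<xi> u (c *s a) = c *s rotation_around \<xi> u a" for c a
    unfolding rotation_around_def cinner_scale_left vec_eq_iff by (simp add: distrib_left right_diff_distrib mult_ac)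
qed

text \<open>
  Average over the rotations around \<open>\<xi>\<close>: they preserve the measure and the factor \<open>k \<langle>z, \<xi>\<rangle>\<close>, and
  by the mean value property on the disc \<open>u \<mapsto> rotation_around \<xi> u z\<close> the average of \<open>f\<close> is its value
  at the centre \<open>\<langle>z, \<xi>\<rangle> \<xi>\<close>. Integrals of \<open>f\<close> against a function of \<open>\<langle>z, \<xi>\<rangle>\<close> thus involve only the
  restriction of \<open>f\<close> to the complex line through \<open>\<xi>\<close>.
\<close>

lemma integral_sphere_line:
  fixes f :: "complex ^ 'd \<Rightarrow> complex"
  assumes f: "line_holomorphic f (ball 0 R)" and R: "R > 1"
    and \<xi>: "\<xi> = 0 \<or> norm \<xi> = 1" and k: "continuous_on (cball 0 1) k"
  shows "(LINT z|sphere_measure. f z * k (cinner z \<xi>)) =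
         (LINT z|sphere_measure. f (cinner z \<xi> *s \<xi>) * k (cinner z \<xi>))"
proof -
  define F where "F z = f z * k (cinner z \<xi>)" for z
  define N where "N = restrict_space lborel {0..1::real}"
  have Nprob: "prob_space N"
    by (rule prob_spaceI) (simp add: N_def space_restrict_space emeasure_restrict_space)
  interpret pair_prob_space "sphere_measure :: (complex ^ 'd) measure" N
    by (intro pair_prob_space.intro pair_sigma_finite.intro prob_space_imp_sigma_finite
          prob_space_sphere_measure Nprob)
  have ci: "cmod (cinner z \<xi>) \<le> 1" if "norm z = 1" for z
    using cmod_cinner_le[of z \<xi>] \<xi> that by auto
  have Fc: "continuous_on (sphere 0 1) F"
    unfolding F_def using R ci
    by (intro continuous_intros continuous_on_subset[OF line_holomorphic_continuous[OF f]]
          continuous_on_compose2[OF k]) auto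
  define G where "G = (\<lambda>(z, t). F (rotation_around \<xi> (cis (2 * pi * t)) z))"
  have rot: "norm (rotation_around \<xi> (cis x) z) = norm z" for x z
    using orthogonal_rotation_around[OF \<xi>, of "cis x"] by (simp add: orthogonal_transformation_norm)
  have Gc: "continuous_on (sphere 0 1 \<times> {0..1}) G"
    unfolding G_def split_beta
  proof (rule continuous_on_compose2[OF Fc])
    show "continuous_on (sphere 0 1 \<times> {0..1}) (\<lambda>x. rotation_around \<xi> (cis (2 * pi * snd x)) (fst x))"
      unfolding rotation_around_def cis_conv_exp by (intro continuous_intros)
  qed (auto simp: rot)
  have mid: "(\<lambda>x. x) \<in> measurable (sphere_measure \<Otimes>\<^sub>M N) (restrict_space borel (sphere 0 1 \<times> {0..1}))"
  proof (rule measurable_restrict_space2)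
    have 1: "fst \<in> measurable (sphere_measure \<Otimes>\<^sub>M N) borel"
      by (rule measurable_compose[OF measurable_fst]) (intro borel_measurable_sphere_measure continuous_intros)
    have 2: "snd \<in> measurable (sphere_measure \<Otimes>\<^sub>M N) borel"
      by (rule measurable_compose[OF measurable_snd]) (simp add: N_def measurable_restrict_space1)
    show "(\<lambda>x. x) \<in> measurable (sphere_measure \<Otimes>\<^sub>M N) borel"
      using borel_measurable_Pair[OF 1 2] by simp
  qed (auto simp: space_pair_measure space_sphere_measure N_def space_restrict_space)
  have Gm: "G \<in> borel_measurable (sphere_measure \<Otimes>\<^sub>M N)"
    using measurable_compose[OF mid borel_measurable_continuous_on_restrict[OF Gc]] .
  have "compact (sphere 0 1 \<times> {0..1::real} :: ((complex^'d) \<times> real) set)" by (intro compact_Times) auto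
  then have "bounded (G ` (sphere 0 1 \<times> {0..1}))"
    by (intro compact_imp_bounded compact_continuous_image Gc)
  then obtain B where B: "\<And>x. x \<in> sphere 0 1 \<times> {0..1} \<Longrightarrow> norm (G x) \<le> B" unfolding bounded_iff by blast
  have sp: "space (sphere_measure \<Otimes>\<^sub>M N) = sphere 0 1 \<times> {0..1}"
    by (auto simp: space_pair_measure space_sphere_measure N_def space_restrict_space)
  have Gi: "integrable (sphere_measure \<Otimes>\<^sub>M N) G"
    using B by (intro P.integrable_const_bound[of _ B] Gm AE_I2) (auto simp: sp)
  have "(LINT z|sphere_measure. F z) = (LINT t|N. (LINT z|sphere_measure. G (z, t)))"
    unfolding G_def
    by (simp add: integral_sphere_orthogonal[OF orthogonal_rotation_around[OF \<xi>] Fc] prob_space.prob_space[OF Nprob])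
  also have "\<dots> = (LINT z|sphere_measure. (LINT t|N. G (z, t)))"
    using Fubini_integral[of "\<lambda>z t. G (z, t)"] Gi by simp
  also have "\<dots> = (LINT z|sphere_measure. f (cinner z \<xi> *s \<xi>) * k (cinner z \<xi>))"
  proof (rule integral_sphere_cong)
    fix z :: "complex ^ 'd" assume z: "norm z = 1"
    define h where "h u = f (rotation_around \<xi> u z)" for u
    have "h holomorphic_on cball 0 1"
      unfolding h_def rotation_around_def
    proof (rule line_holomorphicD[OF f])
      fix u :: complex assume "u \<in> cball 0 1"
      then have "(norm (rotation_around \<xi> u z))\<^sup>2 \<le> (cmod (cinner z \<xi>))\<^sup>2 + 1 * (1 - (cmod (cinner z \<xi>))\<^sup>2)"
        unfolding norm_rotation_around[OF \<xi>] using ci[OF z] z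
        by (intro add_left_mono mult_mono) (auto simp: abs_square_le_1 power_le_one)
      then have "norm (rotation_around \<xi> u z) \<le> 1" by (simp add: abs_square_le_1)
      then show "cinner z \<xi> *s \<xi> + u *s (z - cinner z \<xi> *s \<xi>) \<in> ball 0 R"
        using R by (simp add: rotation_around_def)
    qed
    from holomorphic_average_circle[OF this]
    have "(LINT t|N. h (cis (2 * pi * t))) = h 0"
      by (simp add: N_def integral_restrict_space set_lebesgue_integral_def)
    then show "(LINT t|N. G (z, t)) = f (cinner z \<xi> *s \<xi>) * k (cinner z \<xi>)"
      by (simp add: G_def F_def cinner_rotation_around[OF \<xi>] h_def[symmetric])
         (simp add: h_def rotation_around_def)
  qed
  finally show ?thesis by (simp add: F_def)
qed

text \<open>
  The case \<open>\<xi> = 0\<close>, in which all of the sphere is averaged to the origin.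
\<close>

lemma integral_sphere_mean_value:
  assumes "line_holomorphic f (ball 0 R)" and "R > 1"
  shows "(LINT z|sphere_measure. f z) = f 0"
  using integral_sphere_line[OF assms, of 0 "\<lambda>_. 1"] by (simp add: prob_space.prob_space[OF prob_space_sphere_measure])

section \<open>Moments of the sphere\<close>

lemma orthogonal_torus:
  fixes u :: "'d::finite \<Rightarrow> complex"
  assumes "\<And>i. cmod (u i) = 1"
  shows "orthogonal_transformation (\<lambda>z :: complex ^ 'd. \<chi> i. u i * z $ i)"
  by (rule orthogonal_transformation_cinner)
     (simp_all add: vec_eq_iff distrib_left mult.left_commute norm_vec_def norm_mult assms)

lemma phase_separating_powers:
  assumes "a \<noteq> (b :: nat)"
  obtains c where "cmod c = 1" "c ^ a * cnj c ^ b = -1"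
proof
  define x where "x = pi / (real a - real b)"
  show "cmod (cis x) = 1" by simp
  have "cis x ^ a * cnj (cis x) ^ b = cis ((real a - real b) * x)"
    unfolding cis_cnj Complex.DeMoivre cis_mult by (simp add: algebra_simps)
  also have "(real a - real b) * x = pi" using assms by (simp add: x_def)
  finally show "cis x ^ a * cnj (cis x) ^ b = -1" by simp
qed

text \<open>
  Orthogonality relations are obtained from a rotation that multiplies the integrand by \<open>-1\<close>; a
  phase with this effect exists whenever two exponents differ (\<open>phase_separating_powers\<close>).
\<close>

lemma integral_sphere_eq_0_if_antisymmetric:
  fixes F :: "complex ^ 'd \<Rightarrow> complex"
  assumes "orthogonal_transformation T" "continuous_on (sphere 0 1) F"
    and "\<And>z. norm z = 1 \<Longrightarrow> F (T z) = - F z"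
  shows "(LINT z|sphere_measure. F z) = 0"
proof -
  have "(LINT z|sphere_measure. F z) = (LINT z|sphere_measure. - F z)"
    unfolding integral_sphere_orthogonal[OF assms(1,2), symmetric] by (rule integral_sphere_cong[OF assms(3)])
  then show ?thesis by (simp add: eq_neg_iff_add_eq_0)
qed

lemma integral_homogeneous_orthogonal:
  fixes p q :: "complex ^ 'd \<Rightarrow> complex"
  assumes "continuous_on (sphere 0 1) p" "continuous_on (sphere 0 1) q" "a \<noteq> b"
    and "\<And>c z. p (c *s z) = c ^ a * p z" "\<And>c z. q (c *s z) = c ^ b * q z"
  shows "(LINT z|sphere_measure. p z * cnj (q z)) = 0"
proof -
  obtain c where c: "cmod c = 1" "c ^ a * cnj c ^ b = -1"
    using phase_separating_powers[OF assms(3)] .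
  show ?thesis
  proof (rule integral_sphere_eq_0_if_antisymmetric)
    show "orthogonal_transformation (\<lambda>z. c *s z :: complex ^ 'd)"
      unfolding vector_scalar_mult_def by (rule orthogonal_torus) (rule c)
    show "continuous_on (sphere 0 1) (\<lambda>z. p z * cnj (q z))" by (intro continuous_intros assms)
    have "p (c *s z) * cnj (q (c *s z)) = (c ^ a * cnj c ^ b) * (p z * cnj (q z))" for z
      by (simp add: assms)
    then show "p (c *s z) * cnj (q (c *s z)) = - (p z * cnj (q z))" for z by (simp add: c)
  qed
qed

lemma continuous_on_cmonom [continuous_intros]:
  "continuous_on A f \<Longrightarrow> continuous_on A (\<lambda>x. cmonom \<alpha> (f x))"
  unfolding cmonom_def by (intro continuous_intros) auto

lemma integral_cmonom_orthogonal:
  assumes "\<alpha> \<noteq> \<beta>"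
  shows "(LINT z|sphere_measure. cmonom \<alpha> z * cnj (cmonom \<beta> z)) = 0"
proof -
  obtain i where "\<alpha> $ i \<noteq> \<beta> $ i" using assms by (auto simp: vec_eq_iff)
  then obtain c where c: "cmod c = 1" "c ^ (\<alpha> $ i) * cnj c ^ (\<beta> $ i) = -1"
    using phase_separating_powers by blast
  define u where "u j = (if j = i then c else 1)" for j
  have mon: "cmonom \<gamma> (\<chi> j. u j * z $ j) = c ^ (\<gamma> $ i) * cmonom \<gamma> z" for \<gamma> and z :: "complex ^ 'a"
  proof -
    have "(\<Prod>j\<in>UNIV. u j ^ (\<gamma> $ j)) = (\<Prod>j\<in>UNIV. if j = i then c ^ (\<gamma> $ i) else 1)"
      by (rule prod.cong) (auto simp: u_def)
    then show ?thesis by (simp add: cmonom_def power_mult_distrib prod.distrib)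
  qed
  show ?thesis
  proof (rule integral_sphere_eq_0_if_antisymmetric)
    show "orthogonal_transformation (\<lambda>z :: complex ^ 'a. \<chi> j. u j * z $ j)"
      by (rule orthogonal_torus) (simp add: u_def c)
    have "cmonom \<alpha> (\<chi> j. u j * z $ j) * cnj (cmonom \<beta> (\<chi> j. u j * z $ j))
        = (c ^ (\<alpha> $ i) * cnj c ^ (\<beta> $ i)) * (cmonom \<alpha> z * cnj (cmonom \<beta> z))" for z
      by (simp add: mon)
    then show "cmonom \<alpha> (\<chi> j. u j * z $ j) * cnj (cmonom \<beta> (\<chi> j. u j * z $ j))
        = - (cmonom \<alpha> z * cnj (cmonom \<beta> z))" for z by (simp add: c)
  qed (intro continuous_intros)
qed

text \<open>
  The even absolute moments of \<open>\<langle>z, \<xi>\<rangle>\<close>. They are the reciprocals of the coefficients of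
  \<open>(1 - x) ^ (- d)\<close>, which is the reason that the Cauchy kernel of the ball is \<open>(1 - \<langle>z, \<zeta>\<rangle>) ^ (- d)\<close>.
\<close>

definition sphere_moment :: "nat \<Rightarrow> complex ^ 'd \<Rightarrow> real" where
  "sphere_moment k \<xi> = (LINT z|sphere_measure. cmod (cinner z \<xi>) ^ (2 * k))"

lemma line_holomorphic_cinner: "line_holomorphic (\<lambda>z. cinner z c) U"
  unfolding line_holomorphic_def cinner_add_left cinner_scale_left
  by (intro conjI allI continuous_intros holomorphic_intros)

lemma line_holomorphic_power:
  "line_holomorphic f U \<Longrightarrow> line_holomorphic (\<lambda>z. f z ^ n) U"
  by (rule line_holomorphic_compose[where \<phi> = "\<lambda>x. x ^ n" and V = UNIV]) (auto intro!: holomorphic_intros)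

lemma of_real_cmod_even_power: "complex_of_real (cmod w ^ (2 * k)) = w ^ k * cnj w ^ k"
  by (metis complex_norm_square of_real_power power_mult power_mult_distrib)

text \<open>
  On the line through \<open>\<xi>\<close> a homogeneous function is a monomial, so \<open>\<langle>z, \<xi>\<rangle> ^ k\<close> reproduces it up to the
  moment.
\<close>

lemma integral_homogeneous_cinner_power:
  assumes f: "line_holomorphic f UNIV" and hom: "\<And>c z. f (c *s z) = c ^ k * f z" and \<xi>: "norm \<xi> = 1"
  shows "(LINT z|sphere_measure. f z * cnj (cinner z \<xi>) ^ k) = f \<xi> * of_real (sphere_moment k \<xi>)"
proof -
  have "(LINT z|sphere_measure. f z * cnj (cinner z \<xi>) ^ k)
      = (LINT z|sphere_measure. f (cinner z \<xi> *s \<xi>) * cnj (cinner z \<xi>) ^ k)"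
    using integral_sphere_line[OF line_holomorphic_subset[OF f], of 2 \<xi> "\<lambda>x. cnj x ^ k"] \<xi>
    by (simp add: continuous_intros)
  also have "\<dots> = (LINT z|sphere_measure. f \<xi> * of_real (cmod (cinner z \<xi>) ^ (2 * k)))"
    by (rule integral_sphere_cong)
       (simp only: hom of_real_cmod_even_power, simp only: mult_ac)
  also have "\<dots> = f \<xi> * of_real (sphere_moment k \<xi>)"
    unfolding sphere_moment_def integral_mult_right_zero integral_complex_of_real ..
  finally show ?thesis .
qed

text \<open>
  The integral of \<open>\<langle>z, \<zeta>\<rangle> ^ k * cnj (\<langle>z, \<xi>\<rangle> ^ k)\<close> is evaluated by reproducing the first factor, or the
  conjugate of the second. This replaces an appeal to the transitivity of the unitary group.
\<close>

lemma sphere_moment_eq_if_not_orthogonal: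
  assumes "norm \<xi> = 1" "norm \<zeta> = 1" "cinner \<xi> \<zeta> \<noteq> 0"
  shows "sphere_moment k \<xi> = sphere_moment k \<zeta>"
proof -
  have *: "(LINT z|sphere_measure. cinner z b ^ k * cnj (cinner z a) ^ k) = cinner a b ^ k * of_real (sphere_moment k a)"
    if "norm a = 1" for a b :: "complex ^ 'a"
    by (rule integral_homogeneous_cinner_power[OF line_holomorphic_power[OF line_holomorphic_cinner] _ that])
       (simp add: cinner_scale_left power_mult_distrib)
  have "cinner \<xi> \<zeta> ^ k * of_real (sphere_moment k \<xi>) = (LINT z|sphere_measure. cinner z \<zeta> ^ k * cnj (cinner z \<xi>) ^ k)"
    using *[OF assms(1)] by simp
  also have "\<dots> = (LINT z|sphere_measure. cnj (cinner z \<xi> ^ k * cnj (cinner z \<zeta>) ^ k))"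
    by (simp add: mult.commute)
  also have "\<dots> = cnj (cinner \<zeta> \<xi> ^ k * of_real (sphere_moment k \<zeta>))"
    unfolding Bochner_Integration.integral_cnj *[OF assms(2)] ..
  also have "\<dots> = cinner \<xi> \<zeta> ^ k * of_real (sphere_moment k \<zeta>)"
    by (simp add: cnj_cinner)
  finally show ?thesis using assms(3) by simp
qed

lemma sphere_moment_eq:
  fixes \<xi> \<zeta> :: "complex ^ 'd"
  assumes \<xi>: "norm \<xi> = 1" and \<zeta>: "norm \<zeta> = 1"
  shows "sphere_moment k \<xi> = sphere_moment k \<zeta>"
proof (cases "cinner \<xi> \<zeta> = 0")
  case True
  \<comment> \<open>A unit vector that is orthogonal to neither of the two links them.\<close>
  define \<eta> where "\<eta> = of_real (1 / sqrt 2) *s (\<xi> + \<zeta>)"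
  have "norm (\<xi> + \<zeta>) = sqrt 2"
    using norm_add_cinner_orthogonal[OF True] \<xi> \<zeta> by (metis norm_ge_zero one_add_one one_power2 real_sqrt_unique)
  then have \<eta>: "norm \<eta> = 1" unfolding \<eta>_def norm_scale_vec by (simp add: norm_divide)
  have "cinner \<zeta> \<xi> = 0" using True cnj_cinner[of \<xi> \<zeta>] by simp
  then have "cinner \<eta> \<xi> \<noteq> 0" "cinner \<eta> \<zeta> \<noteq> 0"
    using True \<xi> \<zeta> by (simp_all add: \<eta>_def cinner_scale_left cinner_add_left cinner_self)
  then show ?thesis
    using sphere_moment_eq_if_not_orthogonal \<xi> \<zeta> \<eta> by metis
qed (use assms sphere_moment_eq_if_not_orthogonal in blast)

lemma line_holomorphic_nth: "line_holomorphic (\<lambda>z. z $ i) U"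
  using line_holomorphic_cinner[of "axis i 1" U] by (simp add: cinner_axis)

text \<open>
  Reproduce \<open>z\<^sub>i ^ k * z\<^sub>j\<close> at the vector \<open>e\<^sub>i + e\<^sub>j\<close>, where it takes the value \<open>1\<close>, and expand
  \<open>(z\<^sub>i + z\<^sub>j) ^ (k + 1)\<close>: by orthogonality of monomials only one term survives.
\<close>

lemma integral_coordinates:
  fixes i j :: "'d::finite"
  assumes "i \<noteq> j"
  shows "real (Suc k) * (LINT z|sphere_measure. cmod (z $ i) ^ (2 * k) * (cmod (z $ j))\<^sup>2)
     = sphere_moment (Suc k) (axis i 1 :: complex ^ 'd)"
proof -
  define p where "p z = z $ i ^ k * z $ j" for z :: "complex ^ 'd"
  define a :: "complex ^ 'd" where "a = axis i 1 + axis j 1"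
  define \<xi> where "\<xi> = of_real (1 / sqrt 2) *s a"
  have ca: "cinner z a = z $ i + z $ j" for z by (simp add: a_def cinner_add_right cinner_axis)
  have pc: "continuous_on A p" for A unfolding p_def by (intro continuous_intros)
  have "norm a = sqrt 2"
  proof -
    have "cinner (axis i 1) (axis j (1::complex)) = 0" using assms by (simp only: cinner_axis) (simp add: axis_def)
    from norm_add_cinner_orthogonal[OF this] show ?thesis
      unfolding a_def by (simp add: real_sqrt_unique)
  qed
  then have \<xi>: "norm \<xi> = 1" unfolding \<xi>_def norm_scale_vec by (simp add: norm_divide)
  have p\<xi>: "p \<xi> = of_real (1 / sqrt 2) ^ Suc k"
    using assms by (simp add: p_def \<xi>_def a_def axis_def mult.commute)
  have "(LINT z|sphere_measure. p z * cnj (cinner z \<xi>) ^ Suc k) = p \<xi> * of_real (sphere_moment (Suc k) \<xi>)"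
  proof (rule integral_homogeneous_cinner_power[OF _ _ \<xi>])
    show "line_holomorphic p UNIV" unfolding p_def
      by (intro line_holomorphic_mult line_holomorphic_power line_holomorphic_nth)
  qed (simp add: p_def power_mult_distrib)
  moreover have "(LINT z|sphere_measure. p z * cnj (cinner z \<xi>) ^ Suc k)
      = of_real (1 / sqrt 2) ^ Suc k * (LINT z|sphere_measure. p z * cnj (z $ i + z $ j) ^ Suc k)"
    unfolding \<xi>_def cinner_scale_right ca integral_mult_right_zero[symmetric]
    by (rule integral_sphere_cong) (simp only: complex_cnj_mult complex_cnj_complex_of_real power_mult_distrib mult_ac)
  ultimately have "(LINT z|sphere_measure. p z * cnj (z $ i + z $ j) ^ Suc k) = of_real (sphere_moment (Suc k) \<xi>)"
    unfolding p\<xi> by simp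
  also have "(LINT z|sphere_measure. p z * cnj (z $ i + z $ j) ^ Suc k)
     = (LINT z|sphere_measure. (\<Sum>m\<le>Suc k. of_nat (Suc k choose m) * (p z * cnj (z $ i ^ m * z $ j ^ (Suc k - m)))))"
    by (rule integral_sphere_cong)
       (simp only: complex_cnj_add binomial_ring sum_distrib_left complex_cnj_mult complex_cnj_power mult_ac)
  also have "\<dots> = (\<Sum>m\<le>Suc k. of_nat (Suc k choose m) * (LINT z|sphere_measure. p z * cnj (z $ i ^ m * z $ j ^ (Suc k - m))))"
    unfolding integral_mult_right_zero[symmetric]
    by (intro Bochner_Integration.integral_sum integrable_sphere continuous_intros pc)
  also have "\<dots> = (\<Sum>m\<le>Suc k. if m = k then of_nat (Suc k choose k) * of_real (LINT z|sphere_measure. cmod (z $ i) ^ (2 * k) * (cmod (z $ j))\<^sup>2) else 0)"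
  proof (rule sum.cong[OF refl])
    fix m assume m: "m \<in> {..Suc k}"
    have "(LINT z|sphere_measure. p z * cnj (z $ i ^ m * z $ j ^ (Suc k - m)))
       = (if m = k then of_real (LINT z|sphere_measure. cmod (z $ i) ^ (2 * k) * (cmod (z $ j))\<^sup>2) else 0)"
    proof (cases "m = k")
      case True
      have "(LINT z|sphere_measure. p z * cnj (z $ i ^ m * z $ j ^ (Suc k - m)))
        = (LINT z|sphere_measure. complex_of_real (cmod (z $ i) ^ (2 * k) * (cmod (z $ j))\<^sup>2))"
        using True unfolding of_real_mult of_real_cmod_even_power p_def
        by (intro integral_sphere_cong) (simp add: mult_ac complex_norm_square flip: of_real_power)
      then show ?thesis using True by (simp del: of_real_mult)
    next
      case False
      define \<alpha> \<beta> :: "nat ^ 'd" where "\<alpha> = (\<chi> l. if l = i then k else if l = j then 1 else 0)"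
        and "\<beta> = (\<chi> l. if l = i then m else if l = j then Suc k - m else 0)"
      have two: "(\<Prod>l\<in>UNIV. z $ l ^ (if l = i then a else if l = j then b else 0)) = z $ i ^ a * z $ j ^ b"
        for z :: "complex ^ 'd" and a b
      proof -
        have "(\<Prod>l\<in>UNIV. z $ l ^ (if l = i then a else if l = j then b else 0))
            = (\<Prod>l\<in>{i,j}. z $ l ^ (if l = i then a else if l = j then b else 0))"
          by (rule prod.mono_neutral_right) auto
        then show ?thesis using assms by simp
      qed
      have "\<alpha> $ i \<noteq> \<beta> $ i" using False by (simp add: \<alpha>_def \<beta>_def)
      then have "\<alpha> \<noteq> \<beta>" by auto
      from integral_cmonom_orthogonal[OF this] show ?thesis
        using False by (simp add: cmonom_def \<alpha>_def \<beta>_def two p_def)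
    qed
    then show "of_nat (Suc k choose m) * (LINT z|sphere_measure. p z * cnj (z $ i ^ m * z $ j ^ (Suc k - m)))
      = (if m = k then of_nat (Suc k choose k) * of_real (LINT z|sphere_measure. cmod (z $ i) ^ (2 * k) * (cmod (z $ j))\<^sup>2) else 0)"
      by simp
  qed
  also have "\<dots> = of_nat (Suc k) * of_real (LINT z|sphere_measure. cmod (z $ i) ^ (2 * k) * (cmod (z $ j))\<^sup>2)"
    by (simp add: binomial_Suc_n)
  finally have "complex_of_real (real (Suc k) * (LINT z|sphere_measure. cmod (z $ i) ^ (2 * k) * (cmod (z $ j))\<^sup>2)) = of_real (sphere_moment (Suc k) \<xi>)"
    unfolding of_real_mult of_real_of_nat_eq .
  then have "real (Suc k) * (LINT z|sphere_measure. cmod (z $ i) ^ (2 * k) * (cmod (z $ j))\<^sup>2) = sphere_moment (Suc k) \<xi>"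
    using of_real_eq_iff by blast
  also have "\<dots> = sphere_moment (Suc k) (axis i 1 :: complex ^ 'd)"
    by (rule sphere_moment_eq[OF \<xi>]) simp
  finally show ?thesis .
qed

text \<open>
  Insert \<open>1 = (\<Sum>j. |z\<^sub>j|\<^sup>2)\<close> into the \<open>k\<close>-th moment at the basis vector \<open>e\<^sub>i\<close>. The summand \<open>j = i\<close> is the next
  moment, and the others are \<open>1 / (k + 1)\<close> times the next moment.
\<close>

lemma sphere_moment_recurrence:
  assumes \<xi>: "norm (\<xi> :: complex ^ 'd) = 1"
  shows "real (Suc k) * sphere_moment k \<xi> = (real CARD('d) + real k) * sphere_moment (Suc k) \<xi>"
proof -
  obtain i :: 'd where True by simp
  define e :: "complex ^ 'd" where "e = axis i 1"
  have e: "norm e = 1" by (simp add: e_def)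
  define J where "J j = (LINT z|sphere_measure. cmod (z $ i) ^ (2 * k) * (cmod ((z :: complex ^ 'd) $ j))\<^sup>2)" for j
  have "sphere_moment k e = (LINT z|sphere_measure. (\<Sum>j\<in>UNIV. cmod (z $ i) ^ (2 * k) * (cmod ((z :: complex ^ 'd) $ j))\<^sup>2))"
    unfolding sphere_moment_def
  proof (rule integral_sphere_cong)
    fix z :: "complex ^ 'd" assume "norm z = 1"
    then have "(\<Sum>j\<in>UNIV. (cmod (z $ j))\<^sup>2) = 1"
      by (simp add: norm_vec_def L2_set_def sum_nonneg)
    then show "cmod (cinner z e) ^ (2 * k) = (\<Sum>j\<in>UNIV. cmod (z $ i) ^ (2 * k) * (cmod (z $ j))\<^sup>2)"
      by (simp add: e_def cinner_axis flip: sum_distrib_left)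
  qed
  also have "\<dots> = (\<Sum>j\<in>UNIV. J j)"
    unfolding J_def by (intro Bochner_Integration.integral_sum integrable_sphere continuous_intros)
  also have "\<dots> = J i + (\<Sum>j\<in>UNIV - {i}. J j)"
    by (simp add: sum.remove)
  finally have "real (Suc k) * sphere_moment k e = real (Suc k) * J i + (\<Sum>j\<in>UNIV - {i}. real (Suc k) * J j)"
    by (simp only: distrib_left sum_distrib_left)
  also have "(\<Sum>j\<in>UNIV - {i}. real (Suc k) * J j) = (\<Sum>j\<in>UNIV - {i}. sphere_moment (Suc k) e)"
  proof (rule sum.cong[OF refl])
    fix j assume "j \<in> UNIV - {i}"
    then show "real (Suc k) * J j = sphere_moment (Suc k) e"
      unfolding J_def e_def by (intro integral_coordinates) auto
  qed
  also have "\<dots> = (real CARD('d) - 1) * sphere_moment (Suc k) e"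
    by (simp add: card_Diff_singleton of_nat_diff Suc_leI)
  also have "J i = sphere_moment (Suc k) e"
    unfolding J_def sphere_moment_def e_def cinner_axis
    by (intro integral_sphere_cong) (simp flip: power_add)
  finally have "real (Suc k) * sphere_moment k e = (real CARD('d) + real k) * sphere_moment (Suc k) e"
    by (simp add: algebra_simps)
  then show ?thesis using sphere_moment_eq[OF \<xi> e] by simp
qed

lemma sphere_moment_pochhammer:
  assumes \<xi>: "norm (\<xi> :: complex ^ 'd) = 1"
  shows "pochhammer (real CARD('d)) k * sphere_moment k \<xi> = fact k"
proof (induction k)
  case 0
  then show ?case by (simp add: sphere_moment_def prob_space.prob_space[OF prob_space_sphere_measure])
next
  case (Suc k)
  have "pochhammer (real CARD('d)) (Suc k) * sphere_moment (Suc k) \<xi>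
     = pochhammer (real CARD('d)) k * (real (Suc k) * sphere_moment k \<xi>)"
    unfolding sphere_moment_recurrence[OF \<xi>] by (simp add: pochhammer_Suc)
  also have "\<dots> = real (Suc k) * (pochhammer (real CARD('d)) k * sphere_moment k \<xi>)" by simp
  finally show ?case using Suc by simp
qed

section \<open>The Poisson-Szego formula\<close>

lemma sums_integral_sphere:
  fixes F :: "nat \<Rightarrow> complex ^ 'd \<Rightarrow> complex"
  assumes F: "\<And>k. continuous_on (sphere 0 1) (F k)"
    and B: "\<And>k z. norm z = 1 \<Longrightarrow> cmod (F k z) \<le> B k" "summable B"
    and G: "\<And>z. norm z = 1 \<Longrightarrow> (\<lambda>k. F k z) sums G z"
  shows "(\<lambda>k. LINT z|sphere_measure. F k z) sums (LINT z|sphere_measure. G z)"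
proof -
  have "(\<lambda>k. LINT z|sphere_measure. F k z) sums (LINT z|sphere_measure. (\<Sum>k. F k z))"
  proof (rule sums_integral)
    show "integrable sphere_measure (F k)" for k by (rule integrable_sphere[OF F])
    show "AE z in sphere_measure. summable (\<lambda>k. norm (F k z))"
    proof (rule AE_I2)
      fix z :: "complex ^ 'd" assume "z \<in> space sphere_measure"
      then have "norm z = 1" by (simp add: space_sphere_measure)
      then show "summable (\<lambda>k. norm (F k z))"
        by (intro summable_comparison_test'[OF B(2), of 0]) (simp add: B(1))
    qed
    show "summable (\<lambda>k. LINT z|sphere_measure. norm (F k z))"
    proof (rule summable_comparison_test'[OF B(2), of 0])
      fix k :: nat
      have "(LINT z|sphere_measure. norm (F k z)) \<le> (LINT z|(sphere_measure :: (complex ^ 'd) measure). B k)"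
        by (intro integral_mono_AE AE_I2 integrable_sphere continuous_intros F)
           (simp add: B(1) space_sphere_measure)
      then show "norm (LINT z|sphere_measure. norm (F k z)) \<le> B k"
        by (simp add: prob_space.prob_space[OF prob_space_sphere_measure])
    qed
  qed
  also have "(LINT z|sphere_measure. (\<Sum>k. F k z)) = (LINT z|sphere_measure. G z)"
    by (rule integral_sphere_cong) (simp add: sums_unique[OF G])
  finally show ?thesis .
qed

lemma sums_inverse_power:
  fixes x :: complex
  assumes "cmod x < 1"
  shows "(\<lambda>k. of_real (pochhammer (real n) k / fact k) * x ^ k) sums inverse ((1 - x) ^ n)"
proof -
  have "(\<lambda>k. ((- of_nat n) gchoose k) * (- x) ^ k) sums (1 + - x) powr (- of_nat n)"
    by (rule gen_binomial_complex) (use assms in simp)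
  moreover have "((- of_nat n) gchoose k) * (- x) ^ k = of_real (pochhammer (real n) k / fact k) * x ^ k" for k
    by (simp add: gbinomial_pochhammer power_minus[of x] flip: pochhammer_of_real)
  moreover have "(1 + - x) powr (- of_nat n) = inverse ((1 - x) ^ n)"
    using assms by (auto simp: powr_minus powr_nat)
  ultimately show ?thesis by simp
qed

lemma cmod_cinner_le_1: "norm z = 1 \<Longrightarrow> norm \<xi> = 1 \<Longrightarrow> cmod (cinner z \<xi>) \<le> 1"
  using cmod_cinner_le[of z \<xi>] by simp

text \<open>
  The Cauchy formula of the ball on a complex line. Expand both factors in power series in
  \<open>\<langle>z, \<xi>\<rangle>\<close>; orthogonality leaves the diagonal, where the coefficients of the Cauchy kernel cancel the
  moments.
\<close>

lemma szego_formula_line: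
  fixes \<xi> :: "complex ^ 'd"
  assumes \<psi>: "\<psi> holomorphic_on ball 0 \<rho>" and \<rho>: "\<rho> > 1" and \<xi>: "norm \<xi> = 1" and r: "0 \<le> r" "r < 1"
  shows "(LINT z|sphere_measure. \<psi> (cinner z \<xi>) * cnj (inverse ((1 - of_real r * cinner z \<xi>) ^ CARD('d)))) = \<psi> (of_real r)"
proof -
  let ?c = "\<lambda>k. pochhammer (real CARD('d)) k / fact k"
  define b where "b j = (deriv ^^ j) \<psi> 0 / fact j" for j
  have b: "(\<lambda>j. b j * x ^ j) sums \<psi> x" if "cmod x < \<rho>" for x
    using holomorphic_power_series[OF \<psi>, of x] that by (simp add: b_def)
  have "summable (\<lambda>j. b j * of_real ((1 + \<rho>) / 2) ^ j)"
    by (rule sums_summable[OF b], simp only: norm_of_real) (use \<rho> in simp)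
  moreover have "norm (1 :: complex) < norm (complex_of_real ((1 + \<rho>) / 2))"
    using \<rho> by (simp only: norm_of_real) simp
  ultimately have sb: "summable (\<lambda>j. cmod (b j))"
    using powser_insidea[of b "of_real ((1 + \<rho>) / 2)" 1] by simp
  have \<psi>c: "continuous_on (sphere 0 1) (\<lambda>z. \<psi> (cinner z \<xi>))"
    using \<rho> cmod_cinner_le_1[OF _ \<xi>]
    by (intro continuous_on_compose2[OF holomorphic_on_imp_continuous_on[OF \<psi>]] continuous_intros) force
  then have "bounded ((\<lambda>z. \<psi> (cinner z \<xi>)) ` sphere 0 1)"
    by (intro compact_imp_bounded compact_continuous_image compact_sphere)
  then obtain B where B: "\<And>z. norm z = 1 \<Longrightarrow> cmod (\<psi> (cinner z \<xi>)) \<le> B"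
    unfolding bounded_iff by (metis (no_types, lifting) dist_0_norm imageI mem_sphere)
  have coeff: "(LINT z|sphere_measure. \<psi> (cinner z \<xi>) * cnj (cinner z \<xi>) ^ k) = b k * of_real (sphere_moment k \<xi>)" for k
  proof -
    have mono: "(LINT z|sphere_measure. b j * cinner z \<xi> ^ j * cnj (cinner z \<xi>) ^ k)
        = (if j = k then b k * of_real (sphere_moment k \<xi>) else 0)" for j
    proof (cases "j = k")
      case True
      then show ?thesis
        unfolding sphere_moment_def integral_complex_of_real[symmetric] of_real_cmod_even_power mult.assoc by simp
    next
      case False
      have "(LINT z|sphere_measure. cinner z \<xi> ^ j * cnj (cinner z \<xi> ^ k)) = 0"
        by (rule integral_homogeneous_orthogonal[OF _ _ False])
           (auto intro!: continuous_intros simp: cinner_scale_left power_mult_distrib)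
      with False show ?thesis by (simp add: mult.assoc)
    qed
    have "(\<lambda>j. LINT z|sphere_measure. b j * cinner z \<xi> ^ j * cnj (cinner z \<xi>) ^ k) sums
        (LINT z|sphere_measure. \<psi> (cinner z \<xi>) * cnj (cinner z \<xi>) ^ k)"
    proof (rule sums_integral_sphere[OF _ _ sb])
      fix z :: "complex ^ 'd" assume z: "norm z = 1"
      have 1: "cmod (cinner z \<xi>) ^ n \<le> 1" for n using cmod_cinner_le_1[OF z \<xi>] by (simp add: power_le_one)
      show "cmod (b j * cinner z \<xi> ^ j * cnj (cinner z \<xi>) ^ k) \<le> cmod (b j)" for j
        using mult_left_le[OF mult_le_one[OF 1[of j] _ 1[of k]], of "cmod (b j)"]
        by (simp add: norm_mult norm_power mult.assoc)
      show "(\<lambda>j. b j * cinner z \<xi> ^ j * cnj (cinner z \<xi>) ^ k) sums (\<psi> (cinner z \<xi>) * cnj (cinner z \<xi>) ^ k)"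
        using cmod_cinner_le_1[OF z \<xi>] \<rho> by (intro sums_mult2 b) simp
    qed (intro continuous_intros)
    moreover have "(\<lambda>j. if j = k then b k * of_real (sphere_moment k \<xi>) else 0) sums (b k * of_real (sphere_moment k \<xi>))"
      using sums_single[of k "\<lambda>_. b k * of_real (sphere_moment k \<xi>)"] by simp
    ultimately show ?thesis unfolding mono using sums_unique2 by blast
  qed
  have ser: "(\<lambda>k. cnj (of_real (?c k) * (of_real r * w) ^ k)) sums cnj (inverse ((1 - of_real r * w) ^ CARD('d)))"
    if "cmod w \<le> 1" for w
    unfolding sums_cnj using that r
    by (intro sums_inverse_power) (simp add: norm_mult mult_le_cancel_left1 le_less_trans[OF mult_left_le])
  have "(\<lambda>k. LINT z|sphere_measure. \<psi> (cinner z \<xi>) * cnj (of_real (?c k) * (of_real r * cinner z \<xi>) ^ k)) sums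
     (LINT z|sphere_measure. \<psi> (cinner z \<xi>) * cnj (inverse ((1 - of_real r * cinner z \<xi>) ^ CARD('d))))"
  proof (rule sums_integral_sphere)
    have "summable (\<lambda>k. of_real (?c k) * complex_of_real ((1 + r) / 2) ^ k)"
      by (rule sums_summable[OF sums_inverse_power], simp only: norm_of_real) (use r in simp)
    moreover have "norm (complex_of_real r) < norm (complex_of_real ((1 + r) / 2))"
      using r by (simp only: norm_of_real) simp
    ultimately have "summable (\<lambda>k. cmod (of_real (?c k) * of_real r ^ k))"
      by (rule powser_insidea)
    then show "summable (\<lambda>k. B * cmod (of_real (?c k) * of_real r ^ k))" by (rule summable_mult)
    fix k and z :: "complex ^ 'd" assume z: "norm z = 1"
    have "cmod (of_real (?c k) * (of_real r * cinner z \<xi>) ^ k) = cmod (of_real (?c k) * of_real r ^ k) * cmod (cinner z \<xi>) ^ k"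
      by (simp only: norm_mult norm_power power_mult_distrib mult.assoc)
    also have "\<dots> \<le> cmod (of_real (?c k) * of_real r ^ k)"
      using cmod_cinner_le_1[OF z \<xi>] by (intro mult_left_le power_le_one) auto
    finally show "cmod (\<psi> (cinner z \<xi>) * cnj (of_real (?c k) * (of_real r * cinner z \<xi>) ^ k))
       \<le> B * cmod (of_real (?c k) * of_real r ^ k)"
      unfolding norm_mult[of "\<psi> _"] complex_mod_cnj using B[OF z] order_trans[OF norm_ge_zero B[OF z]]
      by (intro mult_mono) auto
  next
    fix z :: "complex ^ 'd" assume z: "norm z = 1"
    show "(\<lambda>k. \<psi> (cinner z \<xi>) * cnj (of_real (?c k) * (of_real r * cinner z \<xi>) ^ k)) sums
       (\<psi> (cinner z \<xi>) * cnj (inverse ((1 - of_real r * cinner z \<xi>) ^ CARD('d))))"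
      by (intro sums_mult ser cmod_cinner_le_1[OF z \<xi>])
  qed (intro continuous_intros \<psi>c)
  moreover have "(LINT z|sphere_measure. \<psi> (cinner z \<xi>) * cnj (of_real (?c k) * (of_real r * cinner z \<xi>) ^ k))
      = b k * of_real r ^ k" for k
  proof -
    have "(LINT z|sphere_measure. \<psi> (cinner z \<xi>) * cnj (of_real (?c k) * (of_real r * cinner z \<xi>) ^ k))
       = of_real (?c k) * of_real r ^ k * (LINT z|sphere_measure. \<psi> (cinner z \<xi>) * cnj (cinner z \<xi>) ^ k)"
      unfolding integral_mult_right_zero[symmetric] by (rule integral_sphere_cong) (simp add: power_mult_distrib)
    also have "\<dots> = b k * of_real r ^ k * of_real (?c k * sphere_moment k \<xi>)"
      unfolding coeff by simp
    also have "?c k * sphere_moment k \<xi> = 1" using sphere_moment_pochhammer[OF \<xi>, of k] by simp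
    finally show ?thesis by simp
  qed
  ultimately have "(\<lambda>k. b k * of_real r ^ k) sums
     (LINT z|sphere_measure. \<psi> (cinner z \<xi>) * cnj (inverse ((1 - of_real r * cinner z \<xi>) ^ CARD('d))))"
    by simp
  then show ?thesis using b[of "of_real r"] r \<rho> sums_unique2 by fastforce
qed

text \<open>
  The Poisson-Szego kernel at the point \<open>r \<xi>\<close>: the squared modulus of the Cauchy kernel, divided by
  its value on the diagonal.
\<close>

definition poisson :: "real \<Rightarrow> complex ^ 'd \<Rightarrow> complex ^ 'd \<Rightarrow> real" where
  "poisson r \<xi> z = (1 - r\<^sup>2) ^ CARD('d) / cmod (1 - of_real r * cinner z \<xi>) ^ (2 * CARD('d))"

lemma cmod_poisson_denominator:
  assumes "0 \<le> r" "r < 1" "cmod w \<le> 1"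
  shows "1 - r \<le> cmod (1 - of_real r * w)"
proof -
  have "1 - r \<le> 1 - cmod (of_real r * w)"
    using assms by (simp add: norm_mult mult_left_le)
  also have "\<dots> \<le> cmod (1 - of_real r * w)" using norm_triangle_ineq2[of 1 "of_real r * w"] by simp
  finally show ?thesis .
qed

lemma continuous_on_poisson:
  assumes "0 \<le> r" "r < 1" "norm \<xi> = 1"
  shows "continuous_on (sphere 0 1) (poisson r \<xi>)"
  unfolding poisson_def[abs_def]
proof (intro continuous_intros ballI)
  fix z :: "complex ^ 'a" assume "z \<in> sphere 0 1"
  then show "cmod (1 - complex_of_real r * cinner z \<xi>) ^ (2 * CARD('a)) \<noteq> 0"
    using cmod_poisson_denominator[OF assms(1,2) cmod_cinner_le_1[OF _ assms(3)], of z] assms by auto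
qed

lemma poisson_nonneg: "0 \<le> r \<Longrightarrow> r < 1 \<Longrightarrow> 0 \<le> poisson r \<xi> z"
  by (simp add: poisson_def abs_square_le_1)

text \<open>
  The Cauchy formula for the product of \<open>f\<close> and the holomorphic factor
  \<open>((1 - r\<^sup>2) / (1 - r \<langle>z, \<xi>\<rangle>)) ^ d\<close>, which is \<open>1\<close> at the point \<open>r \<xi>\<close>.
\<close>

lemma poisson_formula:
  fixes f :: "complex ^ 'd \<Rightarrow> complex"
  assumes f: "line_holomorphic f (ball 0 R)" and R: "R > 1" and \<xi>: "norm \<xi> = 1" and r: "0 \<le> r" "r < 1"
  shows "(LINT z|sphere_measure. f z * of_real (poisson r \<xi> z)) = f (of_real r *s \<xi>)"
proof -
  let ?d = "CARD('d)"
  define k where "k w = complex_of_real ((1 - r\<^sup>2) ^ ?d / cmod (1 - of_real r * w) ^ (2 * ?d))" for w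
  define \<psi> where "\<psi> w = f (0 + w *s \<xi>) * of_real ((1 - r\<^sup>2) ^ ?d) * inverse ((1 - of_real r * w) ^ ?d)" for w
  \<comment> \<open>Any radius between \<open>1\<close> and \<open>1 / r\<close> keeps the zero of \<open>1 - r w\<close> outside; this one also makes sense for \<open>r = 0\<close>.\<close>
  define \<rho> where "\<rho> = min R (2 / (1 + r))"
  have \<rho>: "\<rho> > 1" using r R by (simp add: \<rho>_def)
  have rw: "cmod (of_real r * w) < 1" if "cmod w < \<rho>" for w
  proof -
    have "r * cmod w \<le> r * (2 / (1 + r))" using that r by (intro mult_left_mono) (auto simp: \<rho>_def)
    also have "\<dots> < 1" using r by (simp add: field_simps)
    finally show ?thesis using r by (simp add: norm_mult)
  qed
  have nz: "1 - of_real r * w \<noteq> 0" if "cmod w < \<rho>" for w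
    using rw[OF that] by (metis eq_iff_diff_eq_0 less_irrefl norm_one)
  have "(LINT z|sphere_measure. f z * of_real (poisson r \<xi> z)) = (LINT z|sphere_measure. f z * k (cinner z \<xi>))"
    by (simp add: k_def poisson_def)
  also have "\<dots> = (LINT z|sphere_measure. f (cinner z \<xi> *s \<xi>) * k (cinner z \<xi>))"
  proof (rule integral_sphere_line[OF f R])
    show "continuous_on (cball 0 1) k" unfolding k_def
      using nz \<rho> by (intro continuous_intros) (auto simp: dist_norm)
  qed (use \<xi> in auto)
  also have "\<dots> = (LINT z|sphere_measure. \<psi> (cinner z \<xi>) * cnj (inverse ((1 - of_real r * cinner z \<xi>) ^ ?d)))"
  proof (rule integral_sphere_cong)
    fix z :: "complex ^ 'd" assume "norm z = 1"
    show "f (cinner z \<xi> *s \<xi>) * k (cinner z \<xi>) = \<psi> (cinner z \<xi>) * cnj (inverse ((1 - of_real r * cinner z \<xi>) ^ ?d))"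
      unfolding k_def \<psi>_def of_real_divide of_real_cmod_even_power by (simp add: divide_inverse mult_ac)
  qed
  also have "\<dots> = \<psi> (of_real r)"
  proof (rule szego_formula_line[OF _ \<rho> \<xi> r])
    show "\<psi> holomorphic_on ball 0 \<rho>" unfolding \<psi>_def using nz \<xi>
      by (intro holomorphic_intros line_holomorphicD[OF f]) (auto simp: norm_scale_vec \<rho>_def)
  qed
  also have "\<psi> (of_real r) = f (of_real r *s \<xi>)"
  proof -
    have "1 - complex_of_real r * of_real r = of_real (1 - r\<^sup>2)" by (simp add: power2_eq_square)
    moreover have "1 - r\<^sup>2 \<noteq> 0" using r by (auto simp: power2_eq_1_iff)
    ultimately show ?thesis by (simp add: \<psi>_def del: of_real_diff)
  qed
  finally show ?thesis .
qed

lemma integral_poisson: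
  assumes "norm \<xi> = 1" "0 \<le> r" "r < 1"
  shows "(LINT z|sphere_measure. poisson r \<xi> z) = 1"
proof -
  have "complex_of_real (LINT z|sphere_measure. poisson r \<xi> z) = 1"
    using poisson_formula[OF line_holomorphic_const _ assms, of 2 1] by simp
  then show ?thesis by (metis of_real_eq_1_iff)
qed

lemma poisson_inequality:
  assumes f: "line_holomorphic f (ball 0 R)" and R: "R > 1" and \<xi>: "norm \<xi> = 1" and r: "0 \<le> r" "r < 1"
  shows "cmod (f (of_real r *s \<xi>)) \<le> (LINT z|sphere_measure. poisson r \<xi> z * cmod (f z))"
proof -
  have "cmod (f (of_real r *s \<xi>)) \<le> (LINT z|sphere_measure. cmod (f z * of_real (poisson r \<xi> z)))"
    unfolding poisson_formula[OF assms, symmetric] by (rule integral_norm_bound)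
  also have "\<dots> = (LINT z|sphere_measure. poisson r \<xi> z * cmod (f z))"
    using poisson_nonneg[OF r, of \<xi>] by (intro integral_sphere_cong) (simp add: norm_mult mult.commute)
  finally show ?thesis .
qed

section \<open>Nonisotropic caps\<close>

text \<open>
  Split \<open>a\<close> and \<open>c\<close> into components along \<open>b\<close> and orthogonal to \<open>b\<close>. The orthogonal components have
  squared norms at most \<open>2 |1 - \<langle>a, b\<rangle>|\<close> and \<open>2 |1 - \<langle>b, c\<rangle>|\<close>, and their inner product supplies the mixed
  term of the square of the right-hand side.
\<close>

lemma cinner_quasi_triangle:
  assumes a: "norm a = 1" and b: "norm b = 1" and c: "norm c = 1"
  shows "sqrt (cmod (1 - cinner a c)) \<le> sqrt (cmod (1 - cinner a b)) + sqrt (cmod (1 - cinner b c))"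
proof -
  define x y where "x = cmod (1 - cinner a b)" and "y = cmod (1 - cinner b c)"
  have bb: "cinner b b = 1" by (simp add: cinner_self b)
  define a' c' where "a' = a - cinner a b *s b" and "c' = c - cinner c b *s b"
  have orth: "(norm (v - cinner v b *s b))\<^sup>2 \<le> 2 * cmod (1 - cinner v b)" if v: "norm v = 1" for v
  proof -
    define p where "p = cmod (cinner v b)"
    have "cinner (cinner v b *s b) (v - cinner v b *s b) = 0"
      by (simp add: cinner_scale_left cinner_diff_right cinner_scale_right cnj_cinner bb)
    from norm_add_cinner_orthogonal[OF this]
    have "(norm (v - cinner v b *s b))\<^sup>2 = 1 - p\<^sup>2" using v b by (simp add: norm_scale_vec p_def)
    also have "\<dots> = (1 + p) * (1 - p)" by (simp add: power2_eq_square algebra_simps)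
    also have "\<dots> \<le> 2 * (1 - p)"
      using cmod_cinner_le_1[OF v b] by (intro mult_right_mono) (auto simp: p_def)
    also have "1 - p \<le> cmod (1 - cinner v b)"
      using norm_triangle_ineq2[of 1 "cinner v b"] by (simp add: p_def)
    finally show ?thesis by simp
  qed
  have y': "cmod (1 - cinner c b) = y"
    unfolding y_def by (metis cnj_cinner complex_cnj_diff complex_cnj_one complex_mod_cnj)
  have "(norm a')\<^sup>2 \<le> 2 * x" "(norm c')\<^sup>2 \<le> 2 * y"
    using orth[OF a] orth[OF c] y' by (simp_all add: a'_def c'_def x_def)
  then have "norm a' \<le> sqrt (2 * x)" "norm c' \<le> sqrt (2 * y)" by (simp_all add: real_le_rsqrt)
  then have *: "norm a' * norm c' \<le> sqrt (2 * x) * sqrt (2 * y)" by (intro mult_mono) (auto simp: x_def)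
  have ac: "cmod (cinner a' c') \<le> 2 * (sqrt x * sqrt y)"
  proof -
    have "sqrt (2 * x) * sqrt (2 * y) = (sqrt 2 * sqrt 2) * (sqrt x * sqrt y)"
      by (simp only: real_sqrt_mult mult_ac)
    then show ?thesis using * cmod_cinner_le[of a' c'] by simp
  qed
  have "cinner a' c' = cinner a c - cinner a b * cinner b c"
    by (simp add: a'_def c'_def cinner_diff_left cinner_diff_right cinner_scale_left cinner_scale_right bb cnj_cinner)
  then have "1 - cinner a c = (1 - cinner a b) + cinner a b * (1 - cinner b c) - cinner a' c'"
    by (simp add: algebra_simps)
  also have "cmod \<dots> \<le> x + cmod (cinner a b) * y + 2 * (sqrt x * sqrt y)"
    unfolding x_def y_def using ac[unfolded x_def y_def]
    by (metis (no_types, opaque_lifting) add_mono norm_triangle_le norm_triangle_le_diff norm_mult order_refl)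
  also have "\<dots> \<le> x + y + 2 * (sqrt x * sqrt y)"
    using cmod_cinner_le_1[OF a b] by (simp add: mult_left_le_one_le y_def)
  also have "\<dots> = (sqrt x + sqrt y)\<^sup>2" by (simp add: power2_sum x_def y_def)
  finally show ?thesis unfolding x_def y_def by (intro real_le_lsqrt) auto
qed

text \<open>
  Balls of the nonisotropic metric \<open>sqrt |1 - \<langle>z, \<zeta>\<rangle>|\<close> on the sphere, with the squared radius as parameter. They are
  taken in the whole space so that they are open sets there.
\<close>

definition cap :: "complex ^ 'd \<Rightarrow> real \<Rightarrow> (complex ^ 'd) set" where
  "cap \<zeta> \<rho> = {z. cmod (1 - cinner z \<zeta>) < \<rho>}"

lemma open_cap: "open (cap \<zeta> \<rho>)"
  unfolding cap_def by (intro open_Collect_less continuous_intros)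

lemma sphere_Int_open_sets: "open U \<Longrightarrow> sphere 0 1 \<inter> U \<in> sets sphere_measure"
  by (simp add: sets_sphere_measure sphere_borel_def sets_restrict_space)

lemma integrable_indicator_mult_sphere:
  fixes u :: "complex ^ 'd \<Rightarrow> real"
  assumes "continuous_on (sphere 0 1) u" "open U"
  shows "integrable sphere_measure (\<lambda>z. indicator U z * u z)"
proof -
  have "integrable sphere_measure (\<lambda>z. indicator (sphere 0 1 \<inter> U) z *\<^sub>R u z)"
    by (intro integrable_mult_indicator sphere_Int_open_sets integrable_sphere assms)
  then show ?thesis
    by (rule Bochner_Integration.integrable_cong[THEN iffD1, rotated -1])
       (auto simp: space_sphere_measure indicator_def)
qed

text \<open>
  The Poisson kernel at \<open>(1 - \<rho>) \<zeta>\<close> has integral \<open>1\<close> and, for \<open>\<rho> < 1\<close>, is at least \<open>1 / (4 \<rho>) ^ d\<close> on the cap.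
\<close>

lemma measure_cap_le:
  fixes \<zeta> :: "complex ^ 'd"
  assumes \<zeta>: "norm \<zeta> = 1" and \<rho>: "\<rho> > 0"
  shows "measure sphere_measure (sphere 0 1 \<inter> cap \<zeta> \<rho>) \<le> 4 ^ CARD('d) * \<rho> ^ CARD('d)"
proof (cases "\<rho> < 1")
  case True
  let ?d = "CARD('d)"
  define r where "r = 1 - \<rho>"
  have r: "0 \<le> r" "r < 1" using True \<rho> by (auto simp: r_def)
  have "measure sphere_measure (sphere 0 1 \<inter> cap \<zeta> \<rho>) = (LINT z|sphere_measure. indicator (sphere 0 1 \<inter> cap \<zeta> \<rho>) z)"
    using sphere_Int_open_sets[OF open_cap, of \<zeta> \<rho>] sets.sets_into_space
    by (subst Bochner_Integration.integral_indicator) (auto simp: Int_absorb2 space_sphere_measure)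
  also have "\<dots> \<le> (LINT z|sphere_measure. 4 ^ ?d * \<rho> ^ ?d * poisson r \<zeta> z)"
  proof (rule integral_mono_AE)
    show "AE z in sphere_measure. indicator (sphere 0 1 \<inter> cap \<zeta> \<rho>) z \<le> 4 ^ ?d * \<rho> ^ ?d * poisson r \<zeta> z"
    proof (rule AE_I2)
      fix z :: "complex ^ 'd" assume "z \<in> space sphere_measure"
      then have z: "norm z = 1" by (simp add: space_sphere_measure)
      show "indicator (sphere 0 1 \<inter> cap \<zeta> \<rho>) z \<le> 4 ^ ?d * \<rho> ^ ?d * poisson r \<zeta> z"
      proof (cases "z \<in> cap \<zeta> \<rho>")
        case True
        let ?w = "cinner z \<zeta>"
        have pos: "0 < cmod (1 - of_real r * ?w)"
          using cmod_poisson_denominator[OF r cmod_cinner_le_1[OF z \<zeta>]] r by linarith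
        have "1 - of_real r * ?w = (1 - ?w) + of_real \<rho> * ?w" by (simp add: r_def algebra_simps)
        then have "cmod (1 - of_real r * ?w) \<le> cmod (1 - ?w) + \<rho> * cmod ?w"
          using \<rho> by (metis abs_of_pos norm_mult norm_of_real norm_triangle_ineq)
        also have "\<dots> \<le> \<rho> + \<rho> * 1"
          using True \<rho> cmod_cinner_le_1[OF z \<zeta>] by (intro add_mono mult_left_mono) (auto simp: cap_def)
        finally have "cmod (1 - of_real r * ?w) ^ (2 * ?d) \<le> (2 * \<rho>) ^ (2 * ?d)"
          by (intro power_mono) auto
        moreover have "\<rho> ^ ?d \<le> (1 - r\<^sup>2) ^ ?d"
        proof (rule power_mono)
          have "1 - r\<^sup>2 = \<rho> * (1 + r)" by (simp add: r_def power2_eq_square algebra_simps)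
          then show "\<rho> \<le> 1 - r\<^sup>2" using r \<rho> by simp
        qed (use \<rho> in simp)
        ultimately have "\<rho> ^ ?d / (2 * \<rho>) ^ (2 * ?d) \<le> poisson r \<zeta> z"
          unfolding poisson_def using \<rho> pos r by (intro frac_le) (auto simp: abs_square_le_1)
        moreover have "(2 * \<rho>) ^ (2 * ?d) = 4 ^ ?d * \<rho> ^ ?d * \<rho> ^ ?d"
          by (simp add: power_mult power_mult_distrib power2_eq_square)
        ultimately have "1 \<le> 4 ^ ?d * \<rho> ^ ?d * poisson r \<zeta> z"
          using \<rho> by (simp add: field_simps)
        then show ?thesis by (simp add: indicator_def)
      qed (use poisson_nonneg[OF r, of \<zeta> z] \<rho> in simp)
    qed
    show "integrable sphere_measure (indicat_real (sphere 0 1 \<inter> cap \<zeta> \<rho>))"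
      by (intro integrable_real_indicator sphere_Int_open_sets open_cap)
         (simp add: finite_measure.emeasure_finite[OF finite_sphere_measure] less_top[symmetric])
  qed (intro integrable_sphere continuous_intros continuous_on_poisson r \<zeta>)
  also have "\<dots> = 4 ^ ?d * \<rho> ^ ?d" by (simp add: integral_poisson[OF \<zeta> r])
  finally show ?thesis .
next
  case False
  have "measure sphere_measure (sphere 0 1 \<inter> cap \<zeta> \<rho>) \<le> 1"
    by (rule prob_space.prob_le_1[OF prob_space_sphere_measure])
  also have "\<dots> \<le> 4 ^ CARD('d) * \<rho> ^ CARD('d)"
    using False by (intro mult_ge1_I one_le_power) auto
  finally show ?thesis .
qed

section \<open>The maximal inequality on Koranyi regions\<close>

text \<open>
  Put \<open>z = r \<xi>\<close> and \<open>\<delta> = 1 - r\<close>. For \<open>z\<close> in the Koranyi region at \<open>\<zeta>\<close>, the distances from \<open>\<xi>\<close> and \<open>\<zeta>\<close>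
  to a point of the sphere are comparable at scales above \<open>\<delta>\<close>. Hence the Poisson kernel at \<open>z\<close> is at
  most a sum of multiples of indicators of caps around \<open>\<zeta>\<close> of radii \<open>2 ^ j \<delta>\<close>, up to a constant, and
  these multiples decay like \<open>4 ^ (- j d)\<close>, whereas the admitted integrals over the caps grow
  only like \<open>2 ^ (j d)\<close>. The averages are normalised by \<open>\<rho> ^ d\<close> instead of the measure of the
  cap; so an upper bound for the measure of caps is all that enters the maximal theory.
\<close>

lemma koranyi_maximal_inequality:
  fixes f :: "complex ^ 'd \<Rightarrow> complex"
  assumes f: "line_holomorphic f (ball 0 R)" and R: "R > 1" and \<zeta>: "norm \<zeta> = 1"
    and c: "c > 0" and z: "z \<in> koranyi_region c \<zeta>" and lam: "lam \<ge> 0"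
    and avg: "\<And>\<rho>. \<rho> > 0 \<Longrightarrow> (LINT \<eta>|sphere_measure. indicator (cap \<zeta> \<rho>) \<eta> * cmod (f \<eta>)) \<le> lam * \<rho> ^ CARD('d)"
  shows "cmod (f z) \<le> 2 * (8 * (2 * c + 6)) ^ CARD('d) * lam"
proof -
  let ?d = "CARD('d)"
  \<comment> \<open>The constant with \<open>|1 - \<langle>\<eta>, \<zeta>\<rangle>| \<le> A |1 - r \<langle>\<eta>, \<xi>\<rangle>|\<close> on the sphere, see \<open>mA\<close> below.\<close>
  define A where "A = 2 * c + 6"
  have A: "A > 0" using c by (simp add: A_def)
  define r where "r = norm z"
  define \<delta> where "\<delta> = 1 - r"
  define \<xi> where "\<xi> = (if z = 0 then \<zeta> else of_real (1 / r) *s z)"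
  have r: "0 \<le> r" "r < 1" using z by (auto simp: koranyi_region_def r_def)
  then have \<delta>: "\<delta> > 0" by (simp add: \<delta>_def)
  have \<xi>: "norm \<xi> = 1"
    using \<zeta> unfolding \<xi>_def by (auto simp only: norm_scale_vec norm_of_real split: if_split) (simp add: r_def)
  have z\<xi>: "z = of_real r *s \<xi>" by (auto simp: \<xi>_def r_def vec_eq_iff)
  have "cmod (1 - cinner z \<zeta>) < c / 2 * (1 - r\<^sup>2)" using z by (simp add: koranyi_region_def r_def)
  also have "c / 2 * (1 - r\<^sup>2) = c * \<delta> * ((1 + r) / 2)" by (simp add: \<delta>_def power2_eq_square field_simps)
  also have "\<dots> \<le> c * \<delta>" using c r \<delta> by (intro mult_left_le) auto
  finally have k1: "cmod (1 - of_real r * cinner \<xi> \<zeta>) \<le> c * \<delta>"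
    by (simp add: z\<xi> cinner_scale_left)
  have split: "cmod (1 - w) \<le> cmod (1 - of_real r * w) + \<delta>" if "cmod w \<le> 1" for w
  proof -
    have "1 - w = (1 - of_real r * w) - of_real \<delta> * w" by (simp add: \<delta>_def algebra_simps)
    then have "cmod (1 - w) \<le> cmod (1 - of_real r * w) + cmod (of_real \<delta> * w)"
      by (metis norm_triangle_ineq4)
    also have "cmod (of_real \<delta> * w) \<le> \<delta>" using that \<delta> by (simp add: norm_mult mult_left_le)
    finally show ?thesis by simp
  qed
  have k2: "cmod (1 - cinner \<xi> \<zeta>) \<le> (c + 1) * \<delta>"
    using split[OF cmod_cinner_le_1[OF \<xi> \<zeta>]] k1 by (simp add: algebra_simps)
  define m where "m \<eta> = cmod (1 - of_real r * cinner \<eta> \<xi>)" for \<eta>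
  have m\<delta>: "\<delta> \<le> m \<eta>" if "norm \<eta> = 1" for \<eta>
    using cmod_poisson_denominator[OF r cmod_cinner_le_1[OF that \<xi>]] by (simp add: m_def \<delta>_def)
  have mA: "cmod (1 - cinner \<eta> \<zeta>) \<le> A * m \<eta>" if \<eta>: "norm \<eta> = 1" for \<eta>
  proof -
    let ?p = "cmod (1 - cinner \<eta> \<xi>)" and ?q = "cmod (1 - cinner \<xi> \<zeta>)"
    have "cmod (1 - cinner \<eta> \<zeta>) \<le> (sqrt ?p + sqrt ?q)\<^sup>2"
      using cinner_quasi_triangle[OF \<eta> \<xi> \<zeta>] by (metis abs_norm_cancel norm_ge_zero real_sqrt_ge_zero real_sqrt_le_iff real_sqrt_abs real_sqrt_pow2 power_mono)
    also have "\<dots> \<le> 2 * ?p + 2 * ?q"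
      using sum_squares_bound[of "sqrt ?p" "sqrt ?q"] by (simp add: power2_sum)
    also have "?p \<le> 2 * m \<eta>" using split[OF cmod_cinner_le_1[OF \<eta> \<xi>]] m\<delta>[OF \<eta>] by (simp add: m_def)
    also have "?q \<le> (c + 1) * m \<eta>" using k2 m\<delta>[OF \<eta>] c by (meson add_nonneg_nonneg less_imp_le mult_left_mono order_trans zero_le_one)
    finally show ?thesis by (simp add: A_def algebra_simps)
  qed
  obtain J where J: "2 / (A * \<delta>) < 2 ^ J" using real_arch_pow[of 2] by auto
  define w where "w j = (8 / (4 ^ j * \<delta>)) ^ ?d" for j :: nat
  have w0: "w j \<ge> 0" for j using \<delta> by (simp add: w_def)
  let ?C = "\<lambda>j :: nat. cap \<zeta> (A * 2 ^ j * \<delta>)"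
  have layer: "poisson r \<xi> \<eta> \<le> (\<Sum>j\<le>J. w j * indicator (?C j) \<eta>)" if \<eta>: "norm \<eta> = 1" for \<eta>
  proof -
    have "cmod (1 - cinner \<eta> \<zeta>) \<le> 2"
      using norm_triangle_ineq4[of 1 "cinner \<eta> \<zeta>"] cmod_cinner_le_1[OF \<eta> \<zeta>] by simp
    also have "2 < A * 2 ^ J * \<delta>" using J A \<delta> by (simp add: field_simps)
    finally have ex: "\<eta> \<in> ?C J" by (simp add: cap_def)
    define j where "j = (LEAST j. \<eta> \<in> ?C j)"
    have j: "\<eta> \<in> ?C j" "j \<le> J" unfolding j_def using ex by (auto intro: LeastI Least_le)
    have "2 ^ j * \<delta> / 2 \<le> m \<eta>"
    proof (cases j)
      case 0
      then show ?thesis using m\<delta>[OF \<eta>] \<delta> by simp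
    next
      case (Suc i)
      then have "\<eta> \<notin> ?C i" using not_less_Least[of i "\<lambda>j. \<eta> \<in> ?C j"] by (simp add: j_def)
      then have "A * 2 ^ i * \<delta> \<le> A * m \<eta>" using mA[OF \<eta>] by (simp add: cap_def)
      then show ?thesis using A Suc by (simp add: mult.assoc)
    qed
    then have "(2 ^ j * \<delta> / 2) ^ (2 * ?d) \<le> m \<eta> ^ (2 * ?d)"
      using \<delta> by (intro power_mono) auto
    moreover have "(1 - r\<^sup>2) ^ ?d \<le> (2 * \<delta>) ^ ?d"
    proof (rule power_mono)
      have "1 - r\<^sup>2 = (1 + r) * \<delta>" by (simp add: \<delta>_def power2_eq_square algebra_simps)
      then show "1 - r\<^sup>2 \<le> 2 * \<delta>" using r \<delta> by simp
    qed (use r in \<open>simp add: abs_square_le_1\<close>)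
    ultimately have "poisson r \<xi> \<eta> \<le> (2 * \<delta>) ^ ?d / (2 ^ j * \<delta> / 2) ^ (2 * ?d)"
      unfolding poisson_def m_def using \<delta> by (intro frac_le) auto
    also have "\<dots> = (2 * \<delta> / (2 ^ j * \<delta> / 2)\<^sup>2) ^ ?d" by (simp only: power_mult power_divide)
    also have "2 * \<delta> / (2 ^ j * \<delta> / 2)\<^sup>2 = 8 / (4 ^ j * \<delta>)"
    proof -
      have "(2 ^ j * \<delta> / 2)\<^sup>2 = (4 ^ j * \<delta>) * \<delta> / 4"
        by (simp add: power2_eq_square field_simps flip: power_mult_distrib)
      then show ?thesis using \<delta> by (simp add: field_simps)
    qed
    also have "(8 / (4 ^ j * \<delta>)) ^ ?d = w j * indicator (?C j) \<eta>" using j by (simp add: w_def)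
    also have "\<dots> \<le> (\<Sum>j\<le>J. w j * indicator (?C j) \<eta>)"
      using j w0 by (intro member_le_sum) auto
    finally show ?thesis .
  qed
  have fc: "continuous_on (sphere 0 1) f"
    by (rule continuous_on_subset[OF line_holomorphic_continuous[OF f]]) (use R in auto)
  have ci: "integrable sphere_measure (\<lambda>\<eta>. indicator (?C j) \<eta> * cmod (f \<eta>))" for j
    by (intro integrable_indicator_mult_sphere continuous_intros fc open_cap)
  have "cmod (f z) \<le> (LINT \<eta>|sphere_measure. poisson r \<xi> \<eta> * cmod (f \<eta>))"
    unfolding z\<xi> by (rule poisson_inequality[OF f R \<xi> r])
  also have "\<dots> \<le> (LINT \<eta>|sphere_measure. (\<Sum>j\<le>J. w j * (indicator (?C j) \<eta> * cmod (f \<eta>))))"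
  proof (rule integral_mono_AE)
    show "AE \<eta> in sphere_measure. poisson r \<xi> \<eta> * cmod (f \<eta>) \<le> (\<Sum>j\<le>J. w j * (indicator (?C j) \<eta> * cmod (f \<eta>)))"
    proof (rule AE_I2)
      fix \<eta> :: "complex ^ 'd" assume "\<eta> \<in> space sphere_measure"
      then have "norm \<eta> = 1" by (simp add: space_sphere_measure)
      from mult_right_mono[OF layer[OF this] norm_ge_zero[of "f \<eta>"]]
      show "poisson r \<xi> \<eta> * cmod (f \<eta>) \<le> (\<Sum>j\<le>J. w j * (indicator (?C j) \<eta> * cmod (f \<eta>)))"
        by (simp only: sum_distrib_right mult.assoc)
    qed
    show "integrable sphere_measure (\<lambda>\<eta>. poisson r \<xi> \<eta> * cmod (f \<eta>))"
      by (intro integrable_sphere continuous_intros continuous_on_poisson r \<xi> fc)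
  qed (intro Bochner_Integration.integrable_sum integrable_mult_right ci)
  also have "\<dots> = (\<Sum>j\<le>J. w j * (LINT \<eta>|sphere_measure. indicator (?C j) \<eta> * cmod (f \<eta>)))"
    by (subst Bochner_Integration.integral_sum) (auto intro!: ci)
  also have "\<dots> \<le> (\<Sum>j\<le>J. (8 * A) ^ ?d * lam * (1 / 2) ^ j)"
  proof (rule sum_mono)
    fix j
    have "w j * (LINT \<eta>|sphere_measure. indicator (?C j) \<eta> * cmod (f \<eta>)) \<le> w j * (lam * (A * 2 ^ j * \<delta>) ^ ?d)"
      using A \<delta> w0 by (intro mult_left_mono avg) auto
    also have "\<dots> = lam * (8 / (4 ^ j * \<delta>) * (A * 2 ^ j * \<delta>)) ^ ?d"
      by (simp only: w_def power_mult_distrib mult_ac)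
    also have "8 / (4 ^ j * \<delta>) * (A * 2 ^ j * \<delta>) = 8 * A * (1 / 2) ^ j"
    proof -
      have "(4 :: real) ^ j = 2 ^ j * 2 ^ j" by (simp flip: power_mult_distrib)
      then show ?thesis using \<delta> by (simp add: field_simps)
    qed
    also have "lam * (8 * A * (1 / 2) ^ j) ^ ?d = (8 * A) ^ ?d * lam * ((1 / 2) ^ j) ^ ?d"
      by (simp only: power_mult_distrib mult_ac)
    also have "\<dots> \<le> (8 * A) ^ ?d * lam * (1 / 2) ^ j"
    proof -
      have "((1 / 2 :: real) ^ j) ^ ?d \<le> ((1 / 2) ^ j) ^ 1"
        by (intro power_decreasing) (auto simp: power_le_one Suc_leI)
      then show ?thesis using A lam by (intro mult_left_mono) auto
    qed
    finally show "w j * (LINT \<eta>|sphere_measure. indicator (?C j) \<eta> * cmod (f \<eta>)) \<le> (8 * A) ^ ?d * lam * (1 / 2) ^ j" .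
  qed
  also have "\<dots> = (8 * A) ^ ?d * lam * (\<Sum>j\<le>J. (1 / 2) ^ j)" by (simp add: sum_distrib_left)
  also have "\<dots> \<le> (8 * A) ^ ?d * lam * 2"
  proof (rule mult_left_mono)
    have "(\<Sum>j\<le>J. (1 / 2 :: real) ^ j) \<le> (\<Sum>j. (1 / 2) ^ j)"
      by (rule sum_le_suminf) (auto intro: summable_geometric)
    then show "(\<Sum>j\<le>J. (1 / 2 :: real) ^ j) \<le> 2" by (simp add: suminf_geometric)
  qed (use A lam in auto)
  finally show ?thesis by (simp add: A_def mult_ac)
qed

section \<open>The weak-type inequality\<close>

text \<open>
  Three times the radius in the metric \<open>sqrt |1 - \<langle>z, \<zeta>\<rangle>|\<close>, hence the factor \<open>9\<close>.
\<close>

lemma cap_engulfing: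
  assumes a: "norm a = 1" and b: "norm b = 1" and le: "s \<le> t"
    and meet: "sphere 0 1 \<inter> cap b s \<inter> cap a t \<noteq> {}"
  shows "sphere 0 1 \<inter> cap b s \<subseteq> cap a (9 * t)"
proof
  fix x assume "x \<in> sphere 0 1 \<inter> cap b s"
  then have x: "norm x = 1" "cmod (1 - cinner x b) < s" by (auto simp: cap_def)
  obtain y where y: "norm y = 1" "cmod (1 - cinner y b) < s" "cmod (1 - cinner y a) < t"
    using meet by (auto simp: cap_def)
  have "cmod (1 - cinner b y) = cmod (1 - cinner y b)"
    by (metis cnj_cinner complex_cnj_diff complex_cnj_one complex_mod_cnj)
  then have "sqrt (cmod (1 - cinner x a)) \<le> sqrt (cmod (1 - cinner x b)) + (sqrt (cmod (1 - cinner y b)) + sqrt (cmod (1 - cinner y a)))"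
    using cinner_quasi_triangle[OF x(1) b a] cinner_quasi_triangle[OF b y(1) a] by simp
  also have "\<dots> < sqrt t + (sqrt t + sqrt t)"
    using x y le by (intro add_strict_mono real_sqrt_less_mono) auto
  also have "\<dots> = sqrt (9 * t)"
    using real_sqrt_mult[of "3\<^sup>2" t] by simp
  finally show "x \<in> cap a (9 * t)" by (simp add: cap_def)
qed

text \<open>
  Choose a largest cap, discard those that meet it, and repeat.
\<close>

lemma vitali_caps:
  fixes I :: "((complex ^ 'd) \<times> real) set"
  assumes "finite I" "\<And>p. p \<in> I \<Longrightarrow> norm (fst p) = 1 \<and> snd p > 0"
  shows "\<exists>J\<subseteq>I. (\<forall>p\<in>J. \<forall>q\<in>J. p \<noteq> q \<longrightarrow> sphere 0 1 \<inter> cap (fst p) (snd p) \<inter> cap (fst q) (snd q) = {}) \<and>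
     (\<Union>p\<in>I. sphere 0 1 \<inter> cap (fst p) (snd p)) \<subseteq> (\<Union>p\<in>J. cap (fst p) (9 * snd p))"
  using assms
proof (induction I rule: finite_psubset_induct)
  case (psubset I)
  let ?B = "\<lambda>p. cap (fst p :: complex ^ 'd) (snd p)"
  show ?case
  proof (cases "I = {}")
    case False
    then have "Max (snd ` I) \<in> snd ` I" using psubset.hyps by simp
    then obtain p where p: "p \<in> I" "snd p = Max (snd ` I)" by force
    then have pmax: "snd q \<le> snd p" if "q \<in> I" for q using that psubset.hyps by simp
    define I' where "I' = {q \<in> I. sphere 0 1 \<inter> ?B q \<inter> ?B p = {}}"
    have "fst p \<in> sphere 0 1 \<inter> ?B p"
      using psubset.prems[OF p(1)] by (simp add: cap_def cinner_self)
    then have "p \<notin> I'" unfolding I'_def by blast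
    then have "I' \<subset> I" using p(1) unfolding I'_def by blast
    from psubset.IH[OF this] psubset.prems obtain J where J: "J \<subseteq> I'"
      "\<forall>p\<in>J. \<forall>q\<in>J. p \<noteq> q \<longrightarrow> sphere 0 1 \<inter> ?B p \<inter> ?B q = {}"
      "(\<Union>p\<in>I'. sphere 0 1 \<inter> ?B p) \<subseteq> (\<Union>p\<in>J. cap (fst p) (9 * snd p))"
      using \<open>I' \<subset> I\<close> by (metis (no_types, lifting) psubsetD)
    show ?thesis
    proof (intro exI[of _ "insert p J"] conjI)
      show "insert p J \<subseteq> I" using J(1) p(1) by (auto simp: I'_def)
      show "\<forall>q\<in>insert p J. \<forall>q'\<in>insert p J. q \<noteq> q' \<longrightarrow> sphere 0 1 \<inter> ?B q \<inter> ?B q' = {}"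
        using J(1,2) unfolding I'_def by blast
      show "(\<Union>q\<in>I. sphere 0 1 \<inter> ?B q) \<subseteq> (\<Union>q\<in>insert p J. cap (fst q) (9 * snd q))"
      proof (rule UN_least)
        fix q assume q: "q \<in> I"
        show "sphere 0 1 \<inter> ?B q \<subseteq> (\<Union>q\<in>insert p J. cap (fst q) (9 * snd q))"
        proof (cases "q \<in> I'")
          case True
          then show ?thesis using J(3) by blast
        next
          case False
          then have "sphere 0 1 \<inter> ?B q \<inter> ?B p \<noteq> {}" using q by (simp add: I'_def)
          from cap_engulfing[OF _ _ pmax[OF q] this] psubset.prems[OF q] psubset.prems[OF p(1)]
          show ?thesis by blast
        qed
      qed
    qed
  qed auto
qed

text \<open>
  \<open>W\<close> is the union of the caps over which \<open>u\<close> has a large average. By Lindelof's theorem it is a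
  countable union, hence a limit of finite ones, and for these the Vitali selection bounds the measure by
  \<open>4 ^ d * 9 ^ d\<close> times \<open>(\<Sum> \<rho> ^ d)\<close> over disjoint caps, each term of which is at most \<open>1 / lam\<close> times the
  integral of \<open>u\<close> over its cap.
\<close>

lemma weak_type_inequality:
  fixes u :: "complex ^ 'd \<Rightarrow> real"
  assumes u: "continuous_on (sphere 0 1) u" "\<And>z. norm z = 1 \<Longrightarrow> u z \<ge> 0" and lam: "lam > 0"
  obtains W where "open W" "measure sphere_measure (sphere 0 1 \<inter> W) \<le> 36 ^ CARD('d) / lam * (LINT z|sphere_measure. u z)"
    "\<And>\<zeta> \<rho>. norm \<zeta> = 1 \<Longrightarrow> \<zeta> \<notin> W \<Longrightarrow> \<rho> > 0 \<Longrightarrow>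
        (LINT z|sphere_measure. indicator (cap \<zeta> \<rho>) z * u z) \<le> lam * \<rho> ^ CARD('d)"
proof -
  let ?d = "CARD('d)"
  let ?I = "\<lambda>p. LINT z|sphere_measure. indicator (cap (fst p :: complex ^ 'd) (snd p)) z * u z"
  let ?B = "\<lambda>p. cap (fst p :: complex ^ 'd) (snd p)"
  define F where "F = {p. norm (fst p) = 1 \<and> snd p > 0 \<and> ?I p > lam * snd p ^ ?d}"
  define W where "W = (\<Union>p\<in>F. ?B p)"
  define K where "K = 36 ^ ?d / lam * (LINT z|sphere_measure. u z)"
  have u0: "(LINT z|sphere_measure. u z) \<ge> 0"
    by (intro integral_nonneg_AE AE_I2 u(2)) (simp add: space_sphere_measure)
  have K0: "K \<ge> 0" unfolding K_def using lam u0 by simp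
  interpret finite_measure "sphere_measure :: (complex ^ 'd) measure" by (rule finite_sphere_measure)
  have S: "sphere 0 1 \<inter> U \<in> sets sphere_measure" if "open U" for U :: "(complex ^ 'd) set"
    using sphere_Int_open_sets[OF that] .
  have fin: "measure sphere_measure (\<Union>p\<in>I. sphere 0 1 \<inter> ?B p) \<le> K" if I: "finite I" "I \<subseteq> F" for I
  proof -
    from vitali_caps[OF I(1)] I(2) obtain J where J: "J \<subseteq> I"
      "\<And>p q. p \<in> J \<Longrightarrow> q \<in> J \<Longrightarrow> p \<noteq> q \<Longrightarrow> sphere 0 1 \<inter> ?B p \<inter> ?B q = {}"
      "(\<Union>p\<in>I. sphere 0 1 \<inter> ?B p) \<subseteq> (\<Union>p\<in>J. cap (fst p) (9 * snd p))"
      unfolding F_def by (smt (verit) mem_Collect_eq subsetD)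
    have fJ: "finite J" using J(1) I(1) finite_subset by blast
    have Jp: "norm (fst p) = 1" "snd p > 0" "lam * snd p ^ ?d < ?I p" if "p \<in> J" for p
      using that J(1) I(2) by (auto simp: F_def)
    have "measure sphere_measure (\<Union>p\<in>I. sphere 0 1 \<inter> ?B p)
        \<le> measure sphere_measure (\<Union>p\<in>J. sphere 0 1 \<inter> cap (fst p) (9 * snd p))"
      using J(3) fJ by (intro finite_measure_mono sets.finite_UN S open_cap) auto
    also have "\<dots> \<le> (\<Sum>p\<in>J. measure sphere_measure (sphere 0 1 \<inter> cap (fst p) (9 * snd p)))"
      using fJ by (intro finite_measure_subadditive_finite) (auto intro: S open_cap)
    also have "\<dots> \<le> (\<Sum>p\<in>J. 36 ^ ?d / lam * ?I p)"
    proof (rule sum_mono)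
      fix p assume p: "p \<in> J"
      have "measure sphere_measure (sphere 0 1 \<inter> cap (fst p) (9 * snd p)) \<le> 4 ^ ?d * (9 * snd p) ^ ?d"
        by (intro measure_cap_le) (use Jp[OF p] in auto)
      also have "\<dots> = 36 ^ ?d / lam * (lam * snd p ^ ?d)"
      proof -
        have "(36 :: real) ^ ?d = 4 ^ ?d * 9 ^ ?d" by (simp only: power_mult_distrib[symmetric]) simp
        then show ?thesis using lam by (simp add: power_mult_distrib)
      qed
      also have "\<dots> \<le> 36 ^ ?d / lam * ?I p"
        using Jp(3)[OF p] lam by (intro mult_left_mono) auto
      finally show "measure sphere_measure (sphere 0 1 \<inter> cap (fst p) (9 * snd p)) \<le> 36 ^ ?d / lam * ?I p" .
    qed
    also have "\<dots> = 36 ^ ?d / lam * (LINT z|sphere_measure. (\<Sum>p\<in>J. indicator (?B p) z * u z))"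
      by (subst Bochner_Integration.integral_sum)
         (auto simp: sum_distrib_left intro!: integrable_indicator_mult_sphere u open_cap)
    also have "\<dots> \<le> K"
      unfolding K_def
    proof (intro mult_left_mono integral_mono_AE)
      show "AE z in sphere_measure. (\<Sum>p\<in>J. indicator (?B p) z * u z) \<le> u z"
      proof (rule AE_I2)
        fix z :: "complex ^ 'd" assume "z \<in> space sphere_measure"
        then have z: "norm z = 1" by (simp add: space_sphere_measure)
        show "(\<Sum>p\<in>J. indicator (?B p) z * u z) \<le> u z"
        proof (cases "\<exists>p\<in>J. z \<in> ?B p")
          case True
          then obtain p where p: "p \<in> J" "z \<in> ?B p" by blast
          have "(\<Sum>q\<in>J. indicator (?B q) z * u z) = (\<Sum>q\<in>{p}. indicator (?B q) z * u z)"
          proof (intro sum.mono_neutral_right ballI)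
            fix q assume q: "q \<in> J - {p}"
            have "z \<in> sphere 0 1" using z by simp
            then have "z \<notin> ?B q" using J(2)[of p q] p q by blast
            then show "indicator (?B q) z * u z = 0" by simp
          qed (use fJ p in auto)
          then show ?thesis using p by simp
        next
          case False
          then have "(\<Sum>p\<in>J. indicator (?B p) z * u z) = 0" by (intro sum.neutral) auto
          then show ?thesis using u(2)[OF z] by simp
        qed
      qed
      show "integrable sphere_measure (\<lambda>z. \<Sum>p\<in>J. indicator (?B p) z * u z)"
        by (intro Bochner_Integration.integrable_sum integrable_indicator_mult_sphere u open_cap)
      show "integrable sphere_measure u" by (rule integrable_sphere[OF u(1)])
    qed (use lam in simp)
    finally show ?thesis .
  qed
  have oW: "open W" unfolding W_def by (auto intro: open_cap)
  have "measure sphere_measure (sphere 0 1 \<inter> W) \<le> K"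
  proof (cases "F = {}")
    case True
    then show ?thesis using K0 by (simp add: W_def)
  next
    case False
    obtain F' where F': "F' \<subseteq> ?B ` F" "countable F'" "\<Union>F' = W"
      unfolding W_def by (rule Lindelof[of "?B ` F"]) (auto intro: open_cap)
    obtain G where G: "G \<subseteq> F" "countable G" "F' = ?B ` G"
      using F'(1,2) countable_subset_image[of F' ?B F] by blast
    \<comment> \<open>A nonempty countable index set, so that it can be enumerated.\<close>
    define G' where "G' = insert (SOME p. p \<in> F) G"
    have G': "G' \<subseteq> F" "countable G'" "G' \<noteq> {}" using G False by (auto simp: G'_def some_in_eq)
    define e where "e = from_nat_into G'"
    have e: "range e = G'" unfolding e_def using G' by (simp add: range_from_nat_into)
    define V where "V n = (\<Union>p\<in>e ` {..n}. sphere 0 1 \<inter> ?B p)" for n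
    have Ws: "sphere 0 1 \<inter> W = (\<Union>n. V n)"
    proof
      show "sphere 0 1 \<inter> W \<subseteq> (\<Union>n. V n)"
      proof
        fix x assume x: "x \<in> sphere 0 1 \<inter> W"
        then obtain p where "p \<in> G" "x \<in> ?B p" using F'(3) G(3) by blast
        moreover have "p \<in> range e" using e \<open>p \<in> G\<close> by (simp add: G'_def)
        ultimately obtain n where "x \<in> ?B (e n)" by blast
        then show "x \<in> (\<Union>n. V n)" using x by (auto simp: V_def)
      qed
      show "(\<Union>n. V n) \<subseteq> sphere 0 1 \<inter> W" using e G'(1) by (fastforce simp: V_def W_def)
    qed
    have "(\<lambda>n. measure sphere_measure (V n)) \<longlonglongrightarrow> measure sphere_measure (\<Union>n. V n)"
    proof (rule finite_Lim_measure_incseq)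
      show "range V \<subseteq> sets sphere_measure" by (auto simp: V_def intro!: sets.finite_UN S open_cap)
      show "incseq V" unfolding V_def incseq_def by (intro allI impI UN_mono image_mono) auto
    qed
    moreover have "measure sphere_measure (V n) \<le> K" for n
      unfolding V_def using e G'(1) by (intro fin) auto
    ultimately show ?thesis unfolding Ws by (intro LIMSEQ_le_const2) auto
  qed
  moreover have "(LINT z|sphere_measure. indicator (cap \<zeta> \<rho>) z * u z) \<le> lam * \<rho> ^ ?d"
    if "norm \<zeta> = 1" "\<zeta> \<notin> W" "\<rho> > 0" for \<zeta> \<rho>
  proof (rule ccontr)
    assume "\<not> ?thesis"
    then have "(\<zeta>, \<rho>) \<in> F" using that by (simp add: F_def)
    moreover have "\<zeta> \<in> ?B (\<zeta>, \<rho>)" using that by (simp add: cap_def cinner_self)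
    ultimately show False using that(2) unfolding W_def by blast
  qed
  ultimately show ?thesis using that[OF oW] by (simp add: K_def)
qed

section \<open>Polynomial functions\<close>

definition polynomial_Cn :: "(complex ^ 'd \<Rightarrow> complex) \<Rightarrow> bool" where
  "polynomial_Cn p \<longleftrightarrow> (\<exists>A c. finite A \<and> (\<forall>z. p z = (\<Sum>\<alpha>\<in>A. c \<alpha> * cmonom \<alpha> z)))"

lemma polynomial_Cn_monom: "polynomial_Cn (\<lambda>z. a * cmonom \<alpha> z)"
  unfolding polynomial_Cn_def by (rule exI[of _ "{\<alpha>}"], rule exI[of _ "\<lambda>_. a"]) simp

lemma polynomial_Cn_const: "polynomial_Cn (\<lambda>z. a)"
  using polynomial_Cn_monom[of a 0] by (simp add: cmonom_def)

lemma polynomial_Cn_add: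
  assumes "polynomial_Cn p" "polynomial_Cn q"
  shows "polynomial_Cn (\<lambda>z. p z + q z)"
proof -
  obtain A c where A: "finite A" "\<And>z. p z = (\<Sum>\<alpha>\<in>A. c \<alpha> * cmonom \<alpha> z)"
    using assms(1) unfolding polynomial_Cn_def by blast
  obtain B e where B: "finite B" "\<And>z. q z = (\<Sum>\<alpha>\<in>B. e \<alpha> * cmonom \<alpha> z)"
    using assms(2) unfolding polynomial_Cn_def by blast
  define h where "h \<alpha> = (if \<alpha> \<in> A then c \<alpha> else 0) + (if \<alpha> \<in> B then e \<alpha> else 0)" for \<alpha>
  have "p z + q z = (\<Sum>\<alpha>\<in>A \<union> B. h \<alpha> * cmonom \<alpha> z)" for z
  proof -
    have "p z = (\<Sum>\<alpha>\<in>A \<union> B. (if \<alpha> \<in> A then c \<alpha> else 0) * cmonom \<alpha> z)"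
      unfolding A by (rule sum.mono_neutral_cong_left) (use A B in auto)
    moreover have "q z = (\<Sum>\<alpha>\<in>A \<union> B. (if \<alpha> \<in> B then e \<alpha> else 0) * cmonom \<alpha> z)"
      unfolding B by (rule sum.mono_neutral_cong_left) (use A B in auto)
    ultimately show ?thesis by (simp only: h_def distrib_right sum.distrib)
  qed
  then show ?thesis unfolding polynomial_Cn_def using A(1) B(1) by blast
qed

lemma polynomial_Cn_sum:
  "finite I \<Longrightarrow> (\<And>i. i \<in> I \<Longrightarrow> polynomial_Cn (p i)) \<Longrightarrow> polynomial_Cn (\<lambda>z. \<Sum>i\<in>I. p i z)"
  by (induction I rule: finite_induct) (auto intro: polynomial_Cn_const polynomial_Cn_add)

lemma cmonom_mult: "cmonom \<alpha> z * cmonom \<beta> z = cmonom (\<alpha> + \<beta>) z"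
  by (simp add: cmonom_def power_add prod.distrib)

lemma polynomial_Cn_mult:
  assumes "polynomial_Cn p" "polynomial_Cn q"
  shows "polynomial_Cn (\<lambda>z. p z * q z)"
proof -
  obtain A c where A: "finite A" "\<And>z. p z = (\<Sum>\<alpha>\<in>A. c \<alpha> * cmonom \<alpha> z)"
    using assms(1) unfolding polynomial_Cn_def by blast
  obtain B e where B: "finite B" "\<And>z. q z = (\<Sum>\<alpha>\<in>B. e \<alpha> * cmonom \<alpha> z)"
    using assms(2) unfolding polynomial_Cn_def by blast
  have "p z * q z = (\<Sum>\<alpha>\<in>A. \<Sum>\<beta>\<in>B. (c \<alpha> * e \<beta>) * cmonom (\<alpha> + \<beta>) z)" for z
    unfolding A B sum_product by (intro sum.cong refl) (simp add: mult_ac flip: cmonom_mult)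
  then show ?thesis
    by (simp only:) (intro polynomial_Cn_sum A B polynomial_Cn_monom)
qed

lemma polynomial_Cn_prod:
  "finite I \<Longrightarrow> (\<And>i. i \<in> I \<Longrightarrow> polynomial_Cn (p i)) \<Longrightarrow> polynomial_Cn (\<lambda>z. \<Prod>i\<in>I. p i z)"
  by (induction I rule: finite_induct) (auto intro: polynomial_Cn_const polynomial_Cn_mult)

lemma polynomial_Cn_power: "polynomial_Cn p \<Longrightarrow> polynomial_Cn (\<lambda>z. p z ^ n)"
  by (induction n) (auto intro: polynomial_Cn_const polynomial_Cn_mult)

lemma polynomial_Cn_nth: "polynomial_Cn (\<lambda>z. z $ i)"
proof -
  have "cmonom (axis i 1) z = z $ i" for z :: "complex ^ 'a"
  proof -
    have "(\<Prod>j\<in>UNIV. z $ j ^ (axis i 1 $ j)) = (\<Prod>j\<in>UNIV. if j = i then z $ i else 1)"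
      by (rule prod.cong) (auto simp: axis_def)
    then show ?thesis by (simp add: cmonom_def)
  qed
  then show ?thesis using polynomial_Cn_monom[of 1 "axis i 1"] by simp
qed

lemma polynomial_Cn_cinner: "polynomial_Cn (\<lambda>z. cinner z c)"
  unfolding cinner_def by (intro polynomial_Cn_sum polynomial_Cn_mult polynomial_Cn_nth polynomial_Cn_const) auto

lemma polynomial_Cn_continuous: "polynomial_Cn p \<Longrightarrow> continuous_on A p"
  unfolding polynomial_Cn_def
  by (elim exE conjE) (simp add: continuous_intros cong: continuous_on_cong)

lemma line_holomorphic_sum:
  "finite I \<Longrightarrow> (\<And>i. i \<in> I \<Longrightarrow> line_holomorphic (f i) U) \<Longrightarrow> line_holomorphic (\<lambda>z. \<Sum>i\<in>I. f i z) U"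
  by (induction I rule: finite_induct) (auto intro: line_holomorphic_const line_holomorphic_add)

lemma line_holomorphic_prod:
  "finite I \<Longrightarrow> (\<And>i. i \<in> I \<Longrightarrow> line_holomorphic (f i) U) \<Longrightarrow> line_holomorphic (\<lambda>z. \<Prod>i\<in>I. f i z) U"
  by (induction I rule: finite_induct) (auto intro: line_holomorphic_const line_holomorphic_mult)

lemma line_holomorphic_polynomial_Cn:
  assumes "polynomial_Cn p" shows "line_holomorphic p U"
proof -
  obtain A c where "finite A" "p = (\<lambda>z. \<Sum>\<alpha>\<in>A. c \<alpha> * cmonom \<alpha> z)"
    using assms unfolding polynomial_Cn_def by blast
  then show ?thesis unfolding cmonom_def
    by (auto intro!: line_holomorphic_sum line_holomorphic_mult line_holomorphic_const line_holomorphic_prod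
          line_holomorphic_power line_holomorphic_nth)
qed

text \<open>
  A polynomial of degree at most \<open>k\<close> is recovered from its values at \<open>0, \<dots>, k\<close> by Lagrange's formula, with basis
  polynomials that are the same for all coefficients.
\<close>

lemma lagrange_interpolation:
  obtains L :: "nat \<Rightarrow> complex poly" where
    "\<And>c t. (\<Sum>j\<le>k. c j * t ^ j) = (\<Sum>m\<le>k. (\<Sum>j\<le>k. c j * of_nat m ^ j) * poly (L m) t)"
proof
  define L where "L m = (\<Prod>l\<in>{..k} - {m}. smult (inverse (of_nat m - of_nat l)) [:- of_nat l, 1:] :: complex poly)" for m
  have degL: "degree (L m) \<le> k" if "m \<le> k" for m
  proof -
    have "degree (L m) \<le> (\<Sum>l\<in>{..k} - {m}. degree (smult (inverse (of_nat m - of_nat l)) [:- of_nat l, 1:] :: complex poly))"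
      unfolding L_def by (rule order_trans[OF degree_prod_sum_le]) (auto simp: o_def)
    also have "\<dots> \<le> (\<Sum>l\<in>{..k} - {m}. 1)" by (intro sum_mono) auto
    also have "\<dots> \<le> k" using that by (simp add: card_Diff_singleton)
    finally show ?thesis .
  qed
  have Lval: "poly (L m) (of_nat n) = (if n = m then 1 else 0)" if "m \<le> k" "n \<le> k" for m n
  proof (cases "n = m")
    case True
    have "poly (smult (inverse (of_nat m - of_nat l)) [:- of_nat l, 1:]) (of_nat m) = (1 :: complex)" if "l \<noteq> m" for l
    proof -
      have "poly (smult (inverse (of_nat m - of_nat l)) [:- of_nat l, 1:]) (of_nat m)
         = inverse (of_nat m - of_nat l) * (of_nat m - of_nat l :: complex)" by (simp add: algebra_simps)
      then show ?thesis using that by simp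
    qed
    then show ?thesis using True unfolding L_def poly_prod by (auto intro!: prod.neutral)
  next
    case False
    then have "n \<in> {..k} - {m}" using that by auto
    then show ?thesis unfolding L_def poly_prod using False by (auto intro!: prod_zero)
  qed
  fix c :: "nat \<Rightarrow> complex" and t
  define p where "p = (\<Sum>j\<le>k. monom (c j) j)"
  define q where "q = (\<Sum>m\<le>k. smult (\<Sum>j\<le>k. c j * of_nat m ^ j) (L m))"
  have p: "poly p x = (\<Sum>j\<le>k. c j * x ^ j)" for x by (simp add: p_def poly_sum poly_monom)
  have q: "poly q x = (\<Sum>m\<le>k. (\<Sum>j\<le>k. c j * of_nat m ^ j) * poly (L m) x)" for x by (simp add: q_def poly_sum)
  have "p = q"
  proof (rule poly_eqI_degree[of "of_nat ` {..k}"])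
    fix x :: complex assume "x \<in> of_nat ` {..k}"
    then obtain n where n: "n \<le> k" "x = of_nat n" by auto
    have "poly q x = (\<Sum>m\<le>k. (\<Sum>j\<le>k. c j * of_nat m ^ j) * (if n = m then 1 else 0))"
      unfolding q n(2) by (intro sum.cong refl) (simp add: Lval n)
    also have "\<dots> = poly p x" using n by (simp add: p if_distrib cong: if_cong)
    finally show "poly p x = poly q x" ..
  next
    have card: "card (of_nat ` {..k} :: complex set) = Suc k" by (simp add: card_image inj_on_def)
    have "degree p \<le> k" unfolding p_def by (intro degree_sum_le order_trans[OF degree_monom_le]) auto
    then show "degree p < card (of_nat ` {..k} :: complex set)" by (simp add: card)
    have "degree q \<le> k" unfolding q_def by (intro degree_sum_le order_trans[OF degree_smult_le] degL) auto
    then show "degree q < card (of_nat ` {..k} :: complex set)" by (simp add: card)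
  qed
  then show "(\<Sum>j\<le>k. c j * t ^ j) = (\<Sum>m\<le>k. (\<Sum>j\<le>k. c j * of_nat m ^ j) * poly (L m) t)"
    using p[of t] q[of t] by simp
qed

lemma polynomial_Cn_poly_nth: "polynomial_Cn (\<lambda>z. poly P (z $ i))"
  unfolding poly_altdef
  by (intro polynomial_Cn_sum polynomial_Cn_mult polynomial_Cn_const polynomial_Cn_power polynomial_Cn_nth) auto

text \<open>
  By Liouville's theorem \<open>h\<close> is a polynomial of degree at most \<open>k\<close> in each variable separately.
  Interpolation at \<open>0, \<dots>, k\<close> replaces one variable at a time by constants, at the price of
  polynomial factors in that variable.
\<close>

lemma polynomial_Cn_if_entire_growth:
  fixes h :: "complex ^ 'd \<Rightarrow> complex"
  assumes hol: "\<And>a b. (\<lambda>t. h (a + t *s b)) holomorphic_on UNIV"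
    and growth: "\<And>z. cmod (h z) \<le> M * norm z ^ k" and M: "M \<ge> 0"
  shows "polynomial_Cn h"
proof -
  obtain L :: "nat \<Rightarrow> complex poly" where
    L: "\<And>c t. (\<Sum>j\<le>k. c j * t ^ j) = (\<Sum>m\<le>k. (\<Sum>j\<le>k. c j * of_nat m ^ j) * poly (L m) t)"
    by (rule lagrange_interpolation[of k]) (rule that)
  have interp: "h (a + t *s axis i 1) = (\<Sum>m\<le>k. h (a + of_nat m *s axis i 1) * poly (L m) t)" for a i t
  proof -
    let ?q = "\<lambda>t. h (a + t *s axis i 1)"
    let ?c = "\<lambda>j. (deriv ^^ j) ?q 0 / fact j"
    have q: "?q t = (\<Sum>j\<le>k. ?c j * t ^ j)" for t
    proof (rule Liouville_polynomial[OF hol])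
      fix x :: complex assume x: "norm a \<le> norm x"
      have "cmod (?q x) \<le> M * norm (a + x *s axis i 1) ^ k" by (rule growth)
      also have "norm (a + x *s axis i 1) \<le> 2 * norm x"
        using norm_triangle_ineq[of a "x *s axis i 1"] x by (simp add: norm_scale_vec)
      then have "M * norm (a + x *s axis i 1) ^ k \<le> M * (2 * norm x) ^ k"
        using M by (intro mult_left_mono power_mono) auto
      finally show "cmod (?q x) \<le> (M * 2 ^ k) * norm x ^ k" by (simp add: power_mult_distrib mult.assoc)
    qed
    show ?thesis using L[of ?c t] unfolding q[symmetric] .
  qed
  \<comment> \<open>The variables in \<open>I\<close> are free; the others are frozen at the coordinates of \<open>w\<close>.\<close>
  define merge where "merge I z w = (\<chi> i. if i \<in> I then z $ i else w $ i)" for I and z w :: "complex ^ 'd"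
  have "finite I \<Longrightarrow> polynomial_Cn (\<lambda>z. h (merge I z w))" for I w
  proof (induction I arbitrary: w rule: finite_induct)
    case empty
    then show ?case by (simp add: merge_def polynomial_Cn_const)
  next
    case (insert i I)
    define u where "u x = (\<chi> j. if j = i then x else w $ j)" for x
    have "h (merge (insert i I) z w) = (\<Sum>m\<le>k. h (merge I z (u (of_nat m))) * poly (L m) (z $ i))" for z
    proof -
      have "merge I z (u 0) + x *s axis i 1 = merge I z (u x)" for x
        using insert.hyps by (auto simp: merge_def u_def vec_eq_iff axis_def)
      moreover have "merge I z (u (z $ i)) = merge (insert i I) z w"
        by (auto simp: merge_def u_def vec_eq_iff)
      ultimately show ?thesis using interp[of "merge I z (u 0)" "z $ i" i] by simp
    qed
    then show ?case
      by (simp only:) (intro polynomial_Cn_sum polynomial_Cn_mult insert.IH polynomial_Cn_poly_nth finite_atMost)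
  qed
  from this[of UNIV 0] show ?thesis by (simp add: merge_def)
qed

section \<open>Homogeneous expansion\<close>

text \<open>
  The coefficient of \<open>t ^ k\<close> in the expansion of \<open>f (t z)\<close>, which makes sense for every \<open>z\<close> although
  \<open>f\<close> is only considered on the ball.
\<close>

definition homogeneous_part :: "(complex ^ 'd \<Rightarrow> complex) \<Rightarrow> nat \<Rightarrow> complex ^ 'd \<Rightarrow> complex" where
  "homogeneous_part f k z = (deriv ^^ k) (\<lambda>t. f (t *s z)) 0 / fact k"

lemma slice_holomorphic:
  assumes "line_holomorphic f (ball 0 1)" "\<rho> * norm z \<le> 1"
  shows "(\<lambda>t. f (t *s z)) holomorphic_on ball 0 \<rho>"
proof -
  have "cmod t * norm z < 1" if "cmod t < \<rho>" for t
  proof (cases "z = 0")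
    case False
    then have "cmod t * norm z < \<rho> * norm z" using that by simp
    then show ?thesis using assms(2) by linarith
  qed simp
  then have "(\<lambda>t. f (0 + t *s z)) holomorphic_on ball 0 \<rho>"
    by (intro line_holomorphicD[OF assms(1)]) (simp add: norm_scale_vec)
  then show ?thesis by simp
qed

lemma homogeneous_part_sums:
  assumes f: "line_holomorphic f (ball 0 1)" and t: "cmod t * norm z < 1"
  shows "(\<lambda>k. homogeneous_part f k z * t ^ k) sums f (t *s z)"
proof -
  define \<rho> where "\<rho> = (if z = 0 then cmod t + 1 else 1 / norm z)"
  have "\<rho> * norm z \<le> 1" "cmod t < \<rho>" using t by (auto simp: \<rho>_def field_simps)
  then show ?thesis
    using holomorphic_power_series[OF slice_holomorphic[OF f], of \<rho> z t] by (simp add: homogeneous_part_def)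
qed

lemma homogeneous_part_scale:
  assumes f: "line_holomorphic f (ball 0 1)"
  shows "homogeneous_part f k (c *s z) = c ^ k * homogeneous_part f k z"
proof -
  define \<rho> where "\<rho> = 1 / (norm z + 1)"
  have "norm z + 1 > 0" by (simp add: add_nonneg_pos)
  then have "\<rho> * norm z \<le> 1" by (simp add: \<rho>_def)
  note hol = slice_holomorphic[OF f this]
  define \<rho>' where "\<rho>' = \<rho> / (cmod c + 1)"
  have pos: "\<rho> > 0" "\<rho>' > 0" by (simp_all add: \<rho>_def \<rho>'_def add_nonneg_pos)
  have "(deriv ^^ k) (\<lambda>w. (\<lambda>t. f (t *s z)) (c * w)) 0 = c ^ k * (deriv ^^ k) (\<lambda>t. f (t *s z)) (c * 0)"
  proof (rule higher_deriv_compose_linear[OF hol, of "ball 0 \<rho>'"])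
    fix w :: complex assume "w \<in> ball 0 \<rho>'"
    then have "cmod c * cmod w \<le> (cmod c + 1) * cmod w" "(cmod c + 1) * cmod w < (cmod c + 1) * \<rho>'"
      by (auto intro: mult_right_mono simp: add_nonneg_pos)
    then have "cmod (c * w) < (cmod c + 1) * \<rho>'" by (simp add: norm_mult)
    also have "(cmod c + 1) * \<rho>' = \<rho>" unfolding \<rho>'_def by (simp add: add_nonneg_pos less_imp_neq[symmetric])
    finally show "c * w \<in> ball 0 \<rho>" by simp
  qed (use pos in auto)
  then show ?thesis by (simp add: homogeneous_part_def mult.commute)
qed

text \<open>
  Cauchy's estimate on the unit disc gives the bound \<open>M\<close> for \<open>norm z < 1\<close>; homogeneity and a limit of
  the scaling factor give the rest.
\<close>

lemma homogeneous_part_bound: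
  fixes f :: "complex ^ 'd \<Rightarrow> complex"
  assumes f: "line_holomorphic f (ball 0 1)" and M: "\<And>z. z \<in> ball 0 1 \<Longrightarrow> cmod (f z) \<le> M"
  shows "cmod (homogeneous_part f k z) \<le> M * norm z ^ k"
proof -
  have unit: "cmod (homogeneous_part f k z) \<le> M" if z: "norm z < 1" for z :: "complex ^ 'd"
  proof -
    define \<rho> where "\<rho> = (if z = 0 then 2 else 1 / norm z)"
    have \<rho>: "\<rho> * norm z \<le> 1" "\<rho> > 1" using z by (auto simp: \<rho>_def)
    note hol = slice_holomorphic[OF f \<rho>(1)]
    have "norm ((deriv ^^ k) (\<lambda>t. f (t *s z)) 0) \<le> fact k * M / 1 ^ k"
    proof (rule Cauchy_inequality)
      show "(\<lambda>t. f (t *s z)) holomorphic_on ball 0 1" using hol \<rho> by (auto elim!: holomorphic_on_subset)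
      show "continuous_on (cball 0 1) (\<lambda>t. f (t *s z))"
        using \<rho> by (intro continuous_on_subset[OF holomorphic_on_imp_continuous_on[OF hol]]) auto
      show "norm (f (x *s z)) \<le> M" if "norm (0 - x) = 1" for x
        using that z by (intro M) (simp add: norm_scale_vec)
    qed simp
    then show ?thesis by (simp add: homogeneous_part_def norm_divide divide_le_eq mult.commute)
  qed
  have le: "cmod (homogeneous_part f k z) \<le> M * a ^ k" if a: "a > norm z" for a
  proof -
    have a0: "a > 0" using a norm_ge_zero[of z] by linarith
    have "of_real a *s (of_real (1 / a) *s z) = z" using a0 by (simp add: vec_eq_iff)
    then have "homogeneous_part f k z = of_real a ^ k * homogeneous_part f k (of_real (1 / a) *s z)"
      using homogeneous_part_scale[OF f, of k "of_real a" "of_real (1 / a) *s z"] by simp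
    moreover have "cmod (homogeneous_part f k (of_real (1 / a) *s z)) \<le> M"
      using a a0 by (intro unit) (simp add: norm_scale_vec norm_divide)
    ultimately show ?thesis using a0 by (simp add: norm_mult norm_power mult.commute mult_right_mono)
  qed
  have "(\<lambda>n. M * (norm z + inverse (real (Suc n))) ^ k) \<longlonglongrightarrow> M * (norm z + 0) ^ k"
    by (intro tendsto_intros LIMSEQ_inverse_real_of_nat)
  then have "cmod (homogeneous_part f k z) \<le> M * (norm z + 0) ^ k"
    by (rule LIMSEQ_le_const) (intro exI[of _ 0] allI impI le, simp)
  then show ?thesis by simp
qed

lemma homogeneous_expansion_remainder:
  fixes f :: "complex ^ 'd \<Rightarrow> complex"
  assumes f: "line_holomorphic f (ball 0 1)" and M: "\<And>z. z \<in> ball 0 1 \<Longrightarrow> cmod (f z) \<le> M"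
    and s: "0 \<le> s" and z: "s * norm z \<le> q" and q: "0 \<le> q" "q < 1"
  shows "cmod (f (of_real s *s z) - (\<Sum>k<n. homogeneous_part f k z * of_real s ^ k)) \<le> M * q ^ n / (1 - q)"
proof -
  have M0: "M \<ge> 0" using order_trans[OF norm_ge_zero M[of 0]] by simp
  let ?u = "\<lambda>k. homogeneous_part f k z * of_real s ^ k"
  have u: "?u sums f (of_real s *s z)"
    using s z q by (intro homogeneous_part_sums[OF f]) simp
  have le: "cmod (?u k) \<le> M * q ^ k" for k
  proof -
    have "cmod (?u k) = cmod (homogeneous_part f k z) * s ^ k" using s by (simp add: norm_mult norm_power)
    also have "\<dots> \<le> M * norm z ^ k * s ^ k"
      using s by (intro mult_right_mono homogeneous_part_bound[OF f M]) auto
    also have "\<dots> = M * (s * norm z) ^ k" by (simp add: power_mult_distrib)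
    also have "\<dots> \<le> M * q ^ k" using s z M0 by (intro mult_left_mono power_mono) auto
    finally show ?thesis .
  qed
  have "f (of_real s *s z) - (\<Sum>k<n. ?u k) = (\<Sum>k. ?u (k + n))"
    using suminf_minus_initial_segment[OF sums_summable[OF u], of n] sums_unique[OF u] by simp
  also have "cmod \<dots> \<le> (\<Sum>k. M * q ^ n * q ^ k)"
  proof (rule norm_suminf_le)
    show "cmod (?u (k + n)) \<le> M * q ^ n * q ^ k" for k using le[of "k + n"] by (simp add: power_add mult_ac)
    show "summable (\<lambda>k. M * q ^ n * q ^ k)" using q by (intro summable_mult summable_geometric) auto
  qed
  also have "\<dots> = M * q ^ n / (1 - q)"
    using q by (subst suminf_mult) (auto simp: suminf_geometric intro!: summable_geometric)
  finally show ?thesis .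
qed

text \<open>
  Induction on the degree: the \<open>k\<close>-th part is the limit of
  \<open>(f (s z) - (\<Sum>j<k. s ^ j * homogeneous_part f j z)) / s ^ k\<close> for \<open>s \<rightarrow> 0\<close>, uniformly on bounded
  sets.
\<close>

lemma homogeneous_part_line_entire:
  fixes f :: "complex ^ 'd \<Rightarrow> complex"
  assumes f: "line_holomorphic f (ball 0 1)" and M: "\<And>z. z \<in> ball 0 1 \<Longrightarrow> cmod (f z) \<le> M"
  shows "(\<lambda>t. homogeneous_part f k (a + t *s b)) holomorphic_on UNIV"
proof (induction k rule: less_induct)
  case (less k)
  have M0: "M \<ge> 0" using order_trans[OF norm_ge_zero M[of 0]] by simp
  have loc: "(\<lambda>t. homogeneous_part f k (a + t *s b)) holomorphic_on ball 0 T" if T: "T > 0" for T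
  proof -
    define B where "B = norm a + T * norm b + 1"
    have B: "B > 0" using T unfolding B_def by (intro add_nonneg_pos add_nonneg_nonneg mult_nonneg_nonneg) auto
    have nB: "norm (a + t *s b) \<le> B" if "t \<in> ball 0 T" for t :: complex
    proof -
      have "norm (a + t *s b) \<le> norm a + cmod t * norm b" using norm_triangle_ineq norm_scale_vec by metis
      also have "cmod t * norm b \<le> T * norm b" using that by (intro mult_right_mono) auto
      finally show ?thesis by (simp add: B_def)
    qed
    define s where "s n = 1 / (2 * B * real (Suc n))" for n
    have s: "s n > 0" "s n * B \<le> 1 / 2" for n
    proof -
      show "s n > 0" using B by (simp add: s_def)
      have "s n * B = 1 / (2 * real (Suc n))" using B by (simp add: s_def)
      also have "\<dots> \<le> 1 / 2" by (intro divide_left_mono) auto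
      finally show "s n * B \<le> 1 / 2" .
    qed
    define g where "g n t = (f (of_real (s n) *s (a + t *s b)) -
        (\<Sum>j<k. homogeneous_part f j (a + t *s b) * of_real (s n) ^ j)) / of_real (s n) ^ k" for n t
    have gh: "g n holomorphic_on ball 0 T" for n
    proof -
      have "(\<lambda>t. f (of_real (s n) *s a + t *s (of_real (s n) *s b))) holomorphic_on ball 0 T"
      proof (rule line_holomorphicD[OF f])
        fix t :: complex assume t: "t \<in> ball 0 T"
        have "of_real (s n) *s a + t *s (of_real (s n) *s b) = of_real (s n) *s (a + t *s b)"
          by (simp add: vec_eq_iff algebra_simps)
        also have "norm \<dots> = s n * norm (a + t *s b)" unfolding norm_scale_vec using s(1)[of n] by simp
        also have "\<dots> \<le> s n * B" using s(1)[of n] nB[OF t] by (intro mult_left_mono) auto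
        finally show "of_real (s n) *s a + t *s (of_real (s n) *s b) \<in> ball 0 1" using s(2)[of n] by simp
      qed
      moreover have "of_real (s n) *s a + t *s (of_real (s n) *s b) = of_real (s n) *s (a + t *s b)" for t
        by (simp add: vec_eq_iff algebra_simps)
      ultimately have "(\<lambda>t. f (of_real (s n) *s (a + t *s b))) holomorphic_on ball 0 T" by (simp only:)
      then show ?thesis unfolding g_def using s(1)[of n]
        by (intro holomorphic_intros holomorphic_on_subset[OF less]) auto
    qed
    have gb: "cmod (g n t - homogeneous_part f k (a + t *s b)) \<le> 2 * M * B ^ Suc k * s n" if t: "t \<in> ball 0 T" for n and t :: complex
    proof -
      let ?w = "a + t *s b" and ?q = "s n * B"
      have "cmod (f (of_real (s n) *s ?w) - (\<Sum>j<Suc k. homogeneous_part f j ?w * of_real (s n) ^ j)) \<le> M * ?q ^ Suc k / (1 - ?q)"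
        using s[of n] B nB[OF t] by (intro homogeneous_expansion_remainder[OF f M] mult_left_mono) auto
      also have "\<dots> \<le> M * ?q ^ Suc k / (1 / 2)"
        using s[of n] B M0 by (intro divide_left_mono) auto
      finally have *: "cmod (f (of_real (s n) *s ?w) - (\<Sum>j<Suc k. homogeneous_part f j ?w * of_real (s n) ^ j)) \<le> 2 * M * ?q ^ Suc k"
        by simp
      have "g n t - homogeneous_part f k ?w =
         (f (of_real (s n) *s ?w) - (\<Sum>j<Suc k. homogeneous_part f j ?w * of_real (s n) ^ j)) / of_real (s n) ^ k"
        using s(1)[of n] by (simp add: g_def field_simps)
      then have "cmod (g n t - homogeneous_part f k ?w) \<le> 2 * M * ?q ^ Suc k / s n ^ k"
        using * s(1)[of n] by (simp add: norm_divide norm_power divide_right_mono)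
      also have "\<dots> = 2 * M * B ^ Suc k * s n" using s(1)[of n] by (simp add: power_mult_distrib)
      finally show ?thesis .
    qed
    have "s \<longlonglongrightarrow> 0"
    proof -
      have "(\<lambda>n. 1 / (2 * B) * inverse (real (Suc n))) \<longlonglongrightarrow> 1 / (2 * B) * 0"
        by (intro tendsto_intros LIMSEQ_inverse_real_of_nat)
      then show ?thesis by (simp add: s_def[abs_def] field_simps)
    qed
    then have lim: "(\<lambda>n. 2 * M * B ^ Suc k * s n) \<longlonglongrightarrow> 0" by (rule tendsto_mult_right_zero)
    have ul: "uniform_limit (ball 0 T) g (\<lambda>t. homogeneous_part f k (a + t *s b)) sequentially"
    proof (rule uniform_limitI)
      fix e :: real assume "e > 0"
      then have "\<forall>\<^sub>F n in sequentially. 2 * M * B ^ Suc k * s n < e" using lim by (rule order_tendstoD(2)[rotated])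
      then show "\<forall>\<^sub>F n in sequentially. \<forall>t\<in>ball 0 T. dist (g n t) (homogeneous_part f k (a + t *s b)) < e"
      proof eventually_elim
        case (elim n)
        show ?case
          unfolding dist_norm using gb[of _ n] elim by (blast intro: le_less_trans)
      qed
    qed
    show ?thesis
    proof (rule holomorphic_uniform_sequence[OF open_ball gh])
      fix x :: complex assume "x \<in> ball 0 T"
      then obtain d where "d > 0" "cball x d \<subseteq> ball 0 T" using open_ball[of 0 T, unfolded open_contains_cball] by blast
      then show "\<exists>d>0. cball x d \<subseteq> ball 0 T \<and> uniform_limit (cball x d) g (\<lambda>t. homogeneous_part f k (a + t *s b)) sequentially"
        using uniform_limit_on_subset[OF ul] by blast
    qed
  qed
  show ?case
  proof (rule holomorphic_onI)
    fix x :: complex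
    have "x \<in> ball 0 (cmod x + 1)" by simp
    moreover have "(\<lambda>t. homogeneous_part f k (a + t *s b)) holomorphic_on ball 0 (cmod x + 1)"
      by (rule loc) (simp add: add_nonneg_pos)
    ultimately show "(\<lambda>t. homogeneous_part f k (a + t *s b)) field_differentiable at x within UNIV"
      using holomorphic_on_imp_differentiable_at open_ball by simp
  qed
qed

lemma polynomial_Cn_homogeneous_part:
  fixes f :: "complex ^ 'd \<Rightarrow> complex"
  assumes f: "line_holomorphic f (ball 0 1)" and M: "\<And>z. z \<in> ball 0 1 \<Longrightarrow> cmod (f z) \<le> M"
  shows "polynomial_Cn (homogeneous_part f k)"
proof (rule polynomial_Cn_if_entire_growth)
  show "(\<lambda>t. homogeneous_part f k (a + t *s b)) holomorphic_on UNIV" for a b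
    by (rule homogeneous_part_line_entire[OF f M])
  show "cmod (homogeneous_part f k z) \<le> M * norm z ^ k" for z
    by (rule homogeneous_part_bound[OF f M])
  show "M \<ge> 0" using order_trans[OF norm_ge_zero M[of 0]] by simp
qed

lemma polynomial_approximation_dilate:
  fixes f :: "complex ^ 'd \<Rightarrow> complex"
  assumes f: "line_holomorphic f (ball 0 1)" and M: "\<And>z. z \<in> ball 0 1 \<Longrightarrow> cmod (f z) \<le> M"
    and s: "0 \<le> s" "s < 1" and e: "e > 0"
  obtains p where "polynomial_Cn p" "\<And>z. norm z \<le> 1 \<Longrightarrow> cmod (f (of_real s *s z) - p z) \<le> e"
proof -
  have "(\<lambda>n. M * s ^ n / (1 - s)) \<longlonglongrightarrow> M * 0 / (1 - s)"
    using s by (intro tendsto_intros LIMSEQ_realpow_zero) auto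
  then have "\<forall>\<^sub>F n in sequentially. M * s ^ n / (1 - s) < e" using e by (intro order_tendstoD(2)) auto
  then obtain n where n: "M * s ^ n / (1 - s) < e" by (auto simp: eventually_sequentially)
  show ?thesis
  proof
    show "polynomial_Cn (\<lambda>z. \<Sum>k<n. homogeneous_part f k z * of_real s ^ k)"
      by (intro polynomial_Cn_sum polynomial_Cn_mult polynomial_Cn_const polynomial_Cn_homogeneous_part[OF f M]) auto
    show "cmod (f (of_real s *s z) - (\<Sum>k<n. homogeneous_part f k z * of_real s ^ k)) \<le> e" if "norm z \<le> 1" for z
    proof -
      have "s * norm z \<le> s" using that s by (simp add: mult_left_le)
      then have "cmod (f (of_real s *s z) - (\<Sum>k<n. homogeneous_part f k z * of_real s ^ k)) \<le> M * s ^ n / (1 - s)"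
        using s by (intro homogeneous_expansion_remainder[OF f M])
      then show ?thesis using n by simp
    qed
  qed
qed

section \<open>Convergence of the dilates in the mean\<close>

text \<open>
  Parseval's identity for the homogeneous parts. The factors \<open>c\<close> cover a single dilate, \<open>c k = s ^ k\<close>, and the
  difference of two, \<open>c k = s ^ k - t ^ k\<close>.
\<close>

lemma homogeneous_parseval:
  fixes f :: "complex ^ 'd \<Rightarrow> complex"
  assumes f: "line_holomorphic f (ball 0 1)" and M: "\<And>z. z \<in> ball 0 1 \<Longrightarrow> cmod (f z) \<le> M"
    and c: "summable (\<lambda>k. \<bar>c k\<bar>)" and D: "continuous_on (sphere 0 1) D"
    and sums: "\<And>z. norm z = 1 \<Longrightarrow> (\<lambda>k. of_real (c k) * homogeneous_part f k z) sums D z"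
  shows "(\<lambda>k. (c k)\<^sup>2 * (LINT z|sphere_measure. (cmod (homogeneous_part f k z))\<^sup>2)) sums
           (LINT z|sphere_measure. (cmod (D z))\<^sup>2)"
proof -
  let ?h = "homogeneous_part f"
  define a where "a k = (LINT z|sphere_measure. (cmod (?h k z))\<^sup>2)" for k
  have hc: "continuous_on (sphere 0 1) (?h k)" for k
    by (rule polynomial_Cn_continuous[OF polynomial_Cn_homogeneous_part[OF f M]])
  have hM: "cmod (?h k z) \<le> M" if "norm z = 1" for k z
    using homogeneous_part_bound[OF f M, of k z] that by simp
  have M0: "M \<ge> 0" using order_trans[OF norm_ge_zero M[of 0]] by simp
  have "bounded (D ` sphere 0 1)" by (intro compact_imp_bounded compact_continuous_image compact_sphere D)
  then obtain B where B: "\<And>z. norm z = 1 \<Longrightarrow> cmod (D z) \<le> B"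
    unfolding bounded_iff by (metis (no_types, lifting) dist_0_norm imageI mem_sphere)
  have coeff: "(LINT z|sphere_measure. D z * cnj (?h k z)) = of_real (c k * a k)" for k
  proof -
    have mono: "(LINT z|sphere_measure. of_real (c j) * ?h j z * cnj (?h k z)) = (if j = k then of_real (c k * a k) else 0)" for j
    proof (cases "j = k")
      case True
      then show ?thesis
        unfolding a_def of_real_mult integral_complex_of_real[symmetric] complex_norm_square mult.assoc by simp
    next
      case False
      have "(LINT z|sphere_measure. ?h j z * cnj (?h k z)) = 0"
        by (rule integral_homogeneous_orthogonal[OF hc hc False homogeneous_part_scale[OF f] homogeneous_part_scale[OF f]])
      then show ?thesis using False by (simp add: mult.assoc)
    qed
    have "(\<lambda>j. LINT z|sphere_measure. of_real (c j) * ?h j z * cnj (?h k z)) sums (LINT z|sphere_measure. D z * cnj (?h k z))"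
    proof (rule sums_integral_sphere)
      show "summable (\<lambda>j. \<bar>c j\<bar> * (M * M))" by (rule summable_mult2[OF c])
      fix z :: "complex ^ 'd" assume z: "norm z = 1"
      show "cmod (of_real (c j) * ?h j z * cnj (?h k z)) \<le> \<bar>c j\<bar> * (M * M)" for j
        using hM[OF z] M0 by (simp add: norm_mult mult.assoc mult_left_mono mult_mono)
      show "(\<lambda>j. of_real (c j) * ?h j z * cnj (?h k z)) sums (D z * cnj (?h k z))"
        by (intro sums_mult2 sums z)
    qed (intro continuous_intros hc)
    moreover have "(\<lambda>j. if j = k then of_real (c k * a k) else 0) sums complex_of_real (c k * a k)"
      using sums_single[of k "\<lambda>_. complex_of_real (c k * a k)"] by simp
    ultimately show ?thesis unfolding mono using sums_unique2 by blast
  qed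
  have "(\<lambda>k. LINT z|sphere_measure. D z * cnj (of_real (c k) * ?h k z)) sums (LINT z|sphere_measure. D z * cnj (D z))"
  proof (rule sums_integral_sphere)
    show "summable (\<lambda>j. \<bar>c j\<bar> * (B * M))" by (rule summable_mult2[OF c])
    fix z :: "complex ^ 'd" assume z: "norm z = 1"
    have "\<bar>c j\<bar> * (cmod (D z) * cmod (?h j z)) \<le> \<bar>c j\<bar> * (B * M)" for j
      using hM[OF z] B[OF z] M0 order_trans[OF norm_ge_zero B[OF z]]
      by (intro mult_left_mono mult_mono) auto
    then show "cmod (D z * cnj (of_real (c j) * ?h j z)) \<le> \<bar>c j\<bar> * (B * M)" for j
      by (simp add: norm_mult mult_ac)
    show "(\<lambda>j. D z * cnj (of_real (c j) * ?h j z)) sums (D z * cnj (D z))"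
      unfolding complex_cnj_mult[symmetric] by (intro sums_mult) (simp only: sums_cnj sums[OF z])
  qed (intro continuous_intros hc D)
  moreover have "(LINT z|sphere_measure. D z * cnj (of_real (c k) * ?h k z)) = of_real ((c k)\<^sup>2 * a k)" for k
  proof -
    have "(LINT z|sphere_measure. D z * cnj (of_real (c k) * ?h k z)) = of_real (c k) * (LINT z|sphere_measure. D z * cnj (?h k z))"
      unfolding integral_mult_right_zero[symmetric] by (simp add: mult_ac)
    then show ?thesis unfolding coeff by (simp add: power2_eq_square)
  qed
  moreover have "(LINT z|sphere_measure. D z * cnj (D z)) = of_real (LINT z|sphere_measure. (cmod (D z))\<^sup>2)"
    unfolding integral_complex_of_real[symmetric] complex_norm_square ..
  ultimately have "(\<lambda>k. complex_of_real ((c k)\<^sup>2 * a k)) sums of_real (LINT z|sphere_measure. (cmod (D z))\<^sup>2)"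
    by simp
  then show ?thesis unfolding sums_of_real_iff a_def .
qed

lemma integral_sphere_cauchy_schwarz:
  fixes u :: "complex ^ 'd \<Rightarrow> real"
  assumes "continuous_on (sphere 0 1) u"
  shows "(LINT z|sphere_measure. u z)\<^sup>2 \<le> (LINT z|sphere_measure. (u z)\<^sup>2)"
proof -
  define m where "m = (LINT z|sphere_measure. u z)"
  have "0 \<le> (LINT z|sphere_measure. (u z - m)\<^sup>2)" by (rule integral_nonneg_AE) simp
  also have "\<dots> = (LINT z|sphere_measure. (u z)\<^sup>2 - (2 * m * u z - m\<^sup>2))"
    by (simp add: power2_diff algebra_simps)
  also have "\<dots> = (LINT z|sphere_measure. (u z)\<^sup>2) - (2 * m * m - m\<^sup>2)"
    using assms by (subst Bochner_Integration.integral_diff, (intro integrable_sphere continuous_intros; assumption)+)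
      (subst Bochner_Integration.integral_diff, auto intro!: integrable_sphere continuous_intros
        simp: m_def prob_space.prob_space[OF prob_space_sphere_measure])
  finally show ?thesis by (simp add: m_def power2_eq_square)
qed

lemma continuous_on_dilate:
  fixes f :: "complex ^ 'd \<Rightarrow> complex"
  assumes f: "line_holomorphic f (ball 0 1)" and s: "0 \<le> s" "s < 1"
  shows "continuous_on (cball 0 1) (\<lambda>z. f (of_real s *s z))"
proof (rule continuous_on_compose2[OF line_holomorphic_continuous[OF f]])
  show "continuous_on (cball 0 1) (\<lambda>z :: complex ^ 'd. of_real s *s z)" by (intro continuous_intros)
  show "(\<lambda>z. complex_of_real s *s z) ` cball 0 1 \<subseteq> ball (0 :: complex ^ 'd) 1"
  proof clarify
    fix z :: "complex ^ 'd" assume "z \<in> cball 0 1"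
    then have "s * norm z \<le> s" using s by (simp add: mult_left_le)
    then show "of_real s *s z \<in> ball 0 1" using s by (simp add: norm_scale_vec)
  qed
qed

definition radius :: "nat \<Rightarrow> real" where
  "radius n = 1 - inverse (real (Suc (Suc n)))"

lemma radius: "0 < radius n" "radius n < 1"
  by (auto simp: radius_def inverse_less_1_iff)

lemma radius_tendsto: "radius \<longlonglongrightarrow> 1"
  using tendsto_diff[OF tendsto_const LIMSEQ_Suc[OF LIMSEQ_inverse_real_of_nat], of 1]
  by (simp add: radius_def[abs_def])

text \<open>
  With \<open>a k\<close> the squared norm of the \<open>k\<close>-th homogeneous part, boundedness of \<open>f\<close> gives
  \<open>summable a\<close>, and the squared distance of two dilates is at most \<open>d s + d t\<close> for
  \<open>d s = (\<Sum>k. (1 - s ^ k)\<^sup>2 * a k)\<close>. By dominated convergence \<open>d s\<close> tends to \<open>0\<close>, so the radii can be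
  chosen along a sequence with any prescribed rate.
\<close>

lemma dilates_mean_cauchy:
  fixes f :: "complex ^ 'd \<Rightarrow> complex"
  assumes f: "line_holomorphic f (ball 0 1)" and M: "\<And>z. z \<in> ball 0 1 \<Longrightarrow> cmod (f z) \<le> M"
  obtains s :: "nat \<Rightarrow> real" where "\<And>j. 0 < s j" "\<And>j. s j < 1" "s \<longlonglongrightarrow> 1"
    "\<And>j. (LINT z|sphere_measure. cmod (f (of_real (s j) *s z) - f (of_real (s (Suc j)) *s z))) \<le> (1 / 4) ^ j"
proof -
  let ?h = "homogeneous_part f"
  define a where "a k = (LINT z|sphere_measure. (cmod (?h k z))\<^sup>2)" for k
  have a0: "a k \<ge> 0" for k unfolding a_def by (rule integral_nonneg_AE) simp
  have M0: "M \<ge> 0" using order_trans[OF norm_ge_zero M[of 0]] by simp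
  have fs: "continuous_on (sphere 0 1) (\<lambda>z. f (of_real s *s z))" if "0 < s" "s < 1" for s
    by (rule continuous_on_subset[OF continuous_on_dilate[OF f]]) (use that in auto)
  have sums: "(\<lambda>k. of_real (s ^ k) * ?h k z) sums f (of_real s *s z)" if "norm z = 1" "0 < s" "s < 1" for s z
    using homogeneous_part_sums[OF f, of "of_real s" z] that by (simp add: mult.commute)
  have partial: "(\<Sum>k<n. a k) \<le> M\<^sup>2" for n
  proof -
    have "(\<Sum>k<n. (s ^ k)\<^sup>2 * a k) \<le> M\<^sup>2" if s: "0 < s" "s < 1" for s
    proof -
      have "(\<lambda>k. (s ^ k)\<^sup>2 * a k) sums (LINT z|sphere_measure. (cmod (f (of_real s *s z)))\<^sup>2)"
        unfolding a_def using s by (intro homogeneous_parseval[OF f M] fs sums) auto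
      then have "(\<Sum>k<n. (s ^ k)\<^sup>2 * a k) \<le> (LINT z|sphere_measure. (cmod (f (of_real s *s z)))\<^sup>2)"
        using a0 sums_unique sums_summable by (metis (no_types, lifting) finite_lessThan mult_nonneg_nonneg sum_le_suminf zero_le_power2)
      also have "\<dots> \<le> (LINT z|(sphere_measure :: (complex ^ 'd) measure). M\<^sup>2)"
      proof (intro integral_mono_AE AE_I2 integrable_sphere continuous_intros fs s)
        fix z :: "complex ^ 'd" assume "z \<in> space sphere_measure"
        then show "(cmod (f (of_real s *s z)))\<^sup>2 \<le> M\<^sup>2"
          using s by (intro power_mono M) (auto simp: norm_scale_vec space_sphere_measure)
      qed
      also have "\<dots> = M\<^sup>2" by (simp add: prob_space.prob_space[OF prob_space_sphere_measure])
      finally show ?thesis .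
    qed
    moreover have "(\<lambda>m. \<Sum>k<n. (radius m ^ k)\<^sup>2 * a k) \<longlonglongrightarrow> (\<Sum>k<n. (1 ^ k)\<^sup>2 * a k)"
      by (intro tendsto_intros radius_tendsto)
    ultimately have "(\<Sum>k<n. (1 ^ k)\<^sup>2 * a k) \<le> M\<^sup>2"
      using radius by (intro LIMSEQ_le_const2) auto
    then show ?thesis by simp
  qed
  have sa: "summable a" by (rule summableI_nonneg_bounded[OF a0 partial])
  define d where "d s = (\<Sum>k. (1 - s ^ k)\<^sup>2 * a k)" for s :: real
  have le1: "(1 - s ^ k)\<^sup>2 \<le> 1" if "0 < s" "s < 1" for s :: real and k
    using that by (intro power_le_one) (auto simp: power_le_one)
  have sd: "summable (\<lambda>k. (1 - s ^ k)\<^sup>2 * a k)" if "0 < s" "s < 1" for s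
    by (rule summable_comparison_test'[OF sa, of 0]) (use le1[OF that] a0 in \<open>simp add: mult_left_le_one_le\<close>)
  have "(\<lambda>n. \<Sum>k. (1 - radius n ^ k)\<^sup>2 * a k) \<longlonglongrightarrow> (\<Sum>k. (1 - 1 ^ k)\<^sup>2 * a k)"
  proof (rule tannerys_theorem[THEN conjunct2, THEN conjunct2])
    show "(\<lambda>n. (1 - radius n ^ k)\<^sup>2 * a k) \<longlonglongrightarrow> (1 - 1 ^ k)\<^sup>2 * a k" for k
      by (intro tendsto_intros radius_tendsto)
    show "\<forall>\<^sub>F (k, n) in at_top \<times>\<^sub>F sequentially. norm ((1 - radius n ^ k)\<^sup>2 * a k) \<le> a k"
      by (rule always_eventually) (use le1[OF radius] a0 in \<open>auto simp: mult_left_le_one_le\<close>)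
  qed (use sa in auto)
  then have dlim: "(\<lambda>n. d (radius n)) \<longlonglongrightarrow> 0" by (simp add: d_def)
  have "\<exists>n\<ge>j. d (radius n) \<le> (1 / 16) ^ j / 2" for j
  proof -
    have "\<forall>\<^sub>F n in sequentially. d (radius n) < (1 / 16) ^ j / 2" by (rule order_tendstoD(2)[OF dlim]) simp
    then obtain N where "\<And>n. n \<ge> N \<Longrightarrow> d (radius n) < (1 / 16) ^ j / 2" by (auto simp: eventually_sequentially)
    then show ?thesis by (intro exI[of _ "max N j"]) (auto intro: less_imp_le)
  qed
  then obtain N where N: "\<And>j. N j \<ge> j" "\<And>j. d (radius (N j)) \<le> (1 / 16) ^ j / 2" by metis
  have pair: "(LINT z|sphere_measure. (cmod (f (of_real s *s z) - f (of_real t *s z)))\<^sup>2) \<le> d s + d t"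
    if s: "0 < s" "s < 1" and t: "0 < t" "t < 1" for s t
  proof -
    have "(\<lambda>k. (s ^ k - t ^ k)\<^sup>2 * a k) sums (LINT z|sphere_measure. (cmod (f (of_real s *s z) - f (of_real t *s z)))\<^sup>2)"
      unfolding a_def
    proof (rule homogeneous_parseval[OF f M])
      show "summable (\<lambda>k. \<bar>s ^ k - t ^ k\<bar>)"
        by (rule summable_comparison_test'[of "\<lambda>k. s ^ k + t ^ k" 0])
           (use s t in \<open>auto intro!: summable_add summable_geometric simp: abs_le_iff\<close>)
      show "(\<lambda>k. of_real (s ^ k - t ^ k) * ?h k z) sums (f (of_real s *s z) - f (of_real t *s z))" if "norm z = 1" for z
        unfolding of_real_diff left_diff_distrib by (intro sums_diff sums that s t)
    qed (auto intro!: continuous_intros fs s t)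
    moreover have "(\<lambda>k. (1 - s ^ k)\<^sup>2 * a k + (1 - t ^ k)\<^sup>2 * a k) sums (d s + d t)"
      unfolding d_def by (intro sums_add summable_sums sd s t)
    ultimately show ?thesis
    proof (rule sums_le[rotated])
      fix k
      have "0 \<le> (1 - s ^ k) * (1 - t ^ k)"
        using s t by (intro mult_nonneg_nonneg) (auto simp: power_le_one)
      then have "(s ^ k - t ^ k)\<^sup>2 \<le> (1 - s ^ k)\<^sup>2 + (1 - t ^ k)\<^sup>2"
        by (simp add: power2_eq_square algebra_simps)
      from mult_right_mono[OF this a0]
      show "(s ^ k - t ^ k)\<^sup>2 * a k \<le> (1 - s ^ k)\<^sup>2 * a k + (1 - t ^ k)\<^sup>2 * a k"
        by (simp add: distrib_right)
    qed
  qed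
  show ?thesis
  proof (rule that[of "\<lambda>j. radius (N j)"])
    have "filterlim N at_top sequentially"
      using N(1) by (intro filterlim_at_top_mono[OF filterlim_ident]) auto
    then show "(\<lambda>j. radius (N j)) \<longlonglongrightarrow> 1" by (rule filterlim_compose[OF radius_tendsto])
    fix j
    let ?s = "radius (N j)" and ?t = "radius (N (Suc j))"
    have "(LINT z|sphere_measure. cmod (f (of_real ?s *s z) - f (of_real ?t *s z)))\<^sup>2
       \<le> (LINT z|sphere_measure. (cmod (f (of_real ?s *s z) - f (of_real ?t *s z)))\<^sup>2)"
      by (intro integral_sphere_cauchy_schwarz continuous_intros fs radius)
    also have "\<dots> \<le> d ?s + d ?t" by (intro pair radius)
    also have "\<dots> \<le> (1 / 16) ^ j / 2 + (1 / 16) ^ j / 2"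
      by (intro add_mono N(2) order_trans[OF N(2)[of "Suc j"]]) auto
    also have "\<dots> = ((1 / 4) ^ j)\<^sup>2" by (simp add: power2_eq_square flip: power_mult_distrib)
    finally show "(LINT z|sphere_measure. cmod (f (of_real ?s *s z) - f (of_real ?t *s z))) \<le> (1 / 4) ^ j"
      by (rule power2_le_imp_le) simp
  qed (use radius in auto)
qed

section \<open>Existence of K-limits\<close>

lemma dilate_tendsto:
  fixes z :: "complex ^ 'd"
  assumes "r \<longlonglongrightarrow> 1" shows "(\<lambda>n. of_real (r n) *s z) \<longlonglongrightarrow> z"
proof -
  have "(\<lambda>n. complex_of_real (r n) *s z) \<longlonglongrightarrow> of_real 1 *s z"
    by (intro bounded_linear.tendsto[OF bounded_linear_scale_vec] tendsto_of_real assms)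
  then show ?thesis by simp
qed

lemma koranyi_region_mono: "c \<le> c' \<Longrightarrow> koranyi_region c \<zeta> \<subseteq> koranyi_region c' \<zeta>"
proof
  fix z assume c: "c \<le> c'" and z: "z \<in> koranyi_region c \<zeta>"
  then have "norm z < 1" by (simp add: koranyi_region_def)
  then have "0 \<le> 1 - (norm z)\<^sup>2" by (simp add: abs_square_le_1)
  then have "c / 2 * (1 - (norm z)\<^sup>2) \<le> c' / 2 * (1 - (norm z)\<^sup>2)" using c by (intro mult_right_mono) auto
  then show "z \<in> koranyi_region c' \<zeta>" using z by (auto simp: koranyi_region_def)
qed

text \<open>
  The aperture \<open>c = 2\<close> is large enough for the whole punctured radius; for smaller \<open>c\<close> only its end
  would lie in the region.
\<close>

lemma radial_in_koranyi_region:
  fixes \<zeta> :: "complex ^ 'd"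
  assumes "norm \<zeta> = 1" "0 < r" "r < 1"
  shows "of_real r *s \<zeta> \<in> koranyi_region 2 \<zeta>"
proof -
  have "norm (1 - complex_of_real r) = 1 - r"
    using assms by (metis abs_of_pos diff_gt_0_iff_gt norm_of_real of_real_1 of_real_diff)
  moreover have "1 - r < 1 - r\<^sup>2" using assms by (simp add: power2_eq_square)
  ultimately show ?thesis
    using assms by (simp add: koranyi_region_def norm_scale_vec cinner_scale_left cinner_self)
qed

lemma has_K_limit_radial:
  fixes \<zeta> :: "complex ^ 'd"
  assumes L: "has_K_limit g \<zeta> L" and \<zeta>: "norm \<zeta> = 1"
    and r: "\<And>n. 0 < r n" "\<And>n. r n < 1" "r \<longlonglongrightarrow> 1"
  shows "(\<lambda>n. g (of_real (r n) *s \<zeta>)) \<longlonglongrightarrow> L"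
proof -
  have "(g \<longlongrightarrow> L) (at \<zeta> within koranyi_region 2 \<zeta>)" using L by (simp add: has_K_limit_def)
  moreover have "of_real (r n) *s \<zeta> \<noteq> \<zeta>" for n
  proof
    assume "of_real (r n) *s \<zeta> = \<zeta>"
    then have "r n * norm \<zeta> = norm \<zeta>" using r(1)[of n] by (metis abs_of_pos norm_of_real norm_scale_vec)
    then show False using r(2)[of n] \<zeta> by simp
  qed
  then have "filterlim (\<lambda>n. of_real (r n) *s \<zeta>) (at \<zeta> within koranyi_region 2 \<zeta>) sequentially"
    unfolding filterlim_at using radial_in_koranyi_region[OF \<zeta> r(1,2)] dilate_tendsto[OF r(3)] by auto
  ultimately show ?thesis by (rule filterlim_compose)
qed

lemma K_limit_eq:
  assumes "has_K_limit g \<zeta> L" "norm \<zeta> = 1"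
  shows "K_limit g \<zeta> = L"
  unfolding K_limit_def
  using has_K_limit_radial[OF _ assms(2) radius radius_tendsto] assms(1) LIMSEQ_unique
  by (intro the_equality) blast+

lemma geometric_cauchy_limit:
  fixes a :: "nat \<Rightarrow> complex"
  assumes step: "\<And>j. j \<ge> J \<Longrightarrow> cmod (a j - a (Suc j)) \<le> K * (1 / 2) ^ j"
  shows "convergent a" and "a \<longlonglongrightarrow> l \<Longrightarrow> J \<le> j \<Longrightarrow> cmod (a j - l) \<le> 2 * K * (1 / 2) ^ j"
proof -
  have "summable (\<lambda>j. a (Suc j) - a j)"
  proof (rule summable_comparison_test'[of "\<lambda>j. K * (1 / 2) ^ j" J])
    show "summable (\<lambda>j. K * (1 / 2 :: real) ^ j)" by (intro summable_mult summable_geometric) auto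
    show "norm (a (Suc j) - a j) \<le> K * (1 / 2) ^ j" if "j \<ge> J" for j
      using step[OF that] by (simp add: norm_minus_commute)
  qed
  then have "convergent (\<lambda>n. a n - a 0)"
    by (simp add: summable_iff_convergent sum_lessThan_telescope)
  then show "convergent a" by (simp add: convergent_diff_const_right_iff)
  assume l: "a \<longlonglongrightarrow> l" and j: "J \<le> j"
  have "cmod (a j - a m) \<le> 2 * K * ((1 / 2) ^ j - (1 / 2) ^ m)" if "j \<le> m" for m
    using that
  proof (induction m rule: dec_induct)
    case (step m)
    have "cmod (a j - a (Suc m)) \<le> cmod (a j - a m) + cmod (a m - a (Suc m))"
      using norm_triangle_ineq[of "a j - a m" "a m - a (Suc m)"] by simp
    also have "\<dots> \<le> 2 * K * ((1 / 2) ^ j - (1 / 2) ^ m) + K * (1 / 2) ^ m"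
      using step assms j by (intro add_mono) auto
    also have "\<dots> = 2 * K * ((1 / 2) ^ j - (1 / 2) ^ Suc m)" by (simp add: algebra_simps)
    finally show ?case .
  qed simp
  moreover have "K \<ge> 0"
  proof (rule ccontr)
    assume "\<not> K \<ge> 0"
    then have "K * (1 / 2) ^ J < 0" by (intro mult_neg_pos) auto
    then show False using order_trans[OF norm_ge_zero step[of J]] by simp
  qed
  ultimately have "cmod (a j - a m) \<le> 2 * K * (1 / 2) ^ j" if "j \<le> m" for m
    using that by (smt (verit) mult_left_mono zero_le_power divide_nonneg_nonneg)
  moreover have "(\<lambda>m. cmod (a j - a m)) \<longlonglongrightarrow> cmod (a j - l)" by (intro tendsto_intros l)
  ultimately show "cmod (a j - l) \<le> 2 * K * (1 / 2) ^ j" by (intro LIMSEQ_le_const2) blast+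
qed

text \<open>
  The differences \<open>f j\<close> of consecutive dilates have integrals at most \<open>4 ^ (- j)\<close>, so their maximal
  functions exceed \<open>2 ^ (- j)\<close> only on sets \<open>W j\<close> of summable measure. By the Borel-Cantelli lemma
  almost every \<open>\<zeta>\<close> lies in finitely many \<open>W j\<close>, and at such \<open>\<zeta>\<close> the dilates converge to \<open>g\<close>
  uniformly on each Koranyi region, while each of them is continuous at \<open>\<zeta>\<close>.
\<close>

theorem K_limit_exists_AE:
  fixes g :: "complex ^ 'd \<Rightarrow> complex"
  assumes g: "line_holomorphic g (ball 0 1)" and M: "\<And>z. z \<in> ball 0 1 \<Longrightarrow> cmod (g z) \<le> M"
  shows "AE \<zeta> in sphere_measure. \<exists>L. has_K_limit g \<zeta> L"
proof -
  let ?d = "CARD('d)"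
  obtain s where s: "\<And>j. 0 < s j" "\<And>j. s j < 1" "s \<longlonglongrightarrow> 1"
    and mean: "\<And>j. (LINT z|sphere_measure. cmod (g (of_real (s j) *s z) - g (of_real (s (Suc j)) *s z))) \<le> (1 / 4) ^ j"
    using dilates_mean_cauchy[OF g M] by blast
  define f where "f j z = g (of_real (s j) *s z) - g (of_real (s (Suc j)) *s z)" for j z
  define R where "R j = min (1 / s j) (1 / s (Suc j))" for j
  have R: "R j > 1" for j using s by (simp add: R_def)
  have f: "line_holomorphic (f j) (ball 0 (R j))" for j
    unfolding f_def
  proof (intro line_holomorphic_diff line_holomorphic_dilate[OF g])
    fix z :: "complex ^ 'd" assume z: "z \<in> ball 0 (R j)"
    show "of_real (s j) *s z \<in> ball 0 1" "of_real (s (Suc j)) *s z \<in> ball 0 1"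
      using z s(1)[of j] s(1)[of "Suc j"] by (simp_all add: norm_scale_vec R_def field_simps)
  qed
  have fc: "continuous_on (sphere 0 1) (f j)" for j
    by (rule continuous_on_subset[OF line_holomorphic_continuous[OF f[of j]]]) (use R[of j] in auto)
  have "\<exists>W. open W \<and> measure sphere_measure (sphere 0 1 \<inter> W) \<le> 36 ^ ?d * (1 / 2) ^ j \<and>
      (\<forall>\<zeta> \<rho>. norm \<zeta> = 1 \<longrightarrow> \<zeta> \<notin> W \<longrightarrow> \<rho> > 0 \<longrightarrow>
        (LINT z|sphere_measure. indicator (cap \<zeta> \<rho>) z * cmod (f j z)) \<le> (1 / 2) ^ j * \<rho> ^ ?d)" for j
  proof -
    obtain W where W: "open W"
      "measure sphere_measure (sphere 0 1 \<inter> W) \<le> 36 ^ ?d / (1 / 2) ^ j * (LINT z|sphere_measure. cmod (f j z))"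
      "\<And>\<zeta> \<rho>. norm \<zeta> = 1 \<Longrightarrow> \<zeta> \<notin> W \<Longrightarrow> \<rho> > 0 \<Longrightarrow>
        (LINT z|sphere_measure. indicator (cap \<zeta> \<rho>) z * cmod (f j z)) \<le> (1 / 2) ^ j * \<rho> ^ ?d"
      by (rule weak_type_inequality[of "\<lambda>z. cmod (f j z)" "(1 / 2) ^ j"]) (auto intro!: continuous_intros fc)
    have "36 ^ ?d / (1 / 2) ^ j * (LINT z|sphere_measure. cmod (f j z)) \<le> 36 ^ ?d / (1 / 2) ^ j * (1 / 4) ^ j"
      using mean[of j] by (intro mult_left_mono) (auto simp: f_def)
    also have "\<dots> = 36 ^ ?d * (1 / 2) ^ j"
    proof -
      have "(1 / 4 :: real) ^ j = (1 / 2) ^ j * (1 / 2) ^ j" by (simp flip: power_mult_distrib)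
      then show ?thesis by simp
    qed
    finally show ?thesis using W by (intro exI[of _ W]) auto
  qed
  then have "\<forall>j. \<exists>W. open W \<and> measure sphere_measure (sphere 0 1 \<inter> W) \<le> 36 ^ ?d * (1 / 2) ^ j \<and>
      (\<forall>\<zeta> \<rho>. norm \<zeta> = 1 \<longrightarrow> \<zeta> \<notin> W \<longrightarrow> \<rho> > 0 \<longrightarrow>
        (LINT z|sphere_measure. indicator (cap \<zeta> \<rho>) z * cmod (f j z)) \<le> (1 / 2) ^ j * \<rho> ^ ?d)" by blast
  from choice[OF this] obtain W where W: "\<And>j. open (W j)" "\<And>j. measure sphere_measure (sphere 0 1 \<inter> W j) \<le> 36 ^ ?d * (1 / 2) ^ j"
    "\<And>j \<zeta> \<rho>. norm \<zeta> = 1 \<Longrightarrow> \<zeta> \<notin> W j \<Longrightarrow> \<rho> > 0 \<Longrightarrow>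
        (LINT z|sphere_measure. indicator (cap \<zeta> \<rho>) z * cmod (f j z)) \<le> (1 / 2) ^ j * \<rho> ^ ?d"
    by blast
  have "AE \<zeta> in sphere_measure. eventually (\<lambda>j. \<zeta> \<in> space sphere_measure - (sphere 0 1 \<inter> W j)) sequentially"
  proof (rule borel_cantelli_AE1)
    show "sphere 0 1 \<inter> W j \<in> sets sphere_measure" for j by (rule sphere_Int_open_sets[OF W(1)])
    show "emeasure sphere_measure (sphere 0 1 \<inter> W j) < \<infinity>" for j
      using finite_measure.emeasure_finite[OF finite_sphere_measure, of "sphere 0 1 \<inter> W j"] by (simp add: less_top[symmetric])
    show "summable (\<lambda>j. measure sphere_measure (sphere 0 1 \<inter> W j))"
    proof (rule summable_comparison_test')
      show "summable (\<lambda>j. 36 ^ ?d * (1 / 2 :: real) ^ j)" by (intro summable_mult summable_geometric) auto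
      show "norm (measure sphere_measure (sphere 0 1 \<inter> W j)) \<le> 36 ^ ?d * (1 / 2) ^ j" if "j \<ge> 0" for j
        using W(2)[of j] by simp
    qed
  qed
  then show ?thesis
  proof (rule AE_mp, intro AE_I2 impI)
    fix \<zeta> :: "complex ^ 'd"
    assume "\<zeta> \<in> space sphere_measure" and ev: "eventually (\<lambda>j. \<zeta> \<in> space sphere_measure - (sphere 0 1 \<inter> W j)) sequentially"
    then have \<zeta>: "norm \<zeta> = 1" by (simp add: space_sphere_measure)
    from ev obtain J where J: "\<And>j. j \<ge> J \<Longrightarrow> \<zeta> \<notin> W j"
      using \<zeta> unfolding eventually_sequentially by auto
    define K where "K c = 2 * (8 * (2 * c + 6)) ^ ?d" for c :: real
    have bound: "cmod (f j z) \<le> K c * (1 / 2) ^ j" if "j \<ge> J" "c > 1" "z \<in> koranyi_region c \<zeta>" for j c z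
      unfolding K_def
      by (rule koranyi_maximal_inequality[OF f R \<zeta> _ that(3)]) (use that W(3)[OF \<zeta> J[OF that(1)]] in auto)
    have bd\<zeta>: "cmod (f j \<zeta>) \<le> K 2 * (1 / 2) ^ j" if "j \<ge> J" for j
    proof -
      have "continuous_on (cball 0 1) (f j)"
        by (rule continuous_on_subset[OF line_holomorphic_continuous[OF f[of j]]]) (use R[of j] in auto)
      then have "(\<lambda>n. f j (of_real (radius n) *s \<zeta>)) \<longlonglongrightarrow> f j \<zeta>"
        by (rule continuous_on_tendsto_compose[OF _ dilate_tendsto[OF radius_tendsto]])
           (use \<zeta> radius in \<open>auto simp: norm_scale_vec less_imp_le\<close>)
      then have "(\<lambda>n. cmod (f j (of_real (radius n) *s \<zeta>))) \<longlonglongrightarrow> cmod (f j \<zeta>)" by (rule tendsto_norm)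
      then show ?thesis
        by (rule LIMSEQ_le_const2) (use bound[OF that, of 2] radial_in_koranyi_region[OF \<zeta> radius] in auto)
    qed
    have "convergent (\<lambda>j. g (of_real (s j) *s \<zeta>))"
      by (rule geometric_cauchy_limit(1)[of J _ "K 2"]) (use bd\<zeta> in \<open>simp add: f_def\<close>)
    then obtain L where L: "(\<lambda>j. g (of_real (s j) *s \<zeta>)) \<longlonglongrightarrow> L" by (auto simp: convergent_def)
    have "(g \<longlongrightarrow> L) (at \<zeta> within koranyi_region c \<zeta>)" if c: "c > 1" for c
    proof (rule swap_uniform_limit[OF _ L])
      show "\<forall>\<^sub>F j in sequentially. ((\<lambda>z. g (of_real (s j) *s z)) \<longlongrightarrow> g (of_real (s j) *s \<zeta>)) (at \<zeta> within koranyi_region c \<zeta>)"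
      proof (rule always_eventually, rule allI)
        fix j
        have "continuous_on (cball 0 1) (\<lambda>z. g (of_real (s j) *s z))"
          by (rule continuous_on_dilate[OF g]) (use s(1,2)[of j] in auto)
        then have "((\<lambda>z. g (of_real (s j) *s z)) \<longlongrightarrow> g (of_real (s j) *s \<zeta>)) (at \<zeta> within cball 0 1)"
          using \<zeta> by (simp add: continuous_on_def)
        then show "((\<lambda>z. g (of_real (s j) *s z)) \<longlongrightarrow> g (of_real (s j) *s \<zeta>)) (at \<zeta> within koranyi_region c \<zeta>)"
          by (rule tendsto_within_subset) (auto simp: koranyi_region_def)
      qed
      show "uniform_limit (koranyi_region c \<zeta>) (\<lambda>j z. g (of_real (s j) *s z)) g sequentially"
      proof (rule uniform_limitI)
        fix e :: real assume e: "e > 0"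
        have "(\<lambda>j. 2 * K c * (1 / 2) ^ j) \<longlonglongrightarrow> 2 * K c * 0"
          by (intro tendsto_intros LIMSEQ_realpow_zero) auto
        then have "\<forall>\<^sub>F j in sequentially. 2 * K c * (1 / 2) ^ j < e" using e by (intro order_tendstoD(2)) auto
        then show "\<forall>\<^sub>F j in sequentially. \<forall>z\<in>koranyi_region c \<zeta>. dist (g (of_real (s j) *s z)) (g z) < e"
          using eventually_ge_at_top[of J]
        proof eventually_elim
          case (elim j)
          show ?case
          proof
            fix z assume z: "z \<in> koranyi_region c \<zeta>"
            then have zb: "z \<in> ball 0 1" by (simp add: koranyi_region_def)
            have "(\<lambda>j. g (of_real (s j) *s z)) \<longlonglongrightarrow> g z"
            proof (rule continuous_on_tendsto_compose[OF line_holomorphic_continuous[OF g] dilate_tendsto[OF s(3)] zb])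
              have "\<bar>s j\<bar> * norm z < 1" for j
                using s(1,2)[of j] zb by (simp add: le_less_trans[OF mult_left_le_one_le])
              then show "\<forall>\<^sub>F j in sequentially. of_real (s j) *s z \<in> ball 0 1"
                by (intro always_eventually) (simp add: norm_scale_vec)
            qed
            then have "cmod (g (of_real (s j) *s z) - g z) \<le> 2 * K c * (1 / 2) ^ j"
              by (rule geometric_cauchy_limit(2)[rotated]) (use bound[OF _ c z] elim in \<open>auto simp: f_def\<close>)
            then show "dist (g (of_real (s j) *s z)) (g z) < e" using elim by (simp add: dist_norm)
          qed
        qed
      qed
    qed simp
    then show "\<exists>L. has_K_limit g \<zeta> L" by (auto simp: has_K_limit_def)
  qed
qed

lemma K_limit_radial_AE:
  fixes g :: "complex ^ 'd \<Rightarrow> complex"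
  assumes g: "line_holomorphic g (ball 0 1)" and M: "\<And>z. z \<in> ball 0 1 \<Longrightarrow> cmod (g z) \<le> M"
  shows "AE \<zeta> in sphere_measure. (\<lambda>n. g (of_real (radius n) *s \<zeta>)) \<longlonglongrightarrow> K_limit g \<zeta>"
proof -
  have "AE \<zeta> in sphere_measure. \<exists>L. has_K_limit g \<zeta> L"
    by (rule K_limit_exists_AE[OF g]) (rule M)
  then show ?thesis
  proof (rule AE_mp, intro AE_I2 impI)
    fix \<zeta> :: "complex ^ 'd" assume "\<zeta> \<in> space sphere_measure" and "\<exists>L. has_K_limit g \<zeta> L"
    then obtain L where "norm \<zeta> = 1" "has_K_limit g \<zeta> L" by (auto simp: space_sphere_measure)
    then show "(\<lambda>n. g (of_real (radius n) *s \<zeta>)) \<longlonglongrightarrow> K_limit g \<zeta>"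
      using has_K_limit_radial[OF _ _ radius radius_tendsto] K_limit_eq by metis
  qed
qed

section \<open>Measurability of the boundary function\<close>

text \<open>
  The Cauchy criterion for the K-limit is a countable combination of these sets, which are closed
  because a Koranyi region depends on \<open>\<zeta>\<close> through a strict inequality that is continuous in \<open>\<zeta>\<close>.
\<close>

definition koranyi_oscillation_le :: "(complex ^ 'd \<Rightarrow> complex) \<Rightarrow> real \<Rightarrow> real \<Rightarrow> real \<Rightarrow> (complex ^ 'd) set" where
  "koranyi_oscillation_le g c e \<delta> =
     {\<zeta>. \<forall>z z'. z \<in> koranyi_region c \<zeta> \<longrightarrow> z' \<in> koranyi_region c \<zeta> \<longrightarrow> dist z \<zeta> < \<delta> \<longrightarrow> dist z' \<zeta> < \<delta> \<longrightarrow>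
        dist (g z) (g z') \<le> e}"

lemma closed_koranyi_oscillation_le: "closed (koranyi_oscillation_le g c e \<delta>)"
proof -
  have o: "open {\<zeta>. z \<in> koranyi_region c \<zeta> \<and> dist z \<zeta> < \<delta>}" for z :: "complex ^ 'a"
  proof (cases "z \<in> ball 0 1")
    case True
    then show ?thesis unfolding koranyi_region_def
      by (auto intro!: open_Collect_conj open_Collect_less continuous_intros)
  qed (simp add: koranyi_region_def)
  have "- koranyi_oscillation_le g c e \<delta> = (\<Union>z. \<Union>z'\<in>{z'. \<not> dist (g z) (g z') \<le> e}.
      {\<zeta>. z \<in> koranyi_region c \<zeta> \<and> dist z \<zeta> < \<delta>} \<inter> {\<zeta>. z' \<in> koranyi_region c \<zeta> \<and> dist z' \<zeta> < \<delta>})"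
    by (auto simp: koranyi_oscillation_le_def)
  then show ?thesis unfolding closed_def using o by (auto intro!: open_UN open_Int)
qed

text \<open>
  Apertures \<open>m + 2\<close> suffice because the regions increase with the aperture, and they all contain
  the radius; so the limits for different apertures agree.
\<close>

lemma has_K_limit_iff_oscillation:
  fixes g :: "complex ^ 'd \<Rightarrow> complex"
  assumes \<zeta>: "norm \<zeta> = 1"
  shows "(\<exists>L. has_K_limit g \<zeta> L) \<longleftrightarrow>
    (\<forall>m k. \<exists>n. \<zeta> \<in> koranyi_oscillation_le g (real (m + 2)) (inverse (real (Suc k))) (inverse (real (Suc n))))"
    (is "_ \<longleftrightarrow> (\<forall>m k. \<exists>n. ?P m k n)")
proof
  assume "\<exists>L. has_K_limit g \<zeta> L"
  then obtain L where L: "has_K_limit g \<zeta> L" by blast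
  show "\<forall>m k. \<exists>n. ?P m k n"
  proof (intro allI)
    fix m k :: nat
    have lim: "(g \<longlongrightarrow> L) (at \<zeta> within koranyi_region (real (m + 2)) \<zeta>)"
      using L by (auto simp: has_K_limit_def)
    define e where "e = inverse (real (Suc k)) / 2"
    have "\<forall>\<^sub>F z in at \<zeta> within koranyi_region (real (m + 2)) \<zeta>. dist (g z) L < e"
      by (rule tendstoD[OF lim]) (simp add: e_def)
    then obtain \<delta> where \<delta>: "\<delta> > 0" "\<And>z. z \<in> koranyi_region (real (m + 2)) \<zeta> \<Longrightarrow> z \<noteq> \<zeta> \<Longrightarrow> dist z \<zeta> < \<delta> \<Longrightarrow> dist (g z) L < e"
      unfolding eventually_at by blast
    obtain n where n: "inverse (real (Suc n)) < \<delta>" using reals_Archimedean[OF \<delta>(1)] by blast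
    have "?P m k n"
      unfolding koranyi_oscillation_le_def
    proof (intro CollectI allI impI)
      fix z z' assume z: "z \<in> koranyi_region (real (m + 2)) \<zeta>" "z' \<in> koranyi_region (real (m + 2)) \<zeta>"
        "dist z \<zeta> < inverse (real (Suc n))" "dist z' \<zeta> < inverse (real (Suc n))"
      then have "z \<noteq> \<zeta>" "z' \<noteq> \<zeta>" using \<zeta> by (auto simp: koranyi_region_def)
      then have "dist (g z) L < e" "dist (g z') L < e" using z n by (auto intro!: \<delta>(2))
      then have "dist (g z) (g z') < e + e" by (meson add_strict_mono dist_triangle2 le_less_trans)
      then show "dist (g z) (g z') \<le> inverse (real (Suc k))" by (simp add: e_def)
    qed
    then show "\<exists>n. ?P m k n" by blast
  qed
next
  assume P: "\<forall>m k. \<exists>n. ?P m k n"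
  define a where "a n = g (of_real (radius n) *s \<zeta>)" for n
  have near: "\<forall>\<^sub>F j in sequentially. dist (of_real (radius j) *s \<zeta>) \<zeta> < \<delta>" if "\<delta> > 0" for \<delta>
    using tendstoD[OF dilate_tendsto[OF radius_tendsto] that] .
  have reg: "of_real (radius j) *s \<zeta> \<in> koranyi_region (real (m + 2)) \<zeta>" for j m
    using radial_in_koranyi_region[OF \<zeta> radius[of j]] koranyi_region_mono[of 2 "real (m + 2)"] by auto
  have "Cauchy a"
  proof (rule metric_CauchyI)
    fix e :: real assume "e > 0"
    then obtain k where k: "inverse (real (Suc k)) < e" using reals_Archimedean by blast
    obtain n where n: "?P 0 k n" using P by blast
    obtain N where N: "\<And>j. j \<ge> N \<Longrightarrow> dist (of_real (radius j) *s \<zeta>) \<zeta> < inverse (real (Suc n))"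
      using near[of "inverse (real (Suc n))"] by (auto simp: eventually_sequentially)
    have "dist (a i) (a j) \<le> inverse (real (Suc k))" if "i \<ge> N" "j \<ge> N" for i j
      using n reg[of i 0] reg[of j 0] N[OF that(1)] N[OF that(2)] unfolding koranyi_oscillation_le_def a_def by blast
    then show "\<exists>N. \<forall>i\<ge>N. \<forall>j\<ge>N. dist (a i) (a j) < e" using k by (meson le_less_trans)
  qed
  then obtain L where L: "a \<longlonglongrightarrow> L" using Cauchy_convergent_iff convergent_def by blast
  have "(g \<longlongrightarrow> L) (at \<zeta> within koranyi_region c \<zeta>)" if c: "c > 1" for c
  proof (rule tendstoI)
    fix e :: real assume "e > 0"
    then obtain k where k: "inverse (real (Suc k)) < e" using reals_Archimedean by blast
    obtain m :: nat where m: "c \<le> real m" using real_arch_simple by blast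
    obtain n where n: "?P m k n" using P by blast
    have "dist (g z) L < e" if z: "z \<in> koranyi_region c \<zeta>" "dist z \<zeta> < inverse (real (Suc n))" for z
    proof -
      have z': "z \<in> koranyi_region (real (m + 2)) \<zeta>" using z koranyi_region_mono[of c "real (m + 2)" \<zeta>] m by auto
      have "\<forall>\<^sub>F j in sequentially. dist (of_real (radius j) *s \<zeta>) \<zeta> < inverse (real (Suc n))"
        by (rule near) simp
      then have "\<forall>\<^sub>F j in sequentially. dist (g z) (a j) \<le> inverse (real (Suc k))"
      proof eventually_elim
        case (elim j)
        then show ?case using n z' z(2) reg[of j m] unfolding koranyi_oscillation_le_def a_def by blast
      qed
      then have "dist (g z) L \<le> inverse (real (Suc k))"
        by (rule tendsto_upperbound[OF tendsto_dist[OF tendsto_const L]]) simp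
      then show ?thesis using k by simp
    qed
    then show "\<forall>\<^sub>F z in at \<zeta> within koranyi_region c \<zeta>. dist (g z) L < e"
      unfolding eventually_at by (intro exI[of _ "inverse (real (Suc n))"]) auto
  qed
  then show "\<exists>L. has_K_limit g \<zeta> L" by (auto simp: has_K_limit_def)
qed

text \<open>
  On the Borel set of points with a K-limit, the K-limit is a pointwise limit of continuous functions;
  elsewhere it is one fixed unspecified value, the same at all points.
\<close>

lemma borel_measurable_K_limit:
  fixes g :: "complex ^ 'd \<Rightarrow> complex"
  assumes g: "line_holomorphic g (ball 0 1)"
  shows "K_limit g \<in> borel_measurable sphere_measure"
proof -
  define E where "E = (\<Inter>m k. \<Union>n. koranyi_oscillation_le g (real (m + 2)) (inverse (real (Suc k))) (inverse (real (Suc n))))"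
  have "E \<in> sets borel" unfolding E_def
    by (intro sets.countable_INT'' sets.countable_UN'' borel_closed closed_koranyi_oscillation_le) auto
  then have E: "E \<inter> space sphere_measure \<in> sets sphere_measure"
    by (auto simp: sets_sphere_measure sphere_borel_def sets_restrict_space space_sphere_measure)
  have gr: "(\<lambda>\<zeta>. g (of_real (radius n) *s \<zeta>)) \<in> borel_measurable sphere_measure" for n
    by (intro borel_measurable_sphere_measure continuous_on_subset[OF continuous_on_dilate[OF g]])
       (use radius[of n] in auto)
  have "K_limit g \<zeta> = (if \<zeta> \<in> E then lim (\<lambda>n. g (of_real (radius n) *s \<zeta>)) else (THE L. False))"
    if "\<zeta> \<in> space sphere_measure" for \<zeta>
  proof -
    have \<zeta>: "norm \<zeta> = 1" using that by (simp add: space_sphere_measure)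
    have iff: "\<zeta> \<in> E \<longleftrightarrow> (\<exists>L. has_K_limit g \<zeta> L)"
      unfolding has_K_limit_iff_oscillation[OF \<zeta>] by (auto simp: E_def)
    show ?thesis
    proof (cases "\<zeta> \<in> E")
      case True
      then obtain L where "has_K_limit g \<zeta> L" using iff by blast
      then have "(\<lambda>n. g (of_real (radius n) *s \<zeta>)) \<longlonglongrightarrow> L" "K_limit g \<zeta> = L"
        using has_K_limit_radial[OF _ \<zeta> radius radius_tendsto] K_limit_eq[OF _ \<zeta>] by auto
      then show ?thesis using True by (simp add: limI)
    next
      case False
      then have "has_K_limit g \<zeta> = (\<lambda>L. False)" using iff by auto
      then show ?thesis using False by (simp add: K_limit_def)
    qed
  qed
  moreover have "(\<lambda>\<zeta>. if \<zeta> \<in> E then lim (\<lambda>n. g (of_real (radius n) *s \<zeta>)) else (THE L. False)) \<in> borel_measurable sphere_measure"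
    by (intro measurable_If_set E borel_measurable_lim_metric gr) auto
  ultimately show ?thesis by (subst measurable_cong) auto
qed

section \<open>Schur complements of a positive definite kernel\<close>

text \<open>
  The algebra behind the Verblunsky coefficients: a Hermitian kernel whose finite sections are positive
  definite, to be thought of as the Gram matrix of linearly independent vectors \<open>e\<^sub>i\<close>.
\<close>

locale positive_kernel =
  fixes K :: "'i \<Rightarrow> 'i \<Rightarrow> complex"
  assumes hermitian: "K j i = cnj (K i j)"
    and positive: "finite S \<Longrightarrow> i \<in> S \<Longrightarrow> c i \<noteq> 0 \<Longrightarrow> 0 < Re (\<Sum>i\<in>S. \<Sum>j\<in>S. c i * K i j * cnj (c j))"
begin

definition projection_coeff :: "'i set \<Rightarrow> ('i \<Rightarrow> complex) \<Rightarrow> ('i \<Rightarrow> complex) \<Rightarrow> bool" where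
  "projection_coeff S b p \<longleftrightarrow> (\<forall>j\<in>S. (\<Sum>i\<in>S. p i * K i j) = b j)"

lemma residual_positive:
  assumes S: "finite S" "a \<notin> S" and p: "projection_coeff S (K a) p"
  shows "0 < Re (K a a - (\<Sum>j\<in>S. p j * K j a))"
proof -
  define \<rho> where "\<rho> i = (if i = a then 1 else - p i)" for i
  have col: "(\<Sum>i\<in>insert a S. \<rho> i * K i j) = K a j - (\<Sum>i\<in>S. p i * K i j)" for j
  proof -
    have "(\<Sum>i\<in>S. \<rho> i * K i j) = (\<Sum>i\<in>S. - (p i * K i j))"
      using S by (intro sum.cong refl) (auto simp: \<rho>_def)
    then show ?thesis using S by (simp add: \<rho>_def sum_negf)
  qed
  have "(\<Sum>i\<in>insert a S. \<Sum>j\<in>insert a S. \<rho> i * K i j * cnj (\<rho> j))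
      = (\<Sum>j\<in>insert a S. (\<Sum>i\<in>insert a S. \<rho> i * K i j) * cnj (\<rho> j))"
    by (subst sum.swap) (simp add: sum_distrib_right)
  also have "\<dots> = (\<Sum>j\<in>insert a S. if j = a then K a a - (\<Sum>j\<in>S. p j * K j a) else 0)"
    unfolding col using p by (intro sum.cong refl) (auto simp: \<rho>_def projection_coeff_def)
  also have "\<dots> = K a a - (\<Sum>j\<in>S. p j * K j a)" using S by simp
  finally have eq: "(\<Sum>i\<in>insert a S. \<Sum>j\<in>insert a S. \<rho> i * K i j * cnj (\<rho> j)) = K a a - (\<Sum>j\<in>S. p j * K j a)" .
  show ?thesis unfolding eq[symmetric] by (rule positive[of _ a]) (use S in \<open>auto simp: \<rho>_def\<close>)
qed

lemma projection_coeff_exists: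
  assumes "finite S" shows "\<exists>p. projection_coeff S b p"
  using assms
proof (induction S arbitrary: b rule: finite_induct)
  case empty
  then show ?case by (simp add: projection_coeff_def)
next
  case (insert x S)
  obtain q where q: "projection_coeff S b q" using insert.IH by blast
  obtain r where r: "projection_coeff S (K x) r" using insert.IH by blast
  define s where "s = K x x - (\<Sum>j\<in>S. r j * K j x)"
  have "s \<noteq> 0" using residual_positive[OF insert.hyps r] by (auto simp: s_def)
  \<comment> \<open>Correct the solution on \<open>S\<close> by a multiple of the residual of \<open>x\<close>, which is orthogonal to \<open>S\<close>.\<close>
  define t where "t = (b x - (\<Sum>i\<in>S. q i * K i x)) / s"
  define p where "p i = (if i = x then t else q i - t * r i)" for i
  have "(\<Sum>i\<in>insert x S. p i * K i j) = (\<Sum>i\<in>S. q i * K i j) + t * (K x j - (\<Sum>i\<in>S. r i * K i j))" for j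
  proof -
    have "(\<Sum>i\<in>S. p i * K i j) = (\<Sum>i\<in>S. q i * K i j - t * (r i * K i j))"
      using insert.hyps by (intro sum.cong refl) (auto simp: p_def algebra_simps)
    then show ?thesis using insert.hyps
      by (simp add: p_def sum_subtractf right_diff_distrib flip: sum_distrib_left)
  qed
  then have "projection_coeff (insert x S) b p"
    using q r \<open>s \<noteq> 0\<close> by (auto simp: projection_coeff_def t_def s_def)
  then show ?case by blast
qed

lemma matrix_inv_on_kernel:
  assumes S: "finite S"
  shows "i \<in> S \<Longrightarrow> j \<in> S \<Longrightarrow> (\<Sum>k\<in>S. K i k * matrix_inv_on S K k j) = (if i = j then 1 else 0)"
proof -
  have "\<exists>p. projection_coeff S (\<lambda>j. if i = j then 1 else 0) p" for i by (rule projection_coeff_exists[OF S])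
  then obtain n where n: "\<And>i j. j \<in> S \<Longrightarrow> (\<Sum>k\<in>S. n i k * K k j) = (if i = j then 1 else 0)"
    unfolding projection_coeff_def by metis
  define N where "N i j = (if i \<in> S \<and> j \<in> S then n i j else 0)" for i j
  have NK: "(\<Sum>k\<in>S. N i k * K k j) = (if i = j then 1 else 0)" if "i \<in> S" "j \<in> S" for i j
    using n[OF that(2), of i] that by (simp add: N_def cong: sum.cong)
  have KN': "(\<Sum>k\<in>S. K i k * cnj (N j k)) = (if i = j then 1 else 0)" if "i \<in> S" "j \<in> S" for i j
  proof -
    have "(\<Sum>k\<in>S. K i k * cnj (N j k)) = cnj (\<Sum>k\<in>S. N j k * K k i)"
      unfolding cnj_sum by (intro sum.cong refl) (simp add: hermitian[of i] mult.commute)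
    then show ?thesis using NK[OF that(2,1)] by simp
  qed
  have unique: "X i j = Y i j"
    if "i \<in> S" "j \<in> S" "\<And>i j. i \<in> S \<Longrightarrow> j \<in> S \<Longrightarrow> (\<Sum>k\<in>S. X i k * K k j) = (if i = j then 1 else 0)"
      "\<And>i j. i \<in> S \<Longrightarrow> j \<in> S \<Longrightarrow> (\<Sum>k\<in>S. K i k * Y k j) = (if i = j then 1 else 0)" for X Y i j
  proof -
    have "X i j = (\<Sum>k\<in>S. X i k * (if k = j then 1 else 0))"
      using that(2) S by (simp add: if_distrib cong: if_cong)
    also have "\<dots> = (\<Sum>k\<in>S. X i k * (\<Sum>l\<in>S. K k l * Y l j))"
      by (intro sum.cong refl) (simp only: that(2,4))
    also have "\<dots> = (\<Sum>l\<in>S. (\<Sum>k\<in>S. X i k * K k l) * Y l j)"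
      unfolding sum_distrib_left sum_distrib_right by (subst sum.swap) (simp add: mult.assoc)
    also have "\<dots> = (\<Sum>l\<in>S. (if i = l then 1 else 0) * Y l j)"
      by (intro sum.cong refl) (simp only: that(1,3))
    also have "\<dots> = Y i j"
      using that(1) S by (simp add: if_distrib[of "\<lambda>x. x * _"] cong: if_cong)
    finally show ?thesis .
  qed
  have NN': "N i j = cnj (N j i)" if "i \<in> S" "j \<in> S" for i j
    using unique[OF that, of N "\<lambda>i j. cnj (N j i)"] NK KN' by blast
  have KN: "(\<Sum>k\<in>S. K i k * N k j) = (if i = j then 1 else 0)" if "i \<in> S" "j \<in> S" for i j
  proof -
    have "(\<Sum>k\<in>S. K i k * N k j) = (\<Sum>k\<in>S. K i k * cnj (N j k))"
      by (intro sum.cong refl arg_cong2[where f = "(*)"] NN' that(2))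
    then show ?thesis using KN'[OF that] by simp
  qed
  have "matrix_inv_on S K = N"
    unfolding matrix_inv_on_def
  proof (rule the_equality)
    show "(\<forall>i j. i \<notin> S \<or> j \<notin> S \<longrightarrow> N i j = 0) \<and>
     (\<forall>i\<in>S. \<forall>j\<in>S. (\<Sum>k\<in>S. K i k * N k j) = (if i = j then 1 else 0)) \<and>
     (\<forall>i\<in>S. \<forall>j\<in>S. (\<Sum>k\<in>S. N i k * K k j) = (if i = j then 1 else 0))"
      using KN NK by (auto simp: N_def)
    fix X assume X: "(\<forall>i j. i \<notin> S \<or> j \<notin> S \<longrightarrow> X i j = 0) \<and>
     (\<forall>i\<in>S. \<forall>j\<in>S. (\<Sum>k\<in>S. K i k * X k j) = (if i = j then 1 else 0)) \<and>
     (\<forall>i\<in>S. \<forall>j\<in>S. (\<Sum>k\<in>S. X i k * K k j) = (if i = j then 1 else 0))"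
    show "X = N"
    proof (intro ext)
      fix i j
      show "X i j = N i j"
      proof (cases "i \<in> S \<and> j \<in> S")
        case True
        then show ?thesis using unique[of i j X N] X KN by blast
      next
        case False
        then show ?thesis using X by (auto simp: N_def)
      qed
    qed
  qed
  then show "i \<in> S \<Longrightarrow> j \<in> S \<Longrightarrow> (\<Sum>k\<in>S. K i k * matrix_inv_on S K k j) = (if i = j then 1 else 0)"
    using KN by simp
qed

definition schur :: "'i set \<Rightarrow> 'i \<Rightarrow> 'i \<Rightarrow> complex" where
  "schur S a b = K a b - row_mat_col S (K a) (matrix_inv_on S K) (\<lambda>j. K j b)"

lemma schur_eq:
  assumes S: "finite S" and p: "projection_coeff S (K a) p"
  shows "schur S a b = K a b - (\<Sum>j\<in>S. p j * K j b)"
proof -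
  let ?N = "matrix_inv_on S K"
  have pj: "(\<Sum>i\<in>S. K a i * ?N i j) = p j" if j: "j \<in> S" for j
  proof -
    have "(\<Sum>i\<in>S. K a i * ?N i j) = (\<Sum>i\<in>S. (\<Sum>k\<in>S. p k * K k i) * ?N i j)"
      using p by (intro sum.cong refl) (simp add: projection_coeff_def)
    also have "\<dots> = (\<Sum>k\<in>S. p k * (\<Sum>i\<in>S. K k i * ?N i j))"
      unfolding sum_distrib_left sum_distrib_right by (subst sum.swap) (simp add: mult.assoc)
    also have "\<dots> = p j" using S j by (simp add: matrix_inv_on_kernel[OF S] if_distrib cong: if_cong sum.cong)
    finally show ?thesis .
  qed
  have "row_mat_col S (K a) ?N (\<lambda>j. K j b) = (\<Sum>j\<in>S. (\<Sum>i\<in>S. K a i * ?N i j) * K j b)"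
    unfolding row_mat_col_def by (subst sum.swap) (simp add: sum_distrib_right)
  also have "\<dots> = (\<Sum>j\<in>S. p j * K j b)" using pj by (intro sum.cong refl) simp
  finally show ?thesis by (simp add: schur_def)
qed

lemma schur_hermitian:
  assumes S: "finite S"
  shows "schur S b a = cnj (schur S a b)"
proof -
  obtain p where p: "projection_coeff S (K a) p" using projection_coeff_exists[OF S] by blast
  obtain q where q: "projection_coeff S (K b) q" using projection_coeff_exists[OF S] by blast
  have sym: "(\<Sum>j\<in>S. p j * K j b) = (\<Sum>j\<in>S. \<Sum>i\<in>S. p j * K j i * cnj (q i))"
    if "projection_coeff S (K b) q" for p q b
  proof (rule sum.cong[OF refl])
    fix j assume "j \<in> S"
    then have "K b j = (\<Sum>i\<in>S. q i * K i j)" using that by (simp add: projection_coeff_def)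
    then have "K j b = (\<Sum>i\<in>S. cnj (q i * K i j))"
      unfolding hermitian[of j b] by (simp only: cnj_sum)
    also have "\<dots> = (\<Sum>i\<in>S. K j i * cnj (q i))"
      by (intro sum.cong refl) (simp only: hermitian[of j] complex_cnj_mult mult.commute)
    finally show "p j * K j b = (\<Sum>i\<in>S. p j * K j i * cnj (q i))" by (simp add: sum_distrib_left mult.assoc)
  qed
  have t: "cnj (p j * K j i * cnj (q i)) = q i * K i j * cnj (p j)" for i j
    unfolding hermitian[of i j] by simp
  have "cnj (\<Sum>j\<in>S. p j * K j b) = (\<Sum>j\<in>S. \<Sum>i\<in>S. q i * K i j * cnj (p j))"
    unfolding sym[OF q] by (simp only: cnj_sum t)
  also have "\<dots> = (\<Sum>i\<in>S. q i * K i a)"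
    unfolding sym[OF p] by (rule sum.swap)
  finally have "cnj (\<Sum>j\<in>S. p j * K j b) = (\<Sum>i\<in>S. q i * K i a)" .
  then show ?thesis
    by (simp only: schur_eq[OF S p] schur_eq[OF S q] complex_cnj_diff hermitian[of b a])
qed

lemma schur_self:
  assumes "finite S" "a \<notin> S"
  shows "schur S a a = of_real (Re (schur S a a))" "0 < Re (schur S a a)"
proof -
  show "schur S a a = of_real (Re (schur S a a))"
    using schur_hermitian[OF assms(1), of a a] by (metis Reals_cnj_iff of_real_Re)
  obtain p where p: "projection_coeff S (K a) p" using projection_coeff_exists[OF assms(1)] by blast
  show "0 < Re (schur S a a)" using residual_positive[OF assms p] schur_eq[OF assms(1) p] by simp
qed

lemma schur_insert:
  assumes S: "finite S" and x: "x \<notin> S"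
  shows "schur (insert x S) a b = schur S a b - schur S a x * schur S x b / schur S x x"
proof -
  obtain p where p: "projection_coeff S (K a) p" using projection_coeff_exists[OF S] by blast
  obtain r where r: "projection_coeff S (K x) r" using projection_coeff_exists[OF S] by blast
  have nz: "schur S x x \<noteq> 0" using schur_self(2)[OF S x] by auto
  define t where "t = schur S a x / schur S x x"
  \<comment> \<open>The projection of \<open>a\<close> onto the larger span: add the component along the residual of \<open>x\<close>.\<close>
  define p' where "p' i = (if i = x then t else p i - t * r i)" for i
  have row: "(\<Sum>i\<in>insert x S. p' i * K i j) = (\<Sum>i\<in>S. p i * K i j) + t * (K x j - (\<Sum>i\<in>S. r i * K i j))" for j
  proof -
    have "(\<Sum>i\<in>S. p' i * K i j) = (\<Sum>i\<in>S. p i * K i j - t * (r i * K i j))"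
      using x by (intro sum.cong refl) (auto simp: p'_def algebra_simps)
    then show ?thesis using S x
      by (simp add: p'_def sum_subtractf right_diff_distrib flip: sum_distrib_left)
  qed
  have row': "(\<Sum>i\<in>insert x S. p' i * K i j) = K a j - schur S a j + t * schur S x j" for j
    unfolding row schur_eq[OF S p] schur_eq[OF S r] by simp
  have van: "schur S y j = 0" if "j \<in> S" "projection_coeff S (K y) q" for y q j
    using schur_eq[OF S that(2)] that by (simp add: projection_coeff_def)
  have "projection_coeff (insert x S) (K a) p'"
    unfolding projection_coeff_def row' using van[OF _ p] van[OF _ r] nz by (auto simp: t_def)
  then have "schur (insert x S) a b = K a b - (\<Sum>j\<in>insert x S. p' j * K j b)"
    using S by (intro schur_eq) auto
  then show ?thesis unfolding row' by (simp add: t_def)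
qed

lemma schur_insert_self:
  assumes S: "finite S" and x: "x \<notin> S" and a: "a \<notin> S"
  shows "Re (schur (insert x S) a a) = Re (schur S a a) *
    (1 - (cmod (schur S a x / (csqrt (schur S a a) * csqrt (schur S x x))))\<^sup>2)"
proof -
  define A X where "A = Re (schur S a a)" and "X = Re (schur S x x)"
  have A: "schur S a a = of_real A" "A > 0" and X: "schur S x x = of_real X" "X > 0"
    using schur_self[OF S a] schur_self[OF S x] by (simp_all add: A_def X_def)
  have "schur S a x * schur S x a = of_real ((cmod (schur S a x))\<^sup>2)"
    unfolding schur_hermitian[OF S, of x a] complex_norm_square ..
  then have "schur (insert x S) a a = of_real (A - (cmod (schur S a x))\<^sup>2 / X)"
    unfolding schur_insert[OF S x] A X by simp
  then have e1: "Re (schur (insert x S) a a) = A - (cmod (schur S a x))\<^sup>2 / X" by simp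
  have e2: "(cmod (schur S a x / (csqrt (schur S a a) * csqrt (schur S x x))))\<^sup>2 = (cmod (schur S a x))\<^sup>2 / (A * X)"
    using A X by (simp add: norm_divide norm_mult power_divide power_mult_distrib csqrt_of_real_nonneg)
  show ?thesis unfolding e1 e2 A_def[symmetric] using A(2) X(2) by (simp add: field_simps)
qed

end

section \<open>Verblunsky products as prediction errors\<close>

lemma shortlex_zero_less: "\<alpha> \<noteq> 0 \<Longrightarrow> 0 \<prec>\<^sub>s \<alpha>"
proof -
  assume "\<alpha> \<noteq> 0"
  then obtain i where "\<alpha> $ i \<noteq> 0" by (auto simp: vec_eq_iff)
  moreover have "\<alpha> $ i \<le> (\<Sum>i\<in>UNIV. \<alpha> $ i)" by (rule member_le_sum) auto
  ultimately show ?thesis by (simp add: shortlex_def)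
qed

lemma shortlex_enum_0: "shortlex_enum 0 = (0 :: nat ^ 'd::{finite,linorder})"
proof (rule ccontr)
  assume "shortlex_enum 0 \<noteq> (0 :: nat ^ 'd::{finite,linorder})"
  from shortlex_zero_less[OF this] have less: "0 \<prec>\<^sub>s (shortlex_enum 0 :: nat ^ 'd::{finite,linorder})" .
  obtain n where n: "0 = (shortlex_enum n :: nat ^ 'd::{finite,linorder})"
    using bij_shortlex_enum by (metis bij_pointE)
  show False using less unfolding n shortlex_enum_less_iff by simp
qed

lemma zero_less_shortlex_enum: "0 \<prec>\<^sub>s shortlex_enum k \<longleftrightarrow> 0 < k"
  by (rule shortlex_enum_less_iff[of 0 k, unfolded shortlex_enum_0])

lemma shortlex_between:
  "{\<delta>. 0 \<prec>\<^sub>s \<delta> \<and> \<delta> \<prec>\<^sub>s shortlex_enum n} = shortlex_enum ` {1..<n}"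
proof safe
  fix \<delta> :: "nat ^ 'a::{finite,linorder}" assume less: "0 \<prec>\<^sub>s \<delta>" "\<delta> \<prec>\<^sub>s shortlex_enum n"
  obtain k where k: "\<delta> = shortlex_enum k" using bij_shortlex_enum by (metis bij_pointE)
  then have "0 < k" "k < n" using less by (simp_all add: zero_less_shortlex_enum shortlex_enum_less_iff)
  then show "\<delta> \<in> shortlex_enum ` {1..<n}" using k by auto
qed (auto simp: zero_less_shortlex_enum shortlex_enum_less_iff)

lemma inj_shortlex_enum: "shortlex_enum m = shortlex_enum n \<longleftrightarrow> m = n"
  using bij_shortlex_enum by (metis bij_pointE)

text \<open>
  Passing from \<open>n\<close> to \<open>n + 1\<close> adjoins one index to the set of which the Schur complement is taken, and
  by \<open>schur_insert_self\<close> this multiplies the Schur complement at \<open>0\<close> by the next factor of the product.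
\<close>

lemma verblunsky_product_eq_schur:
  fixes \<mu> :: "(complex ^ 'd::{finite,linorder}) measure"
  assumes pos: "positive_kernel (moment_kernel \<mu>)" and norm: "moment_kernel \<mu> 0 0 = 1"
  shows "(\<Prod>k<Suc n. 1 - (cmod (verblunsky \<mu> 0 (shortlex_enum k)))\<^sup>2)
     = Re (positive_kernel.schur (moment_kernel \<mu>) (shortlex_enum ` {1..n}) 0 0)"
proof -
  interpret positive_kernel "moment_kernel \<mu>" by (rule pos)
  show ?thesis
  proof (induction n)
    case 0
    have "\<not> 0 \<prec>\<^sub>s (0 :: nat ^ 'd::{finite,linorder})" by (rule shortlex_irrefl)
    then show ?case by (simp add: shortlex_enum_0 verblunsky_def schur_def row_mat_col_def norm)
  next
    case (Suc n)
    let ?S = "shortlex_enum ` {1..n} :: (nat ^ 'd::{finite,linorder}) set" and ?x = "shortlex_enum (Suc n) :: nat ^ 'd::{finite,linorder}"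
    have S: "{\<delta>. 0 \<prec>\<^sub>s \<delta> \<and> \<delta> \<prec>\<^sub>s ?x} = ?S"
      unfolding shortlex_between by (simp add: atLeastLessThanSuc_atLeastAtMost)
    have x: "?x \<notin> ?S" by (auto simp: inj_shortlex_enum)
    have z: "0 \<notin> ?S" unfolding shortlex_enum_0[symmetric] by (auto simp: inj_shortlex_enum)
    have lt: "0 \<prec>\<^sub>s ?x" by (simp add: zero_less_shortlex_enum)
    have "verblunsky \<mu> 0 ?x = schur ?S 0 ?x / (csqrt (schur ?S 0 0) * csqrt (schur ?S ?x ?x))"
      unfolding verblunsky_def verblunsky_lt_def Let_def S schur_def hermitian[symmetric] using lt by simp
    then have step: "Re (schur (insert ?x ?S) 0 0) = Re (schur ?S 0 0) * (1 - (cmod (verblunsky \<mu> 0 ?x))\<^sup>2)"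
      using schur_insert_self[OF _ x z] by simp
    have "insert ?x ?S = shortlex_enum ` {1..Suc n}" by (simp add: atLeastAtMostSuc_conv)
    then show ?case using step Suc.IH by simp
  qed
qed

lemma measurable_sphere_space:
  assumes "sets \<mu> = sets sphere_borel" "continuous_on (sphere 0 1) F"
  shows "F \<in> borel_measurable \<mu>"
proof -
  have "F \<in> borel_measurable (restrict_space borel (sphere 0 1))"
    by (rule borel_measurable_continuous_on_restrict[OF assms(2)])
  then show ?thesis
    using measurable_cong_sets[OF assms(1) refl] unfolding sphere_borel_def by blast
qed

lemma space_if_sets_sphere: "sets \<mu> = sets sphere_borel \<Longrightarrow> space \<mu> = sphere 0 1"
  by (drule sets_eq_imp_space_eq) (simp add: sphere_borel_def space_restrict_space)

lemma integrable_sphere_space: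
  fixes F :: "complex ^ 'd \<Rightarrow> 'b::{banach,second_countable_topology}"
  assumes "finite_measure \<mu>" "sets \<mu> = sets sphere_borel" "continuous_on (sphere 0 1) F"
  shows "integrable \<mu> F"
proof -
  have "bounded (F ` sphere 0 1)" by (intro compact_imp_bounded compact_continuous_image assms compact_sphere)
  then obtain B where "\<And>z. z \<in> sphere 0 1 \<Longrightarrow> norm (F z) \<le> B" unfolding bounded_iff by blast
  then show ?thesis
    by (intro finite_measure.integrable_const_bound[OF assms(1), of _ B] AE_I2 measurable_sphere_space assms)
       (simp add: space_if_sets_sphere[OF assms(2)])
qed

lemma moment_kernel_hermitian: "moment_kernel \<mu> j i = cnj (moment_kernel \<mu> i j)"
  unfolding moment_kernel_def Bochner_Integration.integral_cnj[symmetric] by (simp add: mult.commute)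

lemma moment_quadratic_form:
  assumes \<mu>: "finite_measure \<mu>" "sets \<mu> = sets sphere_borel" and S: "finite S" "finite T"
  shows "(\<Sum>i\<in>S. \<Sum>j\<in>T. c i * moment_kernel \<mu> i j * cnj (e j))
     = (LINT z|\<mu>. (\<Sum>i\<in>S. c i * cmonom i z) * cnj (\<Sum>j\<in>T. e j * cmonom j z))"
proof -
  have "(LINT z|\<mu>. (\<Sum>i\<in>S. c i * cmonom i z) * cnj (\<Sum>j\<in>T. e j * cmonom j z))
     = (LINT z|\<mu>. (\<Sum>i\<in>S. \<Sum>j\<in>T. c i * cnj (e j) * (cmonom i z * cnj (cmonom j z))))"
    unfolding cnj_sum sum_product by (simp add: mult_ac)
  also have "\<dots> = (\<Sum>i\<in>S. \<Sum>j\<in>T. c i * cnj (e j) * (LINT z|\<mu>. cmonom i z * cnj (cmonom j z)))"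
    unfolding integral_mult_right_zero[symmetric]
    by (subst Bochner_Integration.integral_sum, intro integrable_sphere_space[OF \<mu>] continuous_intros)
       (intro sum.cong refl Bochner_Integration.integral_sum integrable_sphere_space[OF \<mu>] continuous_intros)
  finally show ?thesis by (simp add: moment_kernel_def mult_ac)
qed

text \<open>
  The Schur complement at \<open>a\<close> is the squared distance in \<open>L\<^sup>2(\<mu>)\<close> from the monomial \<open>a\<close> to the span of
  the monomials in \<open>S\<close>: the residual \<open>R\<close> of the projection is orthogonal to that span.
\<close>

lemma prediction_error:
  fixes \<mu> :: "(complex ^ 'd) measure"
  assumes \<mu>: "finite_measure \<mu>" "sets \<mu> = sets sphere_borel" and pos: "positive_kernel (moment_kernel \<mu>)"
    and S: "finite S"
  shows "\<exists>p. Re (positive_kernel.schur (moment_kernel \<mu>) S a a) = (LINT z|\<mu>. (cmod (cmonom a z - (\<Sum>j\<in>S. p j * cmonom j z)))\<^sup>2)"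
    and "Re (positive_kernel.schur (moment_kernel \<mu>) S a a) \<le> (LINT z|\<mu>. (cmod (cmonom a z - (\<Sum>j\<in>S. c j * cmonom j z)))\<^sup>2)"
proof -
  interpret positive_kernel "moment_kernel \<mu>" by (rule pos)
  obtain p where p: "projection_coeff S (moment_kernel \<mu> a) p" using projection_coeff_exists[OF S] by blast
  define R where "R z = cmonom a z - (\<Sum>j\<in>S. p j * cmonom j z)" for z
  define h where "h c z = (\<Sum>j\<in>S. (p j - c j) * cmonom j z)" for c z
  have Rc: "continuous_on (sphere 0 1) R" unfolding R_def by (intro continuous_intros)
  have hc: "continuous_on (sphere 0 1) (h c)" for c unfolding h_def by (intro continuous_intros)
  have R1: "(LINT z|\<mu>. R z * cnj (cmonom j z)) = schur S a j" for j
  proof -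
    have "(LINT z|\<mu>. R z * cnj (cmonom j z)) = (LINT z|\<mu>. cmonom a z * cnj (cmonom j z) - (\<Sum>i\<in>S. p i * (cmonom i z * cnj (cmonom j z))))"
      by (simp add: R_def left_diff_distrib sum_distrib_right mult.assoc)
    also have "\<dots> = moment_kernel \<mu> a j - (\<Sum>i\<in>S. p i * moment_kernel \<mu> i j)"
      unfolding moment_kernel_def integral_mult_right_zero[symmetric]
      by (subst Bochner_Integration.integral_diff, (intro integrable_sphere_space[OF \<mu>] continuous_intros)+,
          subst Bochner_Integration.integral_sum, intro integrable_sphere_space[OF \<mu>] continuous_intros) simp
    finally show ?thesis using schur_eq[OF S p] by simp
  qed
  have R0: "(LINT z|\<mu>. R z * cnj (cmonom j z)) = 0" if "j \<in> S" for j
    using R1[of j] schur_eq[OF S p, of j] p that by (simp add: projection_coeff_def)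
  have Rsum: "(LINT z|\<mu>. R z * cnj (\<Sum>j\<in>S. e j * cmonom j z)) = 0" for e
  proof -
    have "(LINT z|\<mu>. R z * cnj (\<Sum>j\<in>S. e j * cmonom j z)) = (LINT z|\<mu>. (\<Sum>j\<in>S. cnj (e j) * (R z * cnj (cmonom j z))))"
      by (simp add: sum_distrib_left mult_ac)
    also have "\<dots> = (\<Sum>j\<in>S. cnj (e j) * (LINT z|\<mu>. R z * cnj (cmonom j z)))"
      unfolding integral_mult_right_zero[symmetric]
      by (intro Bochner_Integration.integral_sum integrable_sphere_space[OF \<mu>] continuous_intros Rc)
    also have "\<dots> = 0" by (simp add: R0)
    finally show ?thesis .
  qed
  have nR: "(LINT z|\<mu>. (cmod (R z))\<^sup>2) = Re (schur S a a)"
  proof -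
    have "complex_of_real (LINT z|\<mu>. (cmod (R z))\<^sup>2) = (LINT z|\<mu>. R z * cnj (cmonom a z) - R z * cnj (\<Sum>j\<in>S. p j * cmonom j z))"
      unfolding integral_complex_of_real[symmetric] complex_norm_square
      by (rule Bochner_Integration.integral_cong[OF refl]) (simp add: R_def algebra_simps)
    also have "\<dots> = schur S a a - 0"
      unfolding R1[symmetric] Rsum[symmetric, of p]
      by (intro Bochner_Integration.integral_diff integrable_sphere_space[OF \<mu>] continuous_intros Rc)
    finally show ?thesis by (metis Re_complex_of_real diff_zero)
  qed
  then show "\<exists>p. Re (schur S a a) = (LINT z|\<mu>. (cmod (cmonom a z - (\<Sum>j\<in>S. p j * cmonom j z)))\<^sup>2)"
    unfolding R_def by (intro exI[of _ p]) (rule sym)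
  have cross: "(LINT z|\<mu>. Re (R z * cnj (h c z))) = 0"
  proof -
    have "integrable \<mu> (\<lambda>z. R z * cnj (h c z))"
      by (intro integrable_sphere_space[OF \<mu>] continuous_intros Rc hc)
    then have "(LINT z|\<mu>. Re (R z * cnj (h c z))) = Re (LINT z|\<mu>. R z * cnj (h c z))" by (rule integral_Re)
    also have "(LINT z|\<mu>. R z * cnj (h c z)) = 0" unfolding h_def by (rule Rsum)
    finally show ?thesis by simp
  qed
  have "(LINT z|\<mu>. (cmod (R z))\<^sup>2) = (LINT z|\<mu>. (cmod (R z))\<^sup>2 + 2 * Re (R z * cnj (h c z)))"
  proof -
    have "(LINT z|\<mu>. (cmod (R z))\<^sup>2 + 2 * Re (R z * cnj (h c z))) = (LINT z|\<mu>. (cmod (R z))\<^sup>2) + (LINT z|\<mu>. 2 * Re (R z * cnj (h c z)))"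
      by (intro Bochner_Integration.integral_add integrable_sphere_space[OF \<mu>] continuous_intros Rc hc)
    also have "(LINT z|\<mu>. 2 * Re (R z * cnj (h c z))) = 0"
      unfolding integral_mult_right_zero cross by simp
    finally show ?thesis by simp
  qed
  also have "\<dots> \<le> (LINT z|\<mu>. (cmod (cmonom a z - (\<Sum>j\<in>S. c j * cmonom j z)))\<^sup>2)"
  proof (intro integral_mono_AE AE_I2 integrable_sphere_space[OF \<mu>] continuous_intros Rc hc)
    fix z
    have "cmonom a z - (\<Sum>j\<in>S. c j * cmonom j z) = R z + h c z"
      by (simp add: R_def h_def left_diff_distrib sum_subtractf)
    also have "(cmod \<dots>)\<^sup>2 = (cmod (R z))\<^sup>2 + 2 * Re (R z * cnj (h c z)) + (cmod (h c z))\<^sup>2"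
      by (simp add: cmod_power2 power2_sum algebra_simps)
    finally show "(cmod (R z))\<^sup>2 + 2 * Re (R z * cnj (h c z)) \<le> (cmod (cmonom a z - (\<Sum>j\<in>S. c j * cmonom j z)))\<^sup>2"
      by simp
  qed
  finally show "Re (schur S a a) \<le> (LINT z|\<mu>. (cmod (cmonom a z - (\<Sum>j\<in>S. c j * cmonom j z)))\<^sup>2)"
    unfolding nR .
qed

section \<open>Extremal problem for the absolutely continuous part\<close>

lemma integrable_const_sphere: "integrable sphere_measure (\<lambda>_ :: complex ^ 'd. c :: real)"
  by (rule integrable_sphere) (intro continuous_intros)

lemma integral_mean_value_dilate:
  fixes F :: "complex ^ 'd \<Rightarrow> complex"
  assumes F: "line_holomorphic F (ball 0 1)" and r: "0 < r" "r < 1"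
  shows "(LINT z|sphere_measure. F (of_real r *s z)) = F 0"
proof -
  have "line_holomorphic (\<lambda>z. F (of_real r *s z)) (ball 0 (1 / r))"
    using r by (intro line_holomorphic_dilate[OF F]) (simp add: norm_scale_vec field_simps)
  from integral_sphere_mean_value[OF this] r show ?thesis by simp
qed

text \<open>
  A holomorphic function with values in the right half of the unit disc. Adding \<open>\<delta> > 0\<close> to it keeps
  the values away from \<open>0\<close> and does not decrease the modulus (\<open>cmod_add_pos\<close>), which makes reciprocals and
  logarithms of \<open>g + \<delta>\<close> available with uniform bounds.
\<close>

locale boundary_function =
  fixes g :: "complex ^ 'd \<Rightarrow> complex"
  assumes hol: "line_holomorphic g (ball 0 1)"
    and le1: "\<And>z. z \<in> ball 0 1 \<Longrightarrow> cmod (g z) \<le> 1"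
    and Re_nonneg: "\<And>z. z \<in> ball 0 1 \<Longrightarrow> 0 \<le> Re (g z)"
begin

abbreviation G :: "complex ^ 'd \<Rightarrow> complex" where "G \<equiv> K_limit g"

abbreviation gr :: "nat \<Rightarrow> complex ^ 'd \<Rightarrow> complex" where "gr n z \<equiv> g (of_real (radius n) *s z)"

lemma radial_in_ball: "norm (z :: complex ^ 'd) \<le> 1 \<Longrightarrow> of_real (radius n) *s z \<in> ball 0 1"
  using radius[of n] by (simp add: norm_scale_vec le_less_trans[OF mult_left_le])

lemma G_measurable [measurable]: "G \<in> borel_measurable sphere_measure"
  by (rule borel_measurable_K_limit[OF hol])

lemma gr_continuous: "continuous_on (cball 0 1) (gr n)"
  using radius[of n] by (intro continuous_on_dilate[OF hol]) auto

lemma gr_continuous_sphere: "continuous_on (sphere 0 1) (gr n)"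
  by (rule continuous_on_subset[OF gr_continuous]) auto

lemma gr_measurable [measurable]: "gr n \<in> borel_measurable sphere_measure"
  by (rule borel_measurable_sphere_measure[OF gr_continuous_sphere])

lemma gr_tendsto: "AE z in sphere_measure. (\<lambda>n. gr n z) \<longlonglongrightarrow> G z"
  by (rule K_limit_radial_AE[OF hol]) (rule le1)

lemma G_bounds: "AE z in sphere_measure. cmod (G z) \<le> 1 \<and> 0 \<le> Re (G z)"
  using gr_tendsto
proof (rule AE_mp, intro AE_I2 impI conjI)
  fix z :: "complex ^ 'd" assume "z \<in> space sphere_measure" and lim: "(\<lambda>n. gr n z) \<longlonglongrightarrow> G z"
  then have b: "of_real (radius n) *s z \<in> ball 0 1" for n
    by (intro radial_in_ball) (simp add: space_sphere_measure)
  show "cmod (G z) \<le> 1" by (rule LIMSEQ_le_const2[OF tendsto_norm[OF lim]]) (use le1[OF b] in auto)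
  show "0 \<le> Re (G z)" by (rule LIMSEQ_le_const[OF tendsto_Re[OF lim]]) (use Re_nonneg[OF b] in auto)
qed

lemma cmod_add_pos:
  assumes "0 \<le> Re x" "cmod x \<le> 1" "0 < \<delta>" "\<delta> \<le> 1"
  shows "\<delta> \<le> cmod (x + of_real \<delta>)" "cmod (x + of_real \<delta>) \<le> 2" "cmod x \<le> cmod (x + of_real \<delta>)"
proof -
  show "\<delta> \<le> cmod (x + of_real \<delta>)" using complex_Re_le_cmod[of "x + of_real \<delta>"] assms by simp
  show "cmod (x + of_real \<delta>) \<le> 2" using norm_triangle_ineq[of x "of_real \<delta>"] assms by simp
  have "(Re x)\<^sup>2 \<le> (Re x + \<delta>)\<^sup>2" using assms by (intro power_mono) auto
  then show "cmod x \<le> cmod (x + of_real \<delta>)" by (simp add: cmod_def)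
qed

lemma abs_ln_le:
  assumes "0 < a" "a \<le> x" "x \<le> (2 :: real)"
  shows "\<bar>ln x\<bar> \<le> \<bar>ln a\<bar> + ln 2"
proof -
  have "ln a \<le> ln x" "ln x \<le> ln 2" "0 \<le> ln (2 :: real)" using assms by auto
  then show ?thesis by linarith
qed

text \<open>
  The mean value property of the real part of \<open>Ln (g + \<delta>)\<close> on spheres of radius \<open>r < 1\<close>, in the limit \<open>r \<rightarrow> 1\<close>.
\<close>

lemma integral_ln_shift:
  assumes \<delta>: "0 < \<delta>" "\<delta> \<le> 1"
  shows "(LINT z|sphere_measure. ln (cmod (G z + of_real \<delta>))) = ln (cmod (g 0 + of_real \<delta>))"
proof -
  define h where "h z = Ln (g z + of_real \<delta>)" for z
  have h: "line_holomorphic h (ball 0 1)"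
    unfolding h_def
  proof (rule line_holomorphic_compose[OF hol, where V = "{x. Re x > - \<delta>}"])
    show "(\<lambda>x. Ln (x + of_real \<delta>)) holomorphic_on {x. Re x > - \<delta>}"
      by (intro holomorphic_intros) (auto simp: complex_nonpos_Reals_iff)
    show "g ` ball 0 1 \<subseteq> {x. Re x > - \<delta>}" using Re_nonneg \<delta> by force
  qed
  have Re_h: "Re (h z) = ln (cmod (g z + of_real \<delta>))" if "z \<in> ball 0 1" for z
  proof -
    have "\<delta> \<le> cmod (g z + of_real \<delta>)" using cmod_add_pos(1)[OF Re_nonneg[OF that] le1[OF that] \<delta>] .
    then have "g z + of_real \<delta> \<noteq> 0" using \<delta> by auto
    then show ?thesis by (simp add: h_def)
  qed
  have val: "(LINT z|sphere_measure. ln (cmod (gr n z + of_real \<delta>))) = ln (cmod (g 0 + of_real \<delta>))" for n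
  proof -
    have "(LINT z|sphere_measure. ln (cmod (gr n z + of_real \<delta>))) = (LINT z|sphere_measure. Re (h (of_real (radius n) *s z)))"
      by (intro integral_sphere_cong Re_h[symmetric] radial_in_ball) simp
    also have "\<dots> = Re (LINT z|sphere_measure. h (of_real (radius n) *s z))"
      using radius[of n]
      by (intro integral_Re integrable_sphere continuous_on_subset[OF continuous_on_dilate[OF h]]) auto
    also have "\<dots> = Re (h 0)" using integral_mean_value_dilate[OF h radius] by simp
    also have "\<dots> = ln (cmod (g 0 + of_real \<delta>))" by (rule Re_h) simp
    finally show ?thesis .
  qed
  have "(\<lambda>n. LINT z|sphere_measure. ln (cmod (gr n z + of_real \<delta>))) \<longlonglongrightarrow> (LINT z|sphere_measure. ln (cmod (G z + of_real \<delta>)))"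
  proof (rule integral_dominated_convergence[OF _ _ integrable_const_sphere[of "\<bar>ln \<delta>\<bar> + ln 2"]])
    show "AE z in sphere_measure. (\<lambda>n. ln (cmod (gr n z + of_real \<delta>))) \<longlonglongrightarrow> ln (cmod (G z + of_real \<delta>))"
      using gr_tendsto G_bounds
    proof eventually_elim
      case (elim z)
      then have "cmod (G z + of_real \<delta>) \<noteq> 0" using cmod_add_pos(1)[of "G z" \<delta>] \<delta> by auto
      then show ?case by (intro tendsto_ln tendsto_norm tendsto_add elim tendsto_const)
    qed
    show "AE z in sphere_measure. norm (ln (cmod (gr n z + of_real \<delta>))) \<le> \<bar>ln \<delta>\<bar> + ln 2" for n
    proof (rule AE_I2)
      fix z :: "complex ^ 'd" assume "z \<in> space sphere_measure"
      then have b: "of_real (radius n) *s z \<in> ball 0 1" by (intro radial_in_ball) (simp add: space_sphere_measure)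
      show "norm (ln (cmod (gr n z + of_real \<delta>))) \<le> \<bar>ln \<delta>\<bar> + ln 2"
        unfolding real_norm_def using cmod_add_pos[OF Re_nonneg[OF b] le1[OF b] \<delta>] \<delta> by (intro abs_ln_le) auto
    qed
  qed measurable
  then show ?thesis unfolding val using LIMSEQ_unique tendsto_const by blast
qed

text \<open>
  Let \<open>\<delta>\<close> tend to \<open>0\<close> in \<open>integral_ln_shift\<close>; the lower bound for the weight dominates the
  logarithms from below. The same bound shows that \<open>|g 0 + \<delta>| \<ge> sqrt \<epsilon>\<close> for all \<open>\<delta>\<close>.
\<close>

lemma integral_ln_boundary:
  assumes \<epsilon>: "\<epsilon> > 0" and lower: "AE z in sphere_measure. \<epsilon> \<le> (cmod (G z))\<^sup>2"
  shows "integrable sphere_measure (\<lambda>z. ln ((cmod (G z))\<^sup>2))" "g 0 \<noteq> 0"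
    "exp (LINT z|sphere_measure. ln ((cmod (G z))\<^sup>2)) = (cmod (g 0))\<^sup>2"
proof -
  define \<delta> where "\<delta> n = inverse (real (Suc n))" for n
  have \<delta>: "0 < \<delta> n" "\<delta> n \<le> 1" for n by (auto simp: \<delta>_def inverse_le_1_iff)
  have \<delta>lim: "\<delta> \<longlonglongrightarrow> 0" unfolding \<delta>_def by (rule LIMSEQ_inverse_real_of_nat)
  define a where "a = sqrt \<epsilon>"
  have a: "a > 0" using \<epsilon> by (simp add: a_def)
  have lower': "AE z in sphere_measure. a \<le> cmod (G z) \<and> cmod (G z) \<le> 1 \<and> 0 \<le> Re (G z)"
    using lower G_bounds by eventually_elim (simp add: a_def real_le_lsqrt)
  have bd: "AE z in sphere_measure. norm (ln (cmod (G z + of_real (\<delta> n)))) \<le> \<bar>ln a\<bar> + ln 2" for n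
    using lower'
  proof eventually_elim
    case (elim z)
    then show ?case unfolding real_norm_def
      using cmod_add_pos[of "G z" "\<delta> n"] \<delta>[of n] a by (intro abs_ln_le) auto
  qed
  have lim: "AE z in sphere_measure. (\<lambda>n. ln (cmod (G z + of_real (\<delta> n)))) \<longlonglongrightarrow> ln (cmod (G z))"
    using lower'
  proof eventually_elim
    case (elim z)
    have "(\<lambda>n. G z + of_real (\<delta> n)) \<longlonglongrightarrow> G z + of_real 0" by (intro tendsto_intros \<delta>lim)
    then have "(\<lambda>n. cmod (G z + of_real (\<delta> n))) \<longlonglongrightarrow> cmod (G z)" using tendsto_norm by fastforce
    then show ?case using elim a by (intro tendsto_ln) auto
  qed
  have m: "(\<lambda>z. ln (cmod (G z))) \<in> borel_measurable sphere_measure"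
    "(\<lambda>z. ln (cmod (G z + of_real (\<delta> n)))) \<in> borel_measurable sphere_measure" for n
    by measurable
  note dct = integral_dominated_convergence[OF m(1) m(2) integrable_const_sphere lim bd]
    integrable_dominated_convergence[OF m(1) m(2) integrable_const_sphere lim bd]
    integrable_dominated_convergence2[OF m(1) m(2) integrable_const_sphere lim bd]
  have "a \<le> cmod (g 0 + of_real (\<delta> n))" for n
  proof -
    have "ln a = (LINT z|(sphere_measure :: (complex ^ 'd) measure). ln a)"
      by (simp add: prob_space.prob_space[OF prob_space_sphere_measure])
    also have "\<dots> \<le> (LINT z|sphere_measure. ln (cmod (G z + of_real (\<delta> n))))"
    proof (rule integral_mono_AE[OF integrable_const_sphere dct(3)])
      show "AE z in sphere_measure. ln a \<le> ln (cmod (G z + of_real (\<delta> n)))"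
        using lower'
      proof eventually_elim
        case (elim z)
        then have "a \<le> cmod (G z + of_real (\<delta> n))"
          using cmod_add_pos(3)[of "G z" "\<delta> n"] \<delta>[of n] by linarith
        then show ?case using a by (intro ln_mono) auto
      qed
    qed
    also have "\<dots> = ln (cmod (g 0 + of_real (\<delta> n)))" by (rule integral_ln_shift[OF \<delta>])
    finally have "ln a \<le> ln (cmod (g 0 + of_real (\<delta> n)))" .
    moreover have "0 < cmod (g 0 + of_real (\<delta> n))"
      by (rule less_le_trans[OF \<delta>(1) cmod_add_pos(1)[OF Re_nonneg le1 \<delta>]]) auto
    ultimately show ?thesis using a by simp
  qed
  moreover have "(\<lambda>n. cmod (g 0 + of_real (\<delta> n))) \<longlonglongrightarrow> cmod (g 0 + of_real 0)"
    by (intro tendsto_intros \<delta>lim)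
  ultimately have "a \<le> cmod (g 0 + of_real 0)" by (intro LIMSEQ_le_const) auto
  then show g0: "g 0 \<noteq> 0" using a by auto
  have "(\<lambda>n. ln (cmod (g 0 + of_real (\<delta> n)))) \<longlonglongrightarrow> ln (cmod (g 0 + of_real 0))"
    using g0 by (intro tendsto_intros \<delta>lim) auto
  then have val: "(LINT z|sphere_measure. ln (cmod (G z))) = ln (cmod (g 0))"
    using dct(1) unfolding integral_ln_shift[OF \<delta>] using LIMSEQ_unique by fastforce
  have ln2: "ln ((cmod x)\<^sup>2) = 2 * ln (cmod x)" for x by (cases "x = 0") (auto simp: ln_realpow)
  show "integrable sphere_measure (\<lambda>z. ln ((cmod (G z))\<^sup>2))"
    unfolding ln2 by (intro integrable_mult_right dct(2))
  show "exp (LINT z|sphere_measure. ln ((cmod (G z))\<^sup>2)) = (cmod (g 0))\<^sup>2"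
    unfolding ln2 using g0 by (simp add: val exp_double)
qed

lemma integrable_weighted:
  fixes F :: "complex ^ 'd \<Rightarrow> complex"
  assumes F: "continuous_on (sphere 0 1) F"
  shows "integrable sphere_measure (\<lambda>z. (cmod (F z))\<^sup>2 * (cmod (G z))\<^sup>2)"
proof (rule Bochner_Integration.integrable_bound)
  show "integrable sphere_measure (\<lambda>z. (cmod (F z))\<^sup>2)" by (intro integrable_sphere continuous_intros F)
  have [measurable]: "F \<in> borel_measurable sphere_measure" by (rule borel_measurable_sphere_measure[OF F])
  show "(\<lambda>z. (cmod (F z))\<^sup>2 * (cmod (G z))\<^sup>2) \<in> borel_measurable sphere_measure" by measurable
  show "AE z in sphere_measure. norm ((cmod (F z))\<^sup>2 * (cmod (G z))\<^sup>2) \<le> norm ((cmod (F z))\<^sup>2)"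
    using G_bounds by eventually_elim (simp add: power_le_one mult_left_le)
qed

lemma weighted_integral_tendsto:
  fixes F :: "nat \<Rightarrow> complex ^ 'd \<Rightarrow> complex"
  assumes F: "\<And>n. continuous_on (sphere 0 1) (F n)" and H: "H \<in> borel_measurable sphere_measure"
    and lim: "AE z in sphere_measure. (\<lambda>n. F n z) \<longlonglongrightarrow> H z"
    and B: "\<And>n z. norm z = 1 \<Longrightarrow> cmod (F n z) \<le> B"
    and v: "v \<in> borel_measurable sphere_measure" "AE z in sphere_measure. cmod (v z) \<le> 1"
  shows "(\<lambda>n. LINT z|sphere_measure. (cmod (F n z))\<^sup>2 * (cmod (v z))\<^sup>2) \<longlonglongrightarrow> (LINT z|sphere_measure. (cmod (H z))\<^sup>2 * (cmod (v z))\<^sup>2)"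
proof (rule integral_dominated_convergence[OF _ _ integrable_const_sphere[of "B\<^sup>2"]])
  have [measurable]: "F n \<in> borel_measurable sphere_measure" for n by (rule borel_measurable_sphere_measure[OF F])
  note H[measurable] v(1)[measurable]
  show "(\<lambda>z. (cmod (H z))\<^sup>2 * (cmod (v z))\<^sup>2) \<in> borel_measurable sphere_measure"
    "(\<lambda>z. (cmod (F n z))\<^sup>2 * (cmod (v z))\<^sup>2) \<in> borel_measurable sphere_measure" for n
    by measurable
  show "AE z in sphere_measure. (\<lambda>n. (cmod (F n z))\<^sup>2 * (cmod (v z))\<^sup>2) \<longlonglongrightarrow> (cmod (H z))\<^sup>2 * (cmod (v z))\<^sup>2"
    using lim by eventually_elim (intro tendsto_intros)
  show "AE z in sphere_measure. norm ((cmod (F n z))\<^sup>2 * (cmod (v z))\<^sup>2) \<le> B\<^sup>2" for n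
    using v(2) AE_space
  proof eventually_elim
    case (elim z)
    then have "cmod (F n z) \<le> B" using B by (simp add: space_sphere_measure)
    then have "(cmod (F n z))\<^sup>2 * (cmod (v z))\<^sup>2 \<le> B\<^sup>2 * 1"
      using elim by (intro mult_mono power_mono power_le_one) auto
    then show ?case by simp
  qed
qed

text \<open>
  The mean value property of \<open>q g\<close> and the Cauchy-Schwarz inequality, on spheres of radius \<open>r < 1\<close>.
\<close>

lemma weight_lower_bound:
  assumes q: "polynomial_Cn q"
  shows "(cmod (q 0 * g 0))\<^sup>2 \<le> (LINT z|sphere_measure. (cmod (q z))\<^sup>2 * (cmod (G z))\<^sup>2)"
proof -
  define F where "F z = q z * g z" for z
  have F: "line_holomorphic F (ball 0 1)" unfolding F_def
    by (intro line_holomorphic_mult line_holomorphic_polynomial_Cn[OF q] hol)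
  have qc: "continuous_on A q" for A by (rule polynomial_Cn_continuous[OF q])
  have "bounded (q ` cball 0 1)" by (intro compact_imp_bounded compact_continuous_image qc compact_cball)
  then obtain B where B: "\<And>z. norm z \<le> 1 \<Longrightarrow> cmod (q z) \<le> B"
    unfolding bounded_iff by (metis (no_types, lifting) dist_0_norm imageI mem_cball)
  let ?F = "\<lambda>n z. F (of_real (radius n) *s z)"
  have Fc: "continuous_on (sphere 0 1) (?F n)" for n
    using radius[of n] by (intro continuous_on_subset[OF continuous_on_dilate[OF F]]) auto
  have "(cmod (F 0))\<^sup>2 \<le> (LINT z|sphere_measure. (cmod (?F n z))\<^sup>2 * (cmod 1)\<^sup>2)" for n
  proof -
    have "cmod (F 0) \<le> (LINT z|sphere_measure. cmod (?F n z))"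
      unfolding integral_mean_value_dilate[OF F radius[of n], symmetric] by (rule integral_norm_bound)
    then have "(cmod (F 0))\<^sup>2 \<le> (LINT z|sphere_measure. cmod (?F n z))\<^sup>2" by (intro power_mono) auto
    also have "\<dots> \<le> (LINT z|sphere_measure. (cmod (?F n z))\<^sup>2)"
      by (intro integral_sphere_cauchy_schwarz continuous_intros Fc)
    finally show ?thesis by simp
  qed
  moreover have "(\<lambda>n. LINT z|sphere_measure. (cmod (?F n z))\<^sup>2 * (cmod 1)\<^sup>2) \<longlonglongrightarrow> (LINT z|sphere_measure. (cmod (q z * G z))\<^sup>2 * (cmod 1)\<^sup>2)"
  proof (rule weighted_integral_tendsto[where B = B])
    have [measurable]: "q \<in> borel_measurable sphere_measure" by (rule borel_measurable_sphere_measure[OF qc])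
    show "(\<lambda>z. q z * G z) \<in> borel_measurable sphere_measure" by measurable
    show "AE z in sphere_measure. (\<lambda>n. ?F n z) \<longlonglongrightarrow> q z * G z"
      using gr_tendsto
    proof eventually_elim
      case (elim z)
      have "(\<lambda>n. q (of_real (radius n) *s z)) \<longlonglongrightarrow> q z"
        by (rule continuous_on_tendsto_compose[OF qc[of UNIV] dilate_tendsto[OF radius_tendsto]]) auto
      then show ?case unfolding F_def by (intro tendsto_mult elim)
    qed
    fix n and z :: "complex ^ 'd" assume "norm z = 1"
    then have b: "of_real (radius n) *s z \<in> ball 0 1" by (intro radial_in_ball) simp
    then have "cmod (q (of_real (radius n) *s z)) * cmod (g (of_real (radius n) *s z)) \<le> B * 1"
      by (intro mult_mono B le1) (auto intro: order_trans[OF norm_ge_zero B[of 0]] simp: less_imp_le)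
    then show "cmod (?F n z) \<le> B" by (simp add: F_def norm_mult)
  qed (auto intro: Fc)
  ultimately have "(cmod (F 0))\<^sup>2 \<le> (LINT z|sphere_measure. (cmod (q z * G z))\<^sup>2 * (cmod 1)\<^sup>2)"
    by (intro LIMSEQ_le_const) auto
  then show ?thesis by (simp add: F_def norm_mult power_mult_distrib)
qed

text \<open>
  Dilates of \<open>k = 1 / (g + \<delta>)\<close> have weighted norms tending to the weighted norm of the boundary values,
  which is at most \<open>1\<close> since \<open>|g| \<le> |g + \<delta>|\<close>. A polynomial uniformly close to a dilate inherits this;
  the distance \<open>\<delta>\<^sup>2\<close> compensates for the bound \<open>1 / \<delta>\<close> of \<open>k\<close>.
\<close>

lemma reciprocal_approximation:
  assumes \<delta>: "0 < \<delta>" "\<delta> \<le> 1"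
  obtains p where "polynomial_Cn p" "cmod (p 0 - 1 / (g 0 + of_real \<delta>)) \<le> \<delta>"
    "(LINT z|sphere_measure. (cmod (p z))\<^sup>2 * (cmod (G z))\<^sup>2) \<le> 1 + 4 * \<delta>"
proof -
  define k where "k z = inverse (g z + of_real \<delta>)" for z
  have k: "line_holomorphic k (ball 0 1)"
    unfolding k_def
  proof (rule line_holomorphic_compose[OF hol, where V = "{x. Re x > - \<delta>}"])
    show "(\<lambda>x. inverse (x + of_real \<delta>)) holomorphic_on {x. Re x > - \<delta>}"
      by (intro holomorphic_intros) (auto simp: complex_eq_iff)
    show "g ` ball 0 1 \<subseteq> {x. Re x > - \<delta>}" using Re_nonneg \<delta> by force
  qed
  have kb: "cmod (k z) \<le> 1 / \<delta>" if "z \<in> ball 0 1" for z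
  proof -
    have "\<delta> \<le> cmod (g z + of_real \<delta>)" using cmod_add_pos(1)[OF Re_nonneg[OF that] le1[OF that] \<delta>] .
    then show ?thesis using \<delta> by (simp add: k_def norm_inverse divide_inverse le_imp_inverse_le)
  qed
  let ?k = "\<lambda>n z. k (of_real (radius n) *s z)"
  have kc: "continuous_on (sphere 0 1) (?k n)" for n
    using radius[of n] by (intro continuous_on_subset[OF continuous_on_dilate[OF k]]) auto
  have G1: "AE z in sphere_measure. cmod (G z) \<le> 1" using G_bounds by eventually_elim simp
  have "(\<lambda>n. LINT z|sphere_measure. (cmod (?k n z))\<^sup>2 * (cmod (G z))\<^sup>2) \<longlonglongrightarrow>
      (LINT z|sphere_measure. (cmod (inverse (G z + of_real \<delta>)))\<^sup>2 * (cmod (G z))\<^sup>2)"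
  proof (rule weighted_integral_tendsto[OF kc _ _ _ G_measurable G1])
    show "(\<lambda>z. inverse (G z + of_real \<delta>)) \<in> borel_measurable sphere_measure" by measurable
    show "AE z in sphere_measure. (\<lambda>n. ?k n z) \<longlonglongrightarrow> inverse (G z + of_real \<delta>)"
      using gr_tendsto G_bounds
    proof eventually_elim
      case (elim z)
      then have "G z + of_real \<delta> \<noteq> 0" using cmod_add_pos(1)[of "G z" \<delta>] \<delta> by auto
      then show ?case unfolding k_def by (intro tendsto_inverse tendsto_add elim tendsto_const)
    qed
    show "cmod (?k n z) \<le> 1 / \<delta>" if "norm z = 1" for n z
      by (intro kb radial_in_ball) (use that in simp)
  qed
  moreover have "(LINT z|sphere_measure. (cmod (inverse (G z + of_real \<delta>)))\<^sup>2 * (cmod (G z))\<^sup>2) \<le> 1"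
  proof -
    have "(LINT z|sphere_measure. (cmod (inverse (G z + of_real \<delta>)))\<^sup>2 * (cmod (G z))\<^sup>2) \<le> (LINT z|(sphere_measure :: (complex ^ 'd) measure). 1)"
    proof (rule Bochner_Integration.integral_mono_AE'[OF integrable_const_sphere])
      show "AE z in sphere_measure. (cmod (inverse (G z + of_real \<delta>)))\<^sup>2 * (cmod (G z))\<^sup>2 \<le> 1"
        using G_bounds
      proof eventually_elim
        case (elim z)
        then have "cmod (G z) \<le> cmod (G z + of_real \<delta>)" "0 < cmod (G z + of_real \<delta>)"
          using cmod_add_pos[of "G z" \<delta>] \<delta> by auto
        then have "cmod (inverse (G z + of_real \<delta>)) * cmod (G z) \<le> 1"
          by (simp only: norm_inverse mult.commute[of "inverse _"] divide_inverse[symmetric] divide_le_eq_1_pos)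
        then show ?case by (simp add: power_le_one flip: power_mult_distrib)
      qed
    qed auto
    then show ?thesis by (simp add: prob_space.prob_space[OF prob_space_sphere_measure])
  qed
  ultimately have "\<forall>\<^sub>F n in sequentially. (LINT z|sphere_measure. (cmod (?k n z))\<^sup>2 * (cmod (G z))\<^sup>2) < 1 + \<delta>"
    using \<delta> by (intro order_tendstoD(2)) auto
  then obtain n where n: "(LINT z|sphere_measure. (cmod (?k n z))\<^sup>2 * (cmod (G z))\<^sup>2) < 1 + \<delta>"
    by (auto simp: eventually_sequentially)
  have d2: "\<delta>\<^sup>2 > 0" "\<delta>\<^sup>2 \<le> \<delta>" using \<delta> by (auto simp: power2_eq_square mult_left_le_one_le)
  obtain p where p: "polynomial_Cn p" "\<And>z. norm z \<le> 1 \<Longrightarrow> cmod (?k n z - p z) \<le> \<delta>\<^sup>2"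
    using polynomial_approximation_dilate[OF k kb _ _ d2(1), of "radius n"] radius[of n] by (metis less_imp_le)
  have pc: "continuous_on A p" for A by (rule polynomial_Cn_continuous[OF p(1)])
  have [measurable]: "p \<in> borel_measurable sphere_measure" "?k n \<in> borel_measurable sphere_measure"
    by (auto intro: borel_measurable_sphere_measure pc kc)
  show ?thesis
  proof (rule that[OF p(1)])
    have "cmod (p 0 - k 0) \<le> \<delta>\<^sup>2" using p(2)[of 0] by (simp add: norm_minus_commute)
    then show "cmod (p 0 - 1 / (g 0 + of_real \<delta>)) \<le> \<delta>" using d2 by (simp add: k_def inverse_eq_divide)
    have sq: "(cmod (p z))\<^sup>2 \<le> (cmod (?k n z))\<^sup>2 + 3 * \<delta>" if z: "norm z = 1" for z
    proof -
      have b: "cmod (?k n z) \<le> 1 / \<delta>" by (intro kb radial_in_ball) (use z in simp)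
      have "cmod (p z) \<le> cmod (?k n z) + \<delta>\<^sup>2"
        using p(2)[of z] z norm_triangle_ineq2[of "p z" "?k n z"] by (simp add: norm_minus_commute)
      then have "(cmod (p z))\<^sup>2 \<le> (cmod (?k n z) + \<delta>\<^sup>2)\<^sup>2" by (intro power_mono) auto
      also have "\<dots> = (cmod (?k n z))\<^sup>2 + 2 * \<delta>\<^sup>2 * cmod (?k n z) + \<delta>\<^sup>2 * \<delta>\<^sup>2"
        by (simp add: power2_eq_square algebra_simps)
      also have "2 * \<delta>\<^sup>2 * cmod (?k n z) \<le> 2 * \<delta>\<^sup>2 * (1 / \<delta>)" using b by (intro mult_left_mono) auto
      also have "2 * \<delta>\<^sup>2 * (1 / \<delta>) = 2 * \<delta>" using \<delta> by (simp add: power2_eq_square)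
      also have "\<delta>\<^sup>2 * \<delta>\<^sup>2 \<le> \<delta> * 1" using d2 \<delta> by (intro mult_mono) auto
      finally show ?thesis by simp
    qed
    have bnd: "(cmod (G z))\<^sup>2 \<le> 1" if "cmod (G z) \<le> 1" for z using that by (simp add: power_le_one)
    have "(LINT z|sphere_measure. (cmod (p z))\<^sup>2 * (cmod (G z))\<^sup>2) \<le> (LINT z|sphere_measure. (cmod (?k n z))\<^sup>2 * (cmod (G z))\<^sup>2 + 3 * \<delta>)"
    proof (rule integral_mono_AE[OF integrable_weighted[OF pc] Bochner_Integration.integrable_add[OF integrable_weighted[OF kc] integrable_const_sphere]])
      show "AE z in sphere_measure. (cmod (p z))\<^sup>2 * (cmod (G z))\<^sup>2 \<le> (cmod (?k n z))\<^sup>2 * (cmod (G z))\<^sup>2 + 3 * \<delta>"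
        using G1 AE_space
      proof eventually_elim
        case (elim z)
        then have "(cmod (p z))\<^sup>2 * (cmod (G z))\<^sup>2 \<le> ((cmod (?k n z))\<^sup>2 + 3 * \<delta>) * (cmod (G z))\<^sup>2"
          by (intro mult_right_mono sq) (auto simp: space_sphere_measure)
        also have "\<dots> \<le> (cmod (?k n z))\<^sup>2 * (cmod (G z))\<^sup>2 + 3 * \<delta>"
          using bnd[OF elim(1)] \<delta> by (simp add: distrib_right mult_left_le)
        finally show ?case .
      qed
    qed
    also have "\<dots> = (LINT z|sphere_measure. (cmod (?k n z))\<^sup>2 * (cmod (G z))\<^sup>2) + 3 * \<delta>"
      by (subst Bochner_Integration.integral_add[OF integrable_weighted[OF kc] integrable_const_sphere])
         (simp add: prob_space.prob_space[OF prob_space_sphere_measure])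
    finally show "(LINT z|sphere_measure. (cmod (p z))\<^sup>2 * (cmod (G z))\<^sup>2) \<le> 1 + 4 * \<delta>" using n by simp
  qed
qed

text \<open>
  Divide the polynomials of \<open>reciprocal_approximation\<close> by their values at \<open>0\<close>, which tend to \<open>1 / g 0\<close>.
\<close>

lemma weight_upper_bound:
  assumes g0: "g 0 \<noteq> 0" and \<eta>: "\<eta> > 0"
  obtains f where "polynomial_Cn f" "f 0 = 1"
    "(LINT z|sphere_measure. (cmod (f z))\<^sup>2 * (cmod (G z))\<^sup>2) < (cmod (g 0))\<^sup>2 + \<eta>"
proof -
  define \<delta> where "\<delta> n = inverse (real (Suc n))" for n
  have \<delta>: "0 < \<delta> n" "\<delta> n \<le> 1" for n by (auto simp: \<delta>_def inverse_le_1_iff)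
  have \<delta>lim: "\<delta> \<longlonglongrightarrow> 0" unfolding \<delta>_def by (rule LIMSEQ_inverse_real_of_nat)
  have "\<exists>p. polynomial_Cn p \<and> cmod (p 0 - 1 / (g 0 + of_real (\<delta> n))) \<le> \<delta> n \<and>
    (LINT z|sphere_measure. (cmod (p z))\<^sup>2 * (cmod (G z))\<^sup>2) \<le> 1 + 4 * \<delta> n" for n
    by (rule reciprocal_approximation[OF \<delta>[of n]]) blast
  then have "\<forall>n. \<exists>p. polynomial_Cn p \<and> cmod (p 0 - 1 / (g 0 + of_real (\<delta> n))) \<le> \<delta> n \<and>
    (LINT z|sphere_measure. (cmod (p z))\<^sup>2 * (cmod (G z))\<^sup>2) \<le> 1 + 4 * \<delta> n" by blast
  from choice[OF this] obtain p where p: "\<And>n. polynomial_Cn (p n)"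
    "\<And>n. cmod (p n 0 - 1 / (g 0 + of_real (\<delta> n))) \<le> \<delta> n"
    "\<And>n. (LINT z|sphere_measure. (cmod (p n z))\<^sup>2 * (cmod (G z))\<^sup>2) \<le> 1 + 4 * \<delta> n" by blast
  have "(\<lambda>n. p n 0 - 1 / (g 0 + of_real (\<delta> n))) \<longlonglongrightarrow> 0"
    by (rule Lim_null_comparison[OF always_eventually \<delta>lim]) (use p(2) in blast)
  moreover have "(\<lambda>n. 1 / (g 0 + of_real (\<delta> n))) \<longlonglongrightarrow> 1 / (g 0 + of_real 0)"
    using g0 by (intro tendsto_intros \<delta>lim) auto
  ultimately have "(\<lambda>n. (p n 0 - 1 / (g 0 + of_real (\<delta> n))) + 1 / (g 0 + of_real (\<delta> n))) \<longlonglongrightarrow> 0 + 1 / (g 0 + of_real 0)"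
    by (rule tendsto_add)
  then have p0: "(\<lambda>n. p n 0) \<longlonglongrightarrow> 1 / g 0" by simp
  have "(\<lambda>n. (1 + 4 * \<delta> n) / (cmod (p n 0))\<^sup>2) \<longlonglongrightarrow> (1 + 4 * 0) / (cmod (1 / g 0))\<^sup>2"
    using g0 by (intro tendsto_intros \<delta>lim p0) auto
  then have "(\<lambda>n. (1 + 4 * \<delta> n) / (cmod (p n 0))\<^sup>2) \<longlonglongrightarrow> (cmod (g 0))\<^sup>2"
    by (simp add: norm_divide power_divide)
  then have "\<forall>\<^sub>F n in sequentially. (1 + 4 * \<delta> n) / (cmod (p n 0))\<^sup>2 < (cmod (g 0))\<^sup>2 + \<eta>"
    using \<eta> by (intro order_tendstoD(2)) auto
  moreover have "\<forall>\<^sub>F n in sequentially. p n 0 \<noteq> 0"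
    using g0 by (intro tendsto_imp_eventually_ne[OF p0]) auto
  ultimately have "\<forall>\<^sub>F n in sequentially. (1 + 4 * \<delta> n) / (cmod (p n 0))\<^sup>2 < (cmod (g 0))\<^sup>2 + \<eta> \<and> p n 0 \<noteq> 0"
    by eventually_elim simp
  then obtain n where n: "(1 + 4 * \<delta> n) / (cmod (p n 0))\<^sup>2 < (cmod (g 0))\<^sup>2 + \<eta>" "p n 0 \<noteq> 0"
    by (auto simp: eventually_sequentially)
  show ?thesis
  proof (rule that[of "\<lambda>z. p n z * inverse (p n 0)"])
    show "polynomial_Cn (\<lambda>z. p n z * inverse (p n 0))" by (intro polynomial_Cn_mult polynomial_Cn_const p)
    have "(LINT z|sphere_measure. (cmod (p n z * inverse (p n 0)))\<^sup>2 * (cmod (G z))\<^sup>2)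
       = (LINT z|sphere_measure. ((cmod (p n z))\<^sup>2 * (cmod (G z))\<^sup>2) / (cmod (p n 0))\<^sup>2)"
      by (simp add: norm_mult norm_inverse power_mult_distrib divide_inverse power_inverse mult_ac)
    also have "\<dots> \<le> (1 + 4 * \<delta> n) / (cmod (p n 0))\<^sup>2"
      using p(3)[of n] by (simp add: divide_right_mono)
    finally show "(LINT z|sphere_measure. (cmod (p n z * inverse (p n 0)))\<^sup>2 * (cmod (G z))\<^sup>2) < (cmod (g 0))\<^sup>2 + \<eta>"
      using n(1) by simp
  qed (use n in simp)
qed

end

section \<open>Removing point masses\<close>

lemma nn_integral_add_measures:
  assumes sets: "sets N1 = sets M" "sets N2 = sets M"
    and eq: "\<And>A. A \<in> sets M \<Longrightarrow> emeasure M A = emeasure N1 A + emeasure N2 A"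
    and f: "f \<in> borel_measurable M"
  shows "(\<integral>\<^sup>+x. f x \<partial>M) = (\<integral>\<^sup>+x. f x \<partial>N1) + (\<integral>\<^sup>+x. f x \<partial>N2)"
  using f
proof (induction rule: borel_measurable_induct)
  case (cong f g)
  have sp: "space N1 = space M" "space N2 = space M" using sets by (auto dest: sets_eq_imp_space_eq)
  have "integral\<^sup>N M f = integral\<^sup>N M g" "integral\<^sup>N N1 f = integral\<^sup>N N1 g" "integral\<^sup>N N2 f = integral\<^sup>N N2 g"
    by (rule nn_integral_cong; simp add: cong.hyps(3) sp)+
  then show ?case using cong.IH by simp
next
  case (set A)
  then show ?case using eq sets by simp
next
  case (mult u c)
  have "u \<in> borel_measurable N1" "u \<in> borel_measurable N2"
    unfolding measurable_cong_sets[OF sets(1) refl] measurable_cong_sets[OF sets(2) refl] using mult(2) by simp_all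
  then show ?case using mult by (simp add: nn_integral_cmult distrib_left)
next
  case (add u v)
  have "u \<in> borel_measurable N1" "u \<in> borel_measurable N2" "v \<in> borel_measurable N1" "v \<in> borel_measurable N2"
    unfolding measurable_cong_sets[OF sets(1) refl] measurable_cong_sets[OF sets(2) refl] using add.hyps(1,3) by simp_all
  then show ?case using add by (simp add: nn_integral_add add_ac)
next
  case (seq U)
  have m: "U i \<in> borel_measurable N1" "U i \<in> borel_measurable N2" for i
    unfolding measurable_cong_sets[OF sets(1) refl] measurable_cong_sets[OF sets(2) refl] using seq(1) by simp_all
  have inc: "incseq (\<lambda>i. \<integral>\<^sup>+x. U i x \<partial>N)" for N
    using seq.hyps(3) by (auto simp: incseq_def le_fun_def intro!: nn_integral_mono)
  have sup: "(\<integral>\<^sup>+x. (SUP i. U i) x \<partial>N) = (SUP i. \<integral>\<^sup>+x. U i x \<partial>N)" if "\<And>i. U i \<in> borel_measurable N" for N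
    unfolding SUP_apply by (rule nn_integral_monotone_convergence_SUP[OF seq.hyps(3) that])
  show ?case
    unfolding sup[OF seq.hyps(1)] sup[OF m(1)] sup[OF m(2)] seq.IH by (rule ennreal_SUP_add[OF inc inc])
qed

text \<open>
  The atoms form a countable set whose complement is null, and finite subsets exhaust it.
\<close>

lemma discrete_tail:
  fixes \<nu> :: "(complex ^ 'd) measure"
  assumes d: "discrete_sphere_measure \<nu>" and fin: "emeasure \<nu> (sphere 0 1) < \<infinity>" and e: "e > 0"
  obtains F where "finite F" "F \<subseteq> sphere 0 1" "emeasure \<nu> (sphere 0 1 - F) < ennreal e"
proof -
  obtain I :: "nat set" and \<rho> :: "nat \<Rightarrow> real" and \<zeta> where sets: "sets \<nu> = sets sphere_borel"
    and \<zeta>: "\<And>k. k \<in> I \<Longrightarrow> \<zeta> k \<in> sphere 0 1"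
    and eq: "\<And>A. A \<in> sets \<nu> \<Longrightarrow> emeasure \<nu> A = (\<Sum>\<^sub>\<infinity>k\<in>I. ennreal (\<rho> k) * emeasure (return sphere_borel (\<zeta> k)) A)"
    using d unfolding discrete_sphere_measure_def by blast
  have meas: "sphere 0 1 \<inter> U \<in> sets \<nu>" if "U \<in> sets borel" for U
    using that by (auto simp: sets sphere_borel_def sets_restrict_space)
  have Sm: "sphere 0 1 - X \<in> sets \<nu>" if "countable X" for X
  proof -
    have "- X \<in> sets borel" using that sets.compl_sets[OF sets.countable[of X borel]] by (simp add: Compl_eq_Diff_UNIV)
    from meas[OF this] show ?thesis by (simp add: Diff_eq)
  qed
  define F where "F m = \<zeta> ` (I \<inter> {..<m})" for m
  have fF: "finite (F m)" for m by (simp add: F_def)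
  have "(\<lambda>m. emeasure \<nu> (sphere 0 1 - F m)) \<longlonglongrightarrow> emeasure \<nu> (\<Inter>m. sphere 0 1 - F m)"
  proof (rule Lim_emeasure_decseq)
    show "range (\<lambda>m. sphere 0 1 - F m) \<subseteq> sets \<nu>" using Sm fF countable_finite by blast
    show "decseq (\<lambda>m. sphere 0 1 - F m)" by (auto simp: decseq_def F_def)
    show "emeasure \<nu> (sphere 0 1 - F m) \<noteq> \<infinity>" for m
      using emeasure_mono[of "sphere 0 1 - F m" "sphere 0 1" \<nu>] meas[of UNIV] fin by (auto simp: top_unique)
  qed
  also have "(\<Inter>m. sphere 0 1 - F m) = sphere 0 1 - \<zeta> ` I" by (auto simp: F_def)
  also have "emeasure \<nu> (sphere 0 1 - \<zeta> ` I) = 0"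
  proof -
    have A: "sphere 0 1 - \<zeta> ` I \<in> sets \<nu>" by (rule Sm) simp
    show ?thesis
      unfolding eq[OF A] using A by (intro infsum_0) (auto simp: sets)
  qed
  finally have "\<forall>\<^sub>F m in sequentially. emeasure \<nu> (sphere 0 1 - F m) < ennreal e"
    using e by (intro order_tendstoD(2)) auto
  then obtain m where "emeasure \<nu> (sphere 0 1 - F m) < ennreal e" by (auto simp: eventually_sequentially)
  moreover have "F m \<subseteq> sphere 0 1" unfolding F_def using \<zeta> by blast
  ultimately show ?thesis using that[of "F m"] fF by blast
qed

text \<open>
  \<open>(1 + \<langle>z, \<zeta>\<rangle>) / 2\<close> is \<open>1\<close> at \<open>\<zeta>\<close> and has modulus less than \<open>1\<close> at all other points of the closed ball,
  also in dimension one, where \<open>\<langle>z, \<zeta>\<rangle>\<close> itself has modulus \<open>1\<close> on the whole sphere.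
\<close>

definition peak_product :: "(complex ^ 'd) set \<Rightarrow> nat \<Rightarrow> complex ^ 'd \<Rightarrow> complex" where
  "peak_product F n z = (\<Prod>\<zeta>\<in>F. 1 - ((1 + cinner z \<zeta>) / 2) ^ n)"

lemma polynomial_Cn_diff: "polynomial_Cn p \<Longrightarrow> polynomial_Cn q \<Longrightarrow> polynomial_Cn (\<lambda>z. p z - q z)"
  using polynomial_Cn_add[of p "\<lambda>z. (- 1) * q z"] polynomial_Cn_mult[OF polynomial_Cn_const[of "- 1"], of q] by simp

lemma polynomial_Cn_peak_product:
  assumes "finite F" shows "polynomial_Cn (peak_product F n)"
  unfolding peak_product_def[abs_def] divide_inverse
  by (intro polynomial_Cn_prod polynomial_Cn_diff polynomial_Cn_power polynomial_Cn_mult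
        polynomial_Cn_add polynomial_Cn_const polynomial_Cn_cinner assms)

lemma peak_product_bound:
  assumes "F \<subseteq> sphere 0 1" "norm z = 1"
  shows "cmod (peak_product F n z) \<le> 2 ^ card F"
proof -
  have "cmod (1 - ((1 + cinner z \<zeta>) / 2) ^ n) \<le> 2" if "\<zeta> \<in> F" for \<zeta>
  proof -
    have "norm \<zeta> = 1" using assms that by auto
    then have "cmod ((1 + cinner z \<zeta>) / 2) \<le> 1"
      using norm_triangle_ineq[of 1 "cinner z \<zeta>"] cmod_cinner_le_1[OF assms(2), of \<zeta>] by (simp add: norm_divide)
    then have "cmod (((1 + cinner z \<zeta>) / 2) ^ n) \<le> 1" unfolding norm_power by (intro power_le_one) auto
    then show ?thesis using norm_triangle_ineq4[of 1 "((1 + cinner z \<zeta>) / 2) ^ n"] by simp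
  qed
  then have "(\<Prod>\<zeta>\<in>F. cmod (1 - ((1 + cinner z \<zeta>) / 2) ^ n)) \<le> (\<Prod>\<zeta>\<in>F. 2)" by (intro prod_mono) auto
  then show ?thesis by (simp add: peak_product_def prod_norm)
qed

lemma peak_product_tendsto:
  assumes F: "finite F" "F \<subseteq> sphere 0 1" and z: "norm z = 1"
  shows "(\<lambda>n. peak_product F n z) \<longlonglongrightarrow> indicator (- F) z"
proof (cases "z \<in> F")
  case True
  have "(1 + cinner z z) / 2 = 1" using z by (simp add: cinner_self)
  then have "1 - ((1 + cinner z z) / 2) ^ n = 0" for n by simp
  then have "peak_product F n z = 0" for n
    unfolding peak_product_def using F(1) True by (intro prod_zero) blast+
  then show ?thesis using True by simp
next
  case False
  have "(\<lambda>n. 1 - ((1 + cinner z \<zeta>) / 2) ^ n) \<longlonglongrightarrow> 1 - 0" if "\<zeta> \<in> F" for \<zeta>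
  proof -
    have \<zeta>: "norm \<zeta> = 1" "z \<noteq> \<zeta>" using F that False by auto
    have le: "cmod (cinner z \<zeta>) \<le> 1" by (rule cmod_cinner_le_1[OF z \<zeta>(1)])
    have "cinner z \<zeta> \<noteq> 1"
    proof
      assume 1: "cinner z \<zeta> = 1"
      then have "cinner \<zeta> z = 1" using cnj_cinner[of z \<zeta>] by simp
      moreover have "cinner (z - \<zeta>) (z - \<zeta>) = (cinner z z - cinner \<zeta> z) - (cinner z \<zeta> - cinner \<zeta> \<zeta>)"
        by (simp only: cinner_diff_left cinner_diff_right)
      ultimately have "cinner (z - \<zeta>) (z - \<zeta>) = 0" using 1 z \<zeta> by (simp add: cinner_self[of z] cinner_self[of \<zeta>])
      then show False using \<zeta>(2) by (simp add: cinner_self)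
    qed
    have re: "Re (cinner z \<zeta>) < 1"
    proof (rule ccontr)
      assume "\<not> Re (cinner z \<zeta>) < 1"
      then have "Re (cinner z \<zeta>) = 1" using le complex_Re_le_cmod[of "cinner z \<zeta>"] by linarith
      moreover then have "Im (cinner z \<zeta>) = 0"
        using le unfolding cmod_def by (simp add: real_sqrt_le_1_iff)
      ultimately show False using \<open>cinner z \<zeta> \<noteq> 1\<close> by (simp add: complex_eq_iff)
    qed
    have "(cmod (1 + cinner z \<zeta>))\<^sup>2 = 1 + 2 * Re (cinner z \<zeta>) + (cmod (cinner z \<zeta>))\<^sup>2"
      by (simp add: cmod_power2 power2_sum)
    also have "\<dots> < 1 + 2 * 1 + 1"
    proof -
      have "(cmod (cinner z \<zeta>))\<^sup>2 \<le> 1" using le by (simp add: power_le_one)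
      then show ?thesis using re by linarith
    qed
    finally have "(cmod (1 + cinner z \<zeta>))\<^sup>2 < 2\<^sup>2" by simp
    then have "cmod (1 + cinner z \<zeta>) < 2" by (rule power2_less_imp_less) simp
    then have "cmod ((1 + cinner z \<zeta>) / 2) < 1" by (simp add: norm_divide)
    then show ?thesis by (intro tendsto_diff tendsto_const LIMSEQ_power_zero)
  qed
  then have "(\<lambda>n. \<Prod>\<zeta>\<in>F. 1 - ((1 + cinner z \<zeta>) / 2) ^ n) \<longlonglongrightarrow> (\<Prod>\<zeta>\<in>F. 1 - 0)" by (intro tendsto_prod)
  then show ?thesis using False by (simp add: peak_product_def)
qed

lemma peak_product_0_tendsto: "(\<lambda>n. peak_product F n 0) \<longlonglongrightarrow> 1"
proof -
  have "(\<lambda>n. \<Prod>\<zeta>\<in>F. 1 - (1 / 2 :: complex) ^ n) \<longlonglongrightarrow> (\<Prod>\<zeta>\<in>F. 1 - 0)"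
    by (intro tendsto_prod tendsto_diff tendsto_const LIMSEQ_power_zero) (simp add: norm_divide)
  then show ?thesis by (simp add: peak_product_def)
qed

section \<open>Linear independence of the monomials\<close>

text \<open>
  By definition the measure of the set is the proportion of the ball covered by the cone over it, and the cone
  contains the nonempty open set \<open>ball 0 1 \<inter> U\<close>.
\<close>

lemma sphere_measure_open_pos:
  fixes U :: "(complex ^ 'd) set"
  assumes U: "open U" and ne: "x \<in> U" "x \<noteq> 0" and cone: "\<And>z r. z \<in> U \<Longrightarrow> r > 0 \<Longrightarrow> r *\<^sub>R z \<in> U" and 0: "0 \<notin> U"
  shows "emeasure sphere_measure (sphere 0 1 \<inter> U) \<noteq> 0"
proof -
  have m: "sphere 0 1 \<inter> U \<in> sets sphere_borel"
    using sphere_Int_open_sets[OF U] by (simp add: sets_sphere_measure)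
  have sub: "ball 0 1 \<inter> U \<subseteq> ball 0 1 \<inter> sgn -` (sphere 0 1 \<inter> U)"
  proof
    fix z assume z: "z \<in> ball 0 1 \<inter> U"
    then have "z \<noteq> 0" using 0 by auto
    moreover from this have "sgn z \<in> U" unfolding sgn_div_norm using z cone[of z "inverse (norm z)"] by simp
    ultimately show "z \<in> ball 0 1 \<inter> sgn -` (sphere 0 1 \<inter> U)" using z by (simp add: norm_sgn)
  qed
  have sgnm: "(sgn :: complex ^ 'd \<Rightarrow> _) \<in> borel_measurable borel"
    unfolding sgn_div_norm[abs_def] by measurable
  have "sphere 0 1 \<inter> U \<in> sets borel" using U by auto
  from measurable_sets[OF sgnm this] have sm: "ball 0 1 \<inter> sgn -` (sphere 0 1 \<inter> U) \<in> sets lborel" by simp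
  have "(1 / (2 * norm x)) *\<^sub>R x \<in> ball 0 1 \<inter> U" using ne cone[OF ne(1), of "1 / (2 * norm x)"] by auto
  moreover have "open (ball 0 1 \<inter> U)" using U by (intro open_Int open_ball)
  ultimately have "\<not> negligible (ball 0 1 \<inter> U)" using open_not_negligible by blast
  then have "emeasure lborel (ball 0 1 \<inter> U) \<noteq> 0"
    using U by (auto simp: negligible_iff_null_sets null_sets_completion_iff null_sets_def)
  then have "emeasure lborel (ball 0 1 \<inter> sgn -` (sphere 0 1 \<inter> U)) \<noteq> 0"
    using emeasure_mono[OF sub sm] by auto
  moreover have "emeasure lborel (ball (0 :: complex ^ 'd) 1) \<noteq> \<infinity>"
    using emeasure_lborel_ball_finite by (simp add: less_top)
  ultimately show ?thesis
    unfolding emeasure_sphere_measure[OF m] by (simp add: ennreal_divide_eq_0_iff)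
qed

lemma integral_cmonom_pos:
  fixes \<alpha> :: "nat ^ 'd"
  shows "0 < (LINT z|sphere_measure. (cmod (cmonom \<alpha> z))\<^sup>2)"
proof -
  define U where "U = {z :: complex ^ 'd. \<forall>i. z $ i \<noteq> 0}"
  have "U = (\<Inter>i. {z. z $ i \<noteq> 0})" by (auto simp: U_def)
  then have U: "open U" by (auto intro!: open_INT open_Collect_neq continuous_intros)
  have i: "integrable sphere_measure (\<lambda>z. (cmod (cmonom \<alpha> z))\<^sup>2)" by (intro integrable_sphere continuous_intros)
  have "(LINT z|sphere_measure. (cmod (cmonom \<alpha> z))\<^sup>2) \<noteq> 0"
  proof
    assume "(LINT z|sphere_measure. (cmod (cmonom \<alpha> z))\<^sup>2) = 0"
    then have "AE z in sphere_measure. (cmod (cmonom \<alpha> z))\<^sup>2 = 0"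
      using integral_nonneg_eq_0_iff_AE[OF i] by simp
    then have "AE z in sphere_measure. z \<notin> sphere 0 1 \<inter> U"
      by eventually_elim (auto simp: U_def cmonom_def)
    then have "emeasure sphere_measure (sphere 0 1 \<inter> U) = 0"
      using AE_iff_null_sets[OF sphere_Int_open_sets[OF U]] by auto
    moreover have "emeasure sphere_measure (sphere 0 1 \<inter> U) \<noteq> 0"
    proof (rule sphere_measure_open_pos[OF U])
      show "(\<chi> i. 1) \<in> U" "(\<chi> i. 1) \<noteq> (0 :: complex ^ 'd)" "0 \<notin> U" by (simp_all add: U_def vec_eq_iff)
    qed (auto simp: U_def)
    ultimately show False by simp
  qed
  moreover have "0 \<le> (LINT z|sphere_measure. (cmod (cmonom \<alpha> z))\<^sup>2)" by simp
  ultimately show ?thesis by linarith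
qed

lemma integral_polynomial_pos:
  fixes c :: "nat ^ 'd \<Rightarrow> complex"
  assumes S: "finite S" "i \<in> S" "c i \<noteq> 0"
  shows "0 < (LINT z|sphere_measure. (cmod (\<Sum>j\<in>S. c j * cmonom j z))\<^sup>2)"
proof -
  let ?n = "\<lambda>j. LINT z|sphere_measure. (cmod (cmonom j (z :: complex ^ 'd)))\<^sup>2"
  have k: "moment_kernel sphere_measure j l = (if j = l then of_real (?n j) else 0)" for j l :: "nat ^ 'd"
    using integral_cmonom_orthogonal[of j l]
    unfolding moment_kernel_def integral_complex_of_real[symmetric] complex_norm_square by auto
  have "complex_of_real (LINT z|sphere_measure. (cmod (\<Sum>j\<in>S. c j * cmonom j z))\<^sup>2)
      = (\<Sum>j\<in>S. \<Sum>l\<in>S. c j * moment_kernel sphere_measure j l * cnj (c l))"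
    unfolding moment_quadratic_form[OF finite_sphere_measure sets_sphere_measure S(1) S(1)]
      integral_complex_of_real[symmetric] complex_norm_square ..
  also have "\<dots> = (\<Sum>j\<in>S. of_real ((cmod (c j))\<^sup>2 * ?n j))"
  proof (rule sum.cong[OF refl])
    fix j assume j: "j \<in> S"
    have "(\<Sum>l\<in>S. c j * moment_kernel sphere_measure j l * cnj (c l)) = (\<Sum>l\<in>S. if l = j then c j * of_real (?n j) * cnj (c j) else 0)"
      by (rule sum.cong) (auto simp: k)
    then show "(\<Sum>l\<in>S. c j * moment_kernel sphere_measure j l * cnj (c l)) = of_real ((cmod (c j))\<^sup>2 * ?n j)"
      using S(1) j unfolding of_real_mult complex_norm_square by (simp add: mult_ac)
  qed
  also have "\<dots> = of_real (\<Sum>j\<in>S. (cmod (c j))\<^sup>2 * ?n j)" by simp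
  finally have "(LINT z|sphere_measure. (cmod (\<Sum>j\<in>S. c j * cmonom j z))\<^sup>2) = (\<Sum>j\<in>S. (cmod (c j))\<^sup>2 * ?n j)"
    using of_real_eq_iff by blast
  also have "\<dots> > 0"
  proof (rule sum_pos2[OF S(1,2)])
    show "0 < (cmod (c i))\<^sup>2 * ?n i" using S(3) by (intro mult_pos_pos integral_cmonom_pos) simp
    show "0 \<le> (cmod (c j))\<^sup>2 * ?n j" for j by (intro mult_nonneg_nonneg less_imp_le[OF integral_cmonom_pos]) simp
  qed
  finally show ?thesis .
qed

section \<open>The limit of the prediction errors\<close>

lemma cmonom_at_0: "cmonom \<alpha> 0 = (if \<alpha> = 0 then 1 else 0)"
proof (cases "\<alpha> = 0")
  case False
  then obtain i where "\<alpha> $ i \<noteq> 0" by (auto simp: vec_eq_iff)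
  then have "(\<Prod>i\<in>UNIV. (0 :: complex) ^ (\<alpha> $ i)) = 0" by (intro prod_zero bexI[of _ i]) auto
  then show ?thesis using False by (simp add: cmonom_def)
qed (simp add: cmonom_def)

lemma cmonom_0: "cmonom 0 z = 1"
  by (simp add: cmonom_def)

text \<open>
  A polynomial with value \<open>1\<close> at \<open>0\<close> has constant coefficient \<open>1\<close>, so it is one of the functions
  that compete in \<open>prediction_error\<close> as soon as all its monomials are enumerated.
\<close>

lemma polynomial_prediction_form:
  fixes p :: "complex ^ 'd::{finite,linorder} \<Rightarrow> complex"
  assumes p: "polynomial_Cn p" and p0: "p 0 = 1"
  obtains N c where "\<And>n z. n \<ge> N \<Longrightarrow> p z = cmonom 0 z - (\<Sum>\<delta>\<in>shortlex_enum ` {1..n}. c \<delta> * cmonom \<delta> z)"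
proof -
  obtain A a where A: "finite A" "\<And>z. p z = (\<Sum>\<alpha>\<in>A. a \<alpha> * cmonom \<alpha> z)"
    using p unfolding polynomial_Cn_def by blast
  define b where "b \<alpha> = (if \<alpha> \<in> A then a \<alpha> else 0)" for \<alpha>
  have "\<exists>K. finite K \<and> A = shortlex_enum ` K"
  proof -
    have "A \<subseteq> range shortlex_enum" unfolding bij_is_surj[OF bij_shortlex_enum] by (rule subset_UNIV)
    from finite_subset_image[OF A(1) this] show ?thesis by blast
  qed
  then obtain K :: "nat set" where K: "finite K" "A = shortlex_enum ` K" by blast
  obtain N where N: "K \<subseteq> {..N}" using finite_nat_iff_bounded_le K(1) by blast
  have form: "p z = b 0 + (\<Sum>\<delta>\<in>shortlex_enum ` {1..n}. b \<delta> * cmonom \<delta> z)" if n: "n \<ge> N" for n z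
  proof -
    have "p z = (\<Sum>\<alpha>\<in>shortlex_enum ` {..n}. b \<alpha> * cmonom \<alpha> z)"
      unfolding A(2) using K(2) N n by (intro sum.mono_neutral_cong_left) (auto simp: b_def)
    also have "{..n} = insert 0 {1..n}" by auto
    also have "(\<Sum>\<alpha>\<in>shortlex_enum ` insert 0 {1..n}. b \<alpha> * cmonom \<alpha> z) = b 0 * cmonom 0 z + (\<Sum>\<delta>\<in>shortlex_enum ` {1..n}. b \<delta> * cmonom \<delta> z)"
    proof -
      have "shortlex_enum 0 \<notin> shortlex_enum ` {1..n}" by (auto simp: inj_shortlex_enum)
      then show ?thesis unfolding image_insert by (subst sum.insert) (auto simp: shortlex_enum_0)
    qed
    finally show ?thesis by (simp add: cmonom_0)
  qed
  have "(\<Sum>\<delta>\<in>shortlex_enum ` {1..N}. b \<delta> * cmonom \<delta> 0) = 0"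
  proof (rule sum.neutral, rule ballI)
    fix \<delta> :: "nat ^ 'd::{finite,linorder}" assume "\<delta> \<in> shortlex_enum ` {1..N}"
    then have "\<delta> \<noteq> 0" by (metis atLeastAtMost_iff imageE less_numeral_extra(3) not_one_le_zero shortlex_enum_0 inj_shortlex_enum)
    then show "b \<delta> * cmonom \<delta> 0 = 0" by (simp add: cmonom_at_0)
  qed
  then have "b 0 = 1" using form[of N 0] p0 by simp
  then show ?thesis using form by (intro that[of N "\<lambda>\<delta>. - b \<delta>"]) (simp add: sum_negf cmonom_0)
qed

text \<open>
  The situation of the theorem, with the weight written out.
\<close>

locale discrete_perturbation = boundary_function g
  for g :: "complex ^ 'd::{finite,linorder} \<Rightarrow> complex" +
  fixes \<mu>\<^sub>s \<mu> :: "(complex ^ 'd::{finite,linorder}) measure" and \<epsilon> :: real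
  assumes \<epsilon>: "\<epsilon> > 0" and lower: "AE z in sphere_measure. \<epsilon> \<le> (cmod (G z))\<^sup>2"
    and discrete: "discrete_sphere_measure \<mu>\<^sub>s" and prob: "prob_space \<mu>" and sets_\<mu>: "sets \<mu> = sets sphere_borel"
    and decomposition: "\<And>A. A \<in> sets \<mu> \<Longrightarrow>
       emeasure \<mu> A = emeasure (density sphere_measure (\<lambda>z. ennreal ((cmod (G z))\<^sup>2))) A + emeasure \<mu>\<^sub>s A"
begin

lemma finite_\<mu>: "finite_measure \<mu>"
  using prob by (rule prob_space.axioms)

lemma sets_\<mu>\<^sub>s: "sets \<mu>\<^sub>s = sets sphere_borel"
  using discrete by (simp add: discrete_sphere_measure_def)

lemma borel_measurable_\<mu>_iff:
  fixes f :: "complex ^ 'd::{finite,linorder} \<Rightarrow> 'b::topological_space"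
  shows "f \<in> borel_measurable \<mu> \<longleftrightarrow> f \<in> borel_measurable sphere_measure"
  using measurable_cong_sets[of \<mu> sphere_measure "borel :: 'b measure" borel] by (simp add: sets_\<mu> sets_sphere_measure)

lemma nn_integral_\<mu>:
  assumes u: "u \<in> borel_measurable \<mu>" "\<And>z. 0 \<le> u z"
  shows "(\<integral>\<^sup>+z. ennreal (u z) \<partial>\<mu>) = (\<integral>\<^sup>+z. ennreal (u z * (cmod (G z))\<^sup>2) \<partial>sphere_measure) + (\<integral>\<^sup>+z. ennreal (u z) \<partial>\<mu>\<^sub>s)"
proof -
  have [measurable]: "u \<in> borel_measurable sphere_measure" using u(1) by (simp add: borel_measurable_\<mu>_iff)
  have "(\<integral>\<^sup>+z. ennreal (u z) \<partial>\<mu>) = (\<integral>\<^sup>+z. ennreal (u z) \<partial>density sphere_measure (\<lambda>z. ennreal ((cmod (G z))\<^sup>2))) + (\<integral>\<^sup>+z. ennreal (u z) \<partial>\<mu>\<^sub>s)"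
    by (rule nn_integral_add_measures) (use u(1) in \<open>auto simp: sets_\<mu> sets_\<mu>\<^sub>s sets_sphere_measure intro!: decomposition\<close>)
  also have "(\<integral>\<^sup>+z. ennreal (u z) \<partial>density sphere_measure (\<lambda>z. ennreal ((cmod (G z))\<^sup>2))) = (\<integral>\<^sup>+z. ennreal (u z * (cmod (G z))\<^sup>2) \<partial>sphere_measure)"
    by (subst nn_integral_density) (auto simp: ennreal_mult u(2) mult.commute)
  finally show ?thesis .
qed

lemma weighted_le_\<mu>:
  assumes q: "continuous_on (sphere 0 1) q"
  shows "(LINT z|sphere_measure. (cmod (q z))\<^sup>2 * (cmod (G z))\<^sup>2) \<le> (LINT z|\<mu>. (cmod (q z))\<^sup>2)"
proof -
  have qi: "integrable \<mu> (\<lambda>z. (cmod (q z))\<^sup>2)" by (intro integrable_sphere_space[OF finite_\<mu> sets_\<mu>] continuous_intros q)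
  have "ennreal (LINT z|sphere_measure. (cmod (q z))\<^sup>2 * (cmod (G z))\<^sup>2) = (\<integral>\<^sup>+z. ennreal ((cmod (q z))\<^sup>2 * (cmod (G z))\<^sup>2) \<partial>sphere_measure)"
    by (intro nn_integral_eq_integral[symmetric] integrable_weighted q) simp
  also have "\<dots> \<le> (\<integral>\<^sup>+z. ennreal ((cmod (q z))\<^sup>2) \<partial>\<mu>)"
    using nn_integral_\<mu>[OF borel_measurable_integrable[OF qi]] by (simp add: le_iff_add)
  also have "\<dots> = ennreal (LINT z|\<mu>. (cmod (q z))\<^sup>2)" by (intro nn_integral_eq_integral qi) simp
  finally show ?thesis by (subst (asm) ennreal_le_iff) auto
qed

lemma positive_moment_kernel: "positive_kernel (moment_kernel \<mu>)"
proof
  show "moment_kernel \<mu> j i = cnj (moment_kernel \<mu> i j)" for i j by (rule moment_kernel_hermitian)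
  fix S :: "(nat ^ 'd::{finite,linorder}) set" and i c
  assume S: "finite S" "i \<in> S" "c i \<noteq> (0 :: complex)"
  define q where "q z = (\<Sum>j\<in>S. c j * cmonom j z)" for z :: "complex ^ 'd::{finite,linorder}"
  have q: "continuous_on (sphere 0 1) q" unfolding q_def by (intro continuous_intros)
  have "0 < \<epsilon> * (LINT z|sphere_measure. (cmod (q z))\<^sup>2)"
    unfolding q_def using integral_polynomial_pos[of S i c] S \<epsilon> by (intro mult_pos_pos) auto
  also have "\<dots> = (LINT z|sphere_measure. (cmod (q z))\<^sup>2 * \<epsilon>)" by simp
  also have "\<dots> \<le> (LINT z|sphere_measure. (cmod (q z))\<^sup>2 * (cmod (G z))\<^sup>2)"
  proof (rule integral_mono_AE[OF _ integrable_weighted[OF q]])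
    show "integrable sphere_measure (\<lambda>z. (cmod (q z))\<^sup>2 * \<epsilon>)" by (intro integrable_sphere continuous_intros q)
    show "AE z in sphere_measure. (cmod (q z))\<^sup>2 * \<epsilon> \<le> (cmod (q z))\<^sup>2 * (cmod (G z))\<^sup>2"
      using lower by eventually_elim (simp add: mult_left_mono)
  qed
  also have "\<dots> \<le> (LINT z|\<mu>. (cmod (q z))\<^sup>2)" by (rule weighted_le_\<mu>[OF q])
  also have "\<dots> = Re (\<Sum>i\<in>S. \<Sum>j\<in>S. c i * moment_kernel \<mu> i j * cnj (c j))"
  proof -
    have "(\<Sum>i\<in>S. \<Sum>j\<in>S. c i * moment_kernel \<mu> i j * cnj (c j)) = of_real (LINT z|\<mu>. (cmod (q z))\<^sup>2)"
      unfolding moment_quadratic_form[OF finite_\<mu> sets_\<mu> S(1) S(1)] integral_complex_of_real[symmetric] complex_norm_square q_def ..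
    then show ?thesis by simp
  qed
  finally show "0 < Re (\<Sum>i\<in>S. \<Sum>j\<in>S. c i * moment_kernel \<mu> i j * cnj (c j))" .
qed

text \<open>
  Start from a polynomial \<open>f\<close> that is nearly optimal for the weight. A finite set \<open>F\<close> of atoms is
  chosen such that the rest of the discrete part contributes at most \<open>\<eta> / 2\<close> to the integral of \<open>|f|\<^sup>2\<close>, and
  multiplication by \<open>peak_product F n\<close> removes the contribution of \<open>F\<close> in the limit. As \<open>F\<close> is chosen
  after the bound \<open>B\<close> of \<open>f\<close>, the growth of the bound \<open>2 ^ card F\<close> of the products does no harm.
\<close>

lemma nearly_optimal_polynomial:
  assumes \<eta>: "\<eta> > 0"
  obtains p where "polynomial_Cn p" "p 0 = 1" "(LINT z|\<mu>. (cmod (p z))\<^sup>2) < (cmod (g 0))\<^sup>2 + \<eta>"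
proof -
  have g0: "g 0 \<noteq> 0" by (rule integral_ln_boundary(2)[OF \<epsilon> lower])
  obtain f where f: "polynomial_Cn f" "f 0 = 1"
    "(LINT z|sphere_measure. (cmod (f z))\<^sup>2 * (cmod (G z))\<^sup>2) < (cmod (g 0))\<^sup>2 + \<eta> / 2"
    using weight_upper_bound[OF g0, of "\<eta> / 2"] \<eta> by auto
  have fc: "continuous_on A f" for A by (rule polynomial_Cn_continuous[OF f(1)])
  have "bounded (f ` sphere 0 1)" by (intro compact_imp_bounded compact_continuous_image fc compact_sphere)
  then obtain B where B: "B > 0" "\<And>z. norm z = 1 \<Longrightarrow> cmod (f z) \<le> B"
    unfolding bounded_pos by (metis (no_types, lifting) dist_0_norm imageI mem_sphere)
  have S\<mu>: "space \<mu> = sphere 0 1" "space \<mu>\<^sub>s = sphere 0 1"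
    by (simp_all add: space_if_sets_sphere sets_\<mu> sets_\<mu>\<^sub>s)
  have "emeasure \<mu>\<^sub>s (sphere 0 1) \<le> emeasure \<mu> (sphere 0 1)"
    using decomposition[of "sphere 0 1"] sets.top[of \<mu>] by (simp add: S\<mu> le_iff_add add.commute)
  also have "\<dots> < \<infinity>" using finite_measure.emeasure_finite[OF finite_\<mu>, of "sphere 0 1"] by (simp add: less_top[symmetric])
  finally have fin: "emeasure \<mu>\<^sub>s (sphere 0 1) < \<infinity>" .
  define e where "e = \<eta> / (2 * B\<^sup>2)"
  have e: "e > 0" "B\<^sup>2 * e = \<eta> / 2" using \<eta> B by (simp_all add: e_def)
  obtain F where F: "finite F" "F \<subseteq> sphere 0 1" "emeasure \<mu>\<^sub>s (sphere 0 1 - F) < ennreal e"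
    using discrete_tail[OF discrete fin e(1)] .
  let ?Q = "peak_product F"
  define H where "H z = f z * indicator (- F) z" for z
  have Qc: "continuous_on A (?Q n)" for A n by (rule polynomial_Cn_continuous[OF polynomial_Cn_peak_product[OF F(1)]])
  have oF: "open (- F)" using F(1) by (intro open_Compl finite_imp_closed)
  have SF: "sphere 0 1 - F \<in> sets \<mu>\<^sub>s"
    using sphere_Int_open_sets[OF oF] by (simp add: sets_\<mu>\<^sub>s sets_sphere_measure Diff_eq)
  have Hm: "(\<lambda>z. (cmod (H z))\<^sup>2) \<in> borel_measurable \<mu>"
  proof -
    have [measurable]: "f \<in> borel_measurable \<mu>" by (rule measurable_sphere_space[OF sets_\<mu> fc])
    have "(\<lambda>z. indicator (sphere 0 1 - F) z :: complex) \<in> borel_measurable \<mu>"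
      using SF sets_\<mu> sets_\<mu>\<^sub>s by simp
    then have "(\<lambda>z. f z * indicator (sphere 0 1 - F) z) \<in> borel_measurable \<mu>" by measurable
    then have "(\<lambda>z. (cmod (f z * indicator (sphere 0 1 - F) z))\<^sup>2) \<in> borel_measurable \<mu>" by measurable
    then show ?thesis
      by (rule measurable_cong[THEN iffD1, rotated]) (auto simp: H_def S\<mu> indicator_def)
  qed
  have HB: "(cmod (H z))\<^sup>2 \<le> B\<^sup>2" if "norm z = 1" for z
    using B(2)[OF that] B(1) by (auto simp: H_def indicator_def intro: power_mono)
  have lim: "(\<lambda>n. LINT z|\<mu>. (cmod (f z * ?Q n z))\<^sup>2) \<longlonglongrightarrow> (LINT z|\<mu>. (cmod (H z))\<^sup>2)"
  proof (rule integral_dominated_convergence[OF Hm])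
    show "integrable \<mu> (\<lambda>z. (B * 2 ^ card F)\<^sup>2)" by (intro integrable_sphere_space[OF finite_\<mu> sets_\<mu>] continuous_intros)
    show "(\<lambda>z. (cmod (f z * ?Q n z))\<^sup>2) \<in> borel_measurable \<mu>" for n
      by (intro measurable_sphere_space[OF sets_\<mu>] continuous_intros fc Qc)
    show "AE z in \<mu>. (\<lambda>n. (cmod (f z * ?Q n z))\<^sup>2) \<longlonglongrightarrow> (cmod (H z))\<^sup>2"
      unfolding H_def by (intro AE_I2 tendsto_intros peak_product_tendsto F) (simp add: S\<mu>)
    show "AE z in \<mu>. norm ((cmod (f z * ?Q n z))\<^sup>2) \<le> (B * 2 ^ card F)\<^sup>2" for n
    proof (rule AE_I2)
      fix z assume "z \<in> space \<mu>"
      then have z: "norm z = 1" by (simp add: S\<mu>)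
      have "cmod (f z * ?Q n z) \<le> B * 2 ^ card F"
        unfolding norm_mult using B peak_product_bound[OF F(2) z] z by (intro mult_mono) auto
      then show "norm ((cmod (f z * ?Q n z))\<^sup>2) \<le> (B * 2 ^ card F)\<^sup>2" by (simp add: power_mono)
    qed
  qed
  have "integrable \<mu> (\<lambda>z. (cmod (H z))\<^sup>2)"
    by (rule finite_measure.integrable_const_bound[OF finite_\<mu>, of _ "B\<^sup>2"]) (auto intro!: AE_I2 Hm HB simp: S\<mu>)
  then have "ennreal (LINT z|\<mu>. (cmod (H z))\<^sup>2) = (\<integral>\<^sup>+z. ennreal ((cmod (H z))\<^sup>2) \<partial>\<mu>)"
    by (intro nn_integral_eq_integral[symmetric]) auto
  also have "\<dots> = (\<integral>\<^sup>+z. ennreal ((cmod (H z))\<^sup>2 * (cmod (G z))\<^sup>2) \<partial>sphere_measure) + (\<integral>\<^sup>+z. ennreal ((cmod (H z))\<^sup>2) \<partial>\<mu>\<^sub>s)"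
    by (rule nn_integral_\<mu>[OF Hm]) simp
  also have "\<dots> \<le> ennreal (LINT z|sphere_measure. (cmod (f z))\<^sup>2 * (cmod (G z))\<^sup>2) + ennreal (\<eta> / 2)"
  proof (rule add_mono)
    have "(\<integral>\<^sup>+z. ennreal ((cmod (H z))\<^sup>2 * (cmod (G z))\<^sup>2) \<partial>sphere_measure) \<le> (\<integral>\<^sup>+z. ennreal ((cmod (f z))\<^sup>2 * (cmod (G z))\<^sup>2) \<partial>sphere_measure)"
      by (intro nn_integral_mono ennreal_leI mult_right_mono) (auto simp: H_def indicator_def)
    also have "\<dots> = ennreal (LINT z|sphere_measure. (cmod (f z))\<^sup>2 * (cmod (G z))\<^sup>2)"
      by (intro nn_integral_eq_integral integrable_weighted fc) simp
    finally show "(\<integral>\<^sup>+z. ennreal ((cmod (H z))\<^sup>2 * (cmod (G z))\<^sup>2) \<partial>sphere_measure) \<le> \<dots>" .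
    have "(\<integral>\<^sup>+z. ennreal ((cmod (H z))\<^sup>2) \<partial>\<mu>\<^sub>s) \<le> (\<integral>\<^sup>+z. ennreal (B\<^sup>2) * indicator (sphere 0 1 - F) z \<partial>\<mu>\<^sub>s)"
    proof (rule nn_integral_mono)
      fix z assume "z \<in> space \<mu>\<^sub>s"
      then have "norm z = 1" by (simp add: S\<mu>)
      then show "ennreal ((cmod (H z))\<^sup>2) \<le> ennreal (B\<^sup>2) * indicator (sphere 0 1 - F) z"
        using HB[of z] by (auto simp: H_def indicator_def intro: ennreal_leI)
    qed
    also have "\<dots> = ennreal (B\<^sup>2) * emeasure \<mu>\<^sub>s (sphere 0 1 - F)"
      by (rule nn_integral_cmult_indicator[OF SF])
    also have "\<dots> \<le> ennreal (B\<^sup>2) * ennreal e" using F(3) by (intro mult_left_mono) (auto intro: less_imp_le)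
    also have "\<dots> = ennreal (B\<^sup>2 * e)" using e by (intro ennreal_mult[symmetric]) auto
    also have "\<dots> = ennreal (\<eta> / 2)" by (simp only: e(2))
    finally show "(\<integral>\<^sup>+z. ennreal ((cmod (H z))\<^sup>2) \<partial>\<mu>\<^sub>s) \<le> ennreal (\<eta> / 2)" .
  qed
  also have "\<dots> = ennreal ((LINT z|sphere_measure. (cmod (f z))\<^sup>2 * (cmod (G z))\<^sup>2) + \<eta> / 2)"
    using \<eta> by (intro ennreal_plus[symmetric]) auto
  finally have "(LINT z|\<mu>. (cmod (H z))\<^sup>2) \<le> (LINT z|sphere_measure. (cmod (f z))\<^sup>2 * (cmod (G z))\<^sup>2) + \<eta> / 2"
    using \<eta> by (subst (asm) ennreal_le_iff) auto
  then have less: "(LINT z|\<mu>. (cmod (H z))\<^sup>2) / (cmod 1)\<^sup>2 < (cmod (g 0))\<^sup>2 + \<eta>" using f(3) by simp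
  have "(\<lambda>n. (LINT z|\<mu>. (cmod (f z * ?Q n z))\<^sup>2) / (cmod (?Q n 0))\<^sup>2) \<longlonglongrightarrow> (LINT z|\<mu>. (cmod (H z))\<^sup>2) / (cmod 1)\<^sup>2"
    by (intro tendsto_intros lim peak_product_0_tendsto) auto
  from order_tendstoD(2)[OF this less]
  have "\<forall>\<^sub>F n in sequentially. (LINT z|\<mu>. (cmod (f z * ?Q n z))\<^sup>2) / (cmod (?Q n 0))\<^sup>2 < (cmod (g 0))\<^sup>2 + \<eta>" .
  moreover have "\<forall>\<^sub>F n in sequentially. ?Q n 0 \<noteq> 0"
    by (intro tendsto_imp_eventually_ne[OF peak_product_0_tendsto]) auto
  ultimately have "\<forall>\<^sub>F n in sequentially. (LINT z|\<mu>. (cmod (f z * ?Q n z))\<^sup>2) / (cmod (?Q n 0))\<^sup>2 < (cmod (g 0))\<^sup>2 + \<eta> \<and> ?Q n 0 \<noteq> 0"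
    by eventually_elim simp
  then obtain n where n: "(LINT z|\<mu>. (cmod (f z * ?Q n z))\<^sup>2) / (cmod (?Q n 0))\<^sup>2 < (cmod (g 0))\<^sup>2 + \<eta>" "?Q n 0 \<noteq> 0"
    by (auto simp: eventually_sequentially)
  show ?thesis
  proof (rule that[of "\<lambda>z. f z * ?Q n z * inverse (?Q n 0)"])
    show "polynomial_Cn (\<lambda>z. f z * ?Q n z * inverse (?Q n 0))"
      by (intro polynomial_Cn_mult f(1) polynomial_Cn_peak_product F(1) polynomial_Cn_const)
    have "(LINT z|\<mu>. (cmod (f z * ?Q n z * inverse (?Q n 0)))\<^sup>2) = (LINT z|\<mu>. (cmod (f z * ?Q n z))\<^sup>2 / (cmod (?Q n 0))\<^sup>2)"
      by (simp only: norm_mult norm_inverse power_mult_distrib divide_inverse power_inverse)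
    also have "\<dots> = (LINT z|\<mu>. (cmod (f z * ?Q n z))\<^sup>2) / (cmod (?Q n 0))\<^sup>2" by simp
    finally show "(LINT z|\<mu>. (cmod (f z * ?Q n z * inverse (?Q n 0)))\<^sup>2) < (cmod (g 0))\<^sup>2 + \<eta>" using n(1) by simp
  qed (use n f in simp)
qed

lemma verblunsky_product_tendsto:
  "(\<lambda>n. \<Prod>k<n. 1 - (cmod (verblunsky \<mu> 0 (shortlex_enum k)))\<^sup>2) \<longlonglongrightarrow> (cmod (g 0))\<^sup>2"
proof -
  interpret positive_kernel "moment_kernel \<mu>" by (rule positive_moment_kernel)
  let ?S = "\<lambda>n. shortlex_enum ` {1..n} :: (nat ^ 'd::{finite,linorder}) set"
  have "moment_kernel \<mu> 0 0 = 1"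
    by (simp add: moment_kernel_def cmonom_0 prob_space.prob_space[OF prob])
  note prod = verblunsky_product_eq_schur[OF positive_moment_kernel this]
  have lo: "(cmod (g 0))\<^sup>2 \<le> Re (schur (?S n) 0 0)" for n
  proof -
    obtain c where c: "Re (schur (?S n) 0 0) = (LINT z|\<mu>. (cmod (cmonom 0 z - (\<Sum>j\<in>?S n. c j * cmonom j z)))\<^sup>2)"
      using prediction_error(1)[OF finite_\<mu> sets_\<mu> positive_moment_kernel, of "?S n" 0] by auto
    define q where "q z = cmonom 0 z - (\<Sum>j\<in>?S n. c j * cmonom j z)" for z
    have q: "polynomial_Cn q" unfolding q_def using polynomial_Cn_monom[of 1 0]
      by (intro polynomial_Cn_diff polynomial_Cn_sum polynomial_Cn_monom) auto
    have "0 \<notin> ?S n" unfolding shortlex_enum_0[symmetric] by (auto simp: inj_shortlex_enum)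
    then have "(\<Sum>j\<in>?S n. c j * cmonom j 0) = 0" by (intro sum.neutral) (auto simp: cmonom_at_0)
    then have "q 0 = 1" by (simp add: q_def cmonom_0)
    then have "(cmod (g 0))\<^sup>2 \<le> (LINT z|sphere_measure. (cmod (q z))\<^sup>2 * (cmod (G z))\<^sup>2)"
      using weight_lower_bound[OF q] by simp
    also have "\<dots> \<le> (LINT z|\<mu>. (cmod (q z))\<^sup>2)"
      by (rule weighted_le_\<mu>[OF polynomial_Cn_continuous[OF q]])
    finally show ?thesis unfolding c q_def .
  qed
  have "(\<lambda>n. Re (schur (?S n) 0 0)) \<longlonglongrightarrow> (cmod (g 0))\<^sup>2"
  proof (rule tendstoI)
    fix \<eta> :: real assume "\<eta> > 0"
    then obtain p where p: "polynomial_Cn p" "p 0 = 1" "(LINT z|\<mu>. (cmod (p z))\<^sup>2) < (cmod (g 0))\<^sup>2 + \<eta>"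
      by (rule nearly_optimal_polynomial)
    obtain N c where c: "\<And>n z. n \<ge> N \<Longrightarrow> p z = cmonom 0 z - (\<Sum>\<delta>\<in>?S n. c \<delta> * cmonom \<delta> z)"
      by (rule polynomial_prediction_form[OF p(1,2)]) (rule that)
    show "\<forall>\<^sub>F n in sequentially. dist (Re (schur (?S n) 0 0)) ((cmod (g 0))\<^sup>2) < \<eta>"
      using eventually_ge_at_top[of N]
    proof eventually_elim
      case (elim n)
      have "Re (schur (?S n) 0 0) \<le> (LINT z|\<mu>. (cmod (p z))\<^sup>2)"
        unfolding c[OF elim] by (rule prediction_error(2)[OF finite_\<mu> sets_\<mu> positive_moment_kernel]) simp
      then show ?case using p(3) lo[of n] by (simp add: dist_real_def)
    qed
  qed
  then show ?thesis unfolding prod[symmetric] by (rule LIMSEQ_imp_Suc)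
qed

end

theorem theorem7p3:
  fixes g :: "complex ^ 'd::{finite,linorder} \<Rightarrow> complex"
    and w :: "complex ^ 'd::{finite,linorder} \<Rightarrow> real"
    and \<mu>\<^sub>s \<mu> :: "(complex ^ 'd::{finite,linorder}) measure"
    and \<gamma> :: "nat ^ 'd::{finite,linorder} \<Rightarrow> nat ^ 'd::{finite,linorder} \<Rightarrow> complex"
  assumes "g \<in> H_infinity"
    and "H_infinity_norm g \<le> 1"
    and "\<And>z. z \<in> ball 0 1 \<Longrightarrow> Re (g z) \<ge> 0"
    and w: "w = (\<lambda>\<zeta>. (cmod (K_limit g \<zeta>))\<^sup>2)"
    and "\<exists>\<epsilon>>0. AE \<zeta> in sphere_measure. w \<zeta> \<ge> \<epsilon>"
    and "discrete_sphere_measure \<mu>\<^sub>s"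
    and "prob_space \<mu>"
    and "sets \<mu> = sets sphere_borel"
    and "\<And>A. A \<in> sets \<mu> \<Longrightarrow>
           emeasure \<mu> A = emeasure (density sphere_measure w) A + emeasure \<mu>\<^sub>s A"
    and \<gamma>: "\<gamma> = verblunsky \<mu>"
  shows "has_shortlex_prod (\<lambda>\<alpha>. 1 - (cmod (\<gamma> 0 \<alpha>))\<^sup>2) (exp (LINT \<zeta>|sphere_measure. ln (w \<zeta>)))
       \<and> integrable sphere_measure (\<lambda>\<zeta>. ln (w \<zeta>))
       \<and> exp (LINT \<zeta>|sphere_measure. ln (w \<zeta>)) > 0"
proof -
  obtain \<epsilon> where \<epsilon>: "\<epsilon> > 0" "AE \<zeta> in sphere_measure. \<epsilon> \<le> (cmod (K_limit g \<zeta>))\<^sup>2"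
    using assms(5) unfolding w by blast
  interpret discrete_perturbation g \<mu>\<^sub>s \<mu> \<epsilon>
  proof (intro discrete_perturbation.intro boundary_function.intro discrete_perturbation_axioms.intro)
    show "line_holomorphic g (ball 0 1)"
      using assms(1) by (intro holomorphic_Cn_imp_line_holomorphic) (simp add: H_infinity_def)
    obtain M where "\<And>z. z \<in> ball 0 1 \<Longrightarrow> cmod (g z) \<le> M"
      using assms(1) unfolding H_infinity_def bounded_iff by blast
    then have "bdd_above ((\<lambda>z. cmod (g z)) ` ball 0 1)" by (rule bdd_aboveI2)
    then show "cmod (g z) \<le> 1" if "z \<in> ball 0 1" for z
      using cSUP_upper[OF that] assms(2) unfolding H_infinity_norm_def by force
    show "emeasure \<mu> A = emeasure (density sphere_measure (\<lambda>z. ennreal ((cmod (K_limit g z))\<^sup>2))) A + emeasure \<mu>\<^sub>s A"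
      if "A \<in> sets \<mu>" for A
      using assms(9)[OF that] unfolding w .
  qed (fact assms \<epsilon>)+
  show ?thesis
    unfolding has_shortlex_prod_def \<gamma> w integral_ln_boundary(3)[OF \<epsilon> lower]
  proof (intro conjI)
    show "0 < (cmod (g 0))\<^sup>2" using integral_ln_boundary(2)[OF \<epsilon> lower] by simp
  qed (rule verblunsky_product_tendsto integral_ln_boundary(1)[OF \<epsilon> lower])+
qed

end
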